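(* Let $H$ be a Lie group with Lie algebra $\mathfrak h$, let $L:\mathrm{T}H\approx H\times\mathfrak h\to\mathbb R$ be a smooth Lagrangian, let $d\subset\mathfrak h$ be a linear subspace defining the left-invariant constraints distribution $D=H\times d\subset \mathrm{T}H$, and let $\mathfrak h=d\oplus d'$ be a splitting into linear subspaces with projections $P:\mathfrak h\to d$, $P':\mathfrak h\to d'$. With the notation of the context: (a) A nonholonomic extremal $(h(t),\eta(t))\in H\times d$ is an unconstrained extremal if and only if for every $t\in[t_0,t_1]$ the covector $$h(t)^*\Big(\frac{\partial L}{\partial h}\Big)-\frac{\mathrm d}{\mathrm dt}\Big(\frac{\partial L}{\partial\eta}\Big)+\operatorname{ad}^*_{\eta(t)}\Big(\frac{\partial L}{\partial \eta}\Big)\in\mathfrak h^*$$ annihilates every $b\in d'\subset\mathfrak h$. (b) A nonholonomic extremal $(h(t),\eta(t))\in H\times d$ is a vakonomic extremal if and only if $$\int_I\Big\langle h(t)^*\Big(\frac{\partial L}{\partial h}\Big)+\operatorname{ad}^*_{\eta(t)}P^*\Big(\frac{\partial L}{\partial\eta}\Big),b(t)\Big\rangle\mathrm dt=\int_I\Big\langle\operatorname{ad}^*_{\eta(t)}(P')^*\Big(\frac{\partial L}{\partial\eta}\Big),a(t)\Big\rangle\mathrm dt$$ for every pair of curves $a(t)\in d$ and $b(t)\in d'$ vanishing at the end-points and related by $$\dot b(t)+P'[\eta(t),a(t)]_{\mathfrak h}+P'[\eta(t),b(t)]_{\mathfrak h}=0.$$ (c) A vakonomic extremal $(h(t),\eta(t))\in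 H\times d$ corresponding to a multiplier $\lambda(t)=(P')^*\lambda(t)\in\operatorname{Ann}(d)\approx(d')^*\subset\mathfrak h^*$, i.e. a solution of the unconstrained problem with the modified Lagrangian $\widetilde L(h,\eta,t)=L(h,\eta)-\langle\lambda(t),P'(\eta)\rangle$, is a nonholonomic extremal if and only if $$\langle\lambda(t),P'[\eta(t),a]_{\mathfrak h}\rangle=0$$ for every $t\in[t_0,t_1]$ and every $a\in d$.
   Context: Everything is $C^\infty$; $I=[t_0,t_1]$ is a fixed interval. Variations. For a manifold $Q$, $\kappa_Q:\mathrm{TT}Q\to\mathrm{TT}Q$ is the canonical flip, $(q^a,\dot q^b,q'^c,\dot q'^d)\mapsto(q^a,q'^b,\dot q^c,\dot q'^d)$ in induced coordinates. If $\gamma(t)\in\mathrm TQ$ is the tangent lift of a curve $q(t)$ (an admissible path) and $\xi(t)\in\mathrm T_{q(t)}Q$ is a curve (generator), the admissible variation generated by $\xi$ is $\delta_\xi\gamma(t)=\kappa_Q(\mathrm T_t\xi(t))\in\mathrm T_{\gamma(t)}\mathrm TQ$, where $\mathrm T_t\xi(t)$ is the tangent lift of the curve $\xi$; and $\langle\mathrm dS_L(\gamma),\delta\gamma\rangle=\int_I\langle\mathrm dL(\gamma(t)),\delta\gamma(t)\rangle\mathrm dt$ (for a time-dependent Lagrangian, differentiate in the $\mathrm TQ$ variable). Lie group setting ($Q=H$). $\mathfrak h=\mathrm T_eH$ with the left Lie bracket $[\cdot,\cdot]_{\mathfrak h}$; $\mathrm TH\approx H\times\mathfrak h$ via $(h,\eta)\mapsto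 h_*\eta$ (left translation). A curve $(h(t),\eta(t))$ is admissible if $h(t)_*\eta(t)$ is the tangent lift of $h(t)$; generators are written as $\xi(t)\in\mathfrak h$ (standing for $h(t)_*\xi(t)$). An admissible curve with $\eta(t)\in d$ is: an unconstrained extremal if $\langle\mathrm dS_L,\delta_\xi\eta\rangle=0$ for all generators $\xi(t)\in\mathfrak h$ with $\xi(t_0)=\xi(t_1)=0$; a nonholonomic extremal if this holds for all such $\xi$ with $\xi(t)\in d$; a vakonomic extremal if this holds for all such $\xi$ for which the admissible variation is tangent to $D$ for all $t$. Notation. $\frac{\partial L}{\partial h}\in\mathrm T_h^*H$ and $\frac{\partial L}{\partial\eta}\in\mathfrak h^*$ are the partial differentials of $L(h,\eta)$, evaluated at $(h(t),\eta(t))$; $\langle h^*\phi,\xi\rangle=\langle\phi,h_*\xi\rangle$ for $\phi\in\mathrm T^*_hH$, $\xi\in\mathfrak h$; $\langle\operatorname{ad}^*_\eta\phi,\cdot\rangle=\langle\phi,[\eta,\cdot]_{\mathfrak h}\rangle$ for $\phi\in\mathfrak h^*$; $P^*,(P')^*$ are the dual maps, regarded as maps $\mathfrak h^*\to\mathfrak h^*$ by viewing $P,P'$ as maps $\mathfrak h\to\mathfrak h$; $\operatorname{Ann}(d)\subset\mathfrak h^*$ is the annihilator of $d$. *)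

theory Defs
  imports "HOL-Analysis.Analysis" "HOL-Algebra.Group"
begin

section \<open>Smooth maps between subsets of normed spaces\<close>

text \<open>
  The derivative is taken within \<open>S\<close>, so that open sets and nondegenerate intervals (with one-sided
  derivatives at the end-points) are treated uniformly; only such \<open>S\<close> occur below. In finite
  dimension, continuity of \<open>x \<mapsto> f' x v\<close> for every \<open>v\<close> is continuity of \<open>f'\<close> in the operator norm.
\<close>

primrec Ck_on :: "nat \<Rightarrow> 'x::real_normed_vector set \<Rightarrow> ('x \<Rightarrow> 'y::real_normed_vector) \<Rightarrow> bool" where
  "Ck_on 0 S f \<longleftrightarrow> continuous_on S f"
| "Ck_on (Suc k) S f \<longleftrightarrow>
     (\<exists>f'. (\<forall>x\<in>S. (f has_derivative f' x) (at x within S)) \<and> (\<forall>v. Ck_on k S (\<lambda>x. f' x v)))"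

definition smooth_on :: "'x::real_normed_vector set \<Rightarrow> ('x \<Rightarrow> 'y::real_normed_vector) \<Rightarrow> bool" where
  "smooth_on S f \<longleftrightarrow> (\<forall>k. Ck_on k S f)"

section \<open>Manifolds\<close>

text \<open>
  A chart \<open>c\<close> is a pair of its domain and its coordinate map. A manifold comes with an atlas and
  a preferred chart around every point. A tangent vector at \<open>p\<close> is recorded as \<open>(p, v)\<close>, where
  \<open>v\<close> is its component vector in the preferred chart at \<open>p\<close>; its components in any other chart
  are given by the Jacobian of the transition map. Hence every tangent space is
  a copy of the model space \<open>'e\<close>.
\<close>

type_synonym ('a, 'e) chart = "'a set \<times> ('a \<Rightarrow> 'e)"

record ('a, 'e) manifold =
  points :: "'a set"
  atlas :: "('a, 'e) chart set"
  chart_at :: "'a \<Rightarrow> ('a, 'e) chart"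

abbreviation chart_inv :: "('a, 'e) chart \<Rightarrow> 'e \<Rightarrow> 'a" where
  "chart_inv c \<equiv> inv_into (fst c) (snd c)"

definition transition :: "('a, 'e) chart \<Rightarrow> ('a, 'e) chart \<Rightarrow> 'e \<Rightarrow> 'e" where
  "transition c c' = snd c' \<circ> chart_inv c"

text \<open>Component vector at \<open>p\<close>: the coordinates of \<open>p\<close> in its own preferred chart.\<close>

definition coord_at :: "('a, 'e) manifold \<Rightarrow> 'a \<Rightarrow> 'e" where
  "coord_at M p = snd (chart_at M p) p"

definition manifold_topology :: "('a, 'e::real_normed_vector) manifold \<Rightarrow> 'a topology" where
  "manifold_topology M =
     topology (\<lambda>W. W \<subseteq> points M \<and> (\<forall>c\<in>atlas M. open (snd c ` (W \<inter> fst c))))"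

lemma openin_manifold_topology:
  assumes "\<forall>c\<in>atlas M. inj_on (snd c) (fst c)"
  shows "openin (manifold_topology M) W \<longleftrightarrow>
    W \<subseteq> points M \<and> (\<forall>c\<in>atlas M. open (snd c ` (W \<inter> fst c)))"
proof -
  let ?T = "\<lambda>W. W \<subseteq> points M \<and> (\<forall>c\<in>atlas M. open (snd c ` (W \<inter> fst c)))"
  have "istopology ?T"
    unfolding istopology_def
  proof (intro conjI allI impI)
    fix S T assume ST: "?T S" "?T T"
    show "S \<inter> T \<subseteq> points M" using ST by blast
    show "\<forall>c\<in>atlas M. open (snd c ` (S \<inter> T \<inter> fst c))"
    proof
      fix c assume c: "c \<in> atlas M"
      have "snd c ` (S \<inter> T \<inter> fst c) = snd c ` (S \<inter> fst c) \<inter> snd c ` (T \<inter> fst c)"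
        using assms c by (auto simp: inj_on_def)
      then show "open (snd c ` (S \<inter> T \<inter> fst c))" using ST c by auto
    qed
  next
    fix K assume K: "\<forall>S\<in>K. ?T S"
    show "\<Union>K \<subseteq> points M" using K by blast
    show "\<forall>c\<in>atlas M. open (snd c ` (\<Union>K \<inter> fst c))"
    proof
      fix c assume c: "c \<in> atlas M"
      have "snd c ` (\<Union>K \<inter> fst c) = (\<Union>S\<in>K. snd c ` (S \<inter> fst c))" by blast
      then show "open (snd c ` (\<Union>K \<inter> fst c))" using K c by auto
    qed
  qed
  then show ?thesis
    by (simp add: manifold_topology_def topology_inverse')
qed

text \<open>
  The model space is finite-dimensional; dimension \<open>0\<close> is allowed (which is why it is not taken
  from the class \<open>euclidean_space\<close>).
\<close>

definition smooth_manifold :: "('a, 'e::real_normed_vector) manifold \<Rightarrow> bool" where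
  "smooth_manifold M \<longleftrightarrow>
     (\<exists>B::'e set. finite B \<and> span B = UNIV) \<and>
     (\<Union>c\<in>atlas M. fst c) = points M \<and>
     (\<forall>c\<in>atlas M. inj_on (snd c) (fst c) \<and> open (snd c ` fst c)) \<and>
     (\<forall>c\<in>atlas M. \<forall>c'\<in>atlas M. open (snd c ` (fst c \<inter> fst c')) \<and>
        smooth_on (snd c ` (fst c \<inter> fst c')) (transition c c')) \<and>
     (\<forall>p\<in>points M. chart_at M p \<in> atlas M \<and> p \<in> fst (chart_at M p)) \<and>
     Hausdorff_space (manifold_topology M) \<and>
     second_countable (manifold_topology M)"

definition prod_manifold ::
  "('a, 'e) manifold \<Rightarrow> ('b, 'f) manifold \<Rightarrow> ('a \<times> 'b, 'e \<times> 'f) manifold" where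
  "prod_manifold M N =
     (let prod_chart = (\<lambda>c c'. (fst c \<times> fst c', \<lambda>(p, q). (snd c p, snd c' q)))
      in \<lparr> points = points M \<times> points N,
           atlas = {prod_chart c c' | c c'. c \<in> atlas M \<and> c' \<in> atlas N},
           chart_at = (\<lambda>(p, q). prod_chart (chart_at M p) (chart_at N q)) \<rparr>)"

text \<open>In the next three definitions openness of the preimages of chart domains expresses continuity.\<close>

definition smooth_map ::
  "('a, 'e::real_normed_vector) manifold \<Rightarrow> ('b, 'f::real_normed_vector) manifold \<Rightarrow> ('a \<Rightarrow> 'b) \<Rightarrow> bool"
where
  "smooth_map M N f \<longleftrightarrow>
     f ` points M \<subseteq> points N \<and>
     (\<forall>c\<in>atlas M. \<forall>c'\<in>atlas N. open (snd c ` (fst c \<inter> f -` fst c')) \<and>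
        smooth_on (snd c ` (fst c \<inter> f -` fst c')) (snd c' \<circ> f \<circ> chart_inv c))"

definition smooth_fun :: "('a, 'e::real_normed_vector) manifold \<Rightarrow> ('a \<Rightarrow> real) \<Rightarrow> bool" where
  "smooth_fun M f \<longleftrightarrow> (\<forall>c\<in>atlas M. smooth_on (snd c ` fst c) (f \<circ> chart_inv c))"

definition smooth_curve ::
  "('a, 'e::real_normed_vector) manifold \<Rightarrow> real set \<Rightarrow> (real \<Rightarrow> 'a) \<Rightarrow> bool" where
  "smooth_curve M I x \<longleftrightarrow>
     x ` I \<subseteq> points M \<and>
     (\<forall>c\<in>atlas M. openin (top_of_set I) (I \<inter> x -` fst c) \<and>
        smooth_on (I \<inter> x -` fst c) (snd c \<circ> x))"

section \<open>Tangent bundles\<close>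

text \<open>The chart of the tangent bundle induced by a chart \<open>c\<close> of \<open>M\<close>.\<close>

definition tangent_chart ::
  "('a, 'e::real_normed_vector) manifold \<Rightarrow> ('a, 'e) chart \<Rightarrow> ('a \<times> 'e, 'e \<times> 'e) chart" where
  "tangent_chart M c =
     (fst c \<times> UNIV,
      \<lambda>(p, v). (snd c p, frechet_derivative (transition (chart_at M p) c) (at (coord_at M p)) v))"

definition tangent_bundle ::
  "('a, 'e::real_normed_vector) manifold \<Rightarrow> ('a \<times> 'e, 'e \<times> 'e) manifold" where
  "tangent_bundle M =
     \<lparr> points = points M \<times> UNIV,
       atlas = tangent_chart M ` atlas M,
       chart_at = (\<lambda>(p, v). tangent_chart M (chart_at M p)) \<rparr>"

definition tangent_map ::
  "('a, 'e::real_normed_vector) manifold \<Rightarrow> ('b, 'f::real_normed_vector) manifold \<Rightarrow>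
     ('a \<Rightarrow> 'b) \<Rightarrow> 'a \<times> 'e \<Rightarrow> 'b \<times> 'f" where
  "tangent_map M N f = (\<lambda>(p, v).
     (f p, frechet_derivative (snd (chart_at N (f p)) \<circ> f \<circ> chart_inv (chart_at M p))
             (at (coord_at M p)) v))"

definition differential ::
  "('a, 'e::real_normed_vector) manifold \<Rightarrow> ('a \<Rightarrow> real) \<Rightarrow> 'a \<times> 'e \<Rightarrow> real" where
  "differential M f = (\<lambda>(p, v).
     frechet_derivative (f \<circ> chart_inv (chart_at M p)) (at (coord_at M p)) v)"

definition tangent_lift ::
  "('a, 'e::real_normed_vector) manifold \<Rightarrow> real set \<Rightarrow> (real \<Rightarrow> 'a) \<Rightarrow> real \<Rightarrow> 'a \<times> 'e" where
  "tangent_lift M I x t =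
     (x t, vector_derivative (snd (chart_at M (x t)) \<circ> x) (at t within I))"

text \<open>
  The preferred chart of \<open>tangent_bundle M\<close> at \<open>(p, v)\<close> is induced by the preferred chart of \<open>M\<close>
  at \<open>p\<close>, and in the latter \<open>(p, v)\<close> has fibre component \<open>v\<close>. So an element \<open>((p, v), (a, b))\<close> of the
  double tangent bundle has induced coordinates \<open>(coord_at M p, v, a, b)\<close> and the flip, which
  exchanges the two middle ones, takes the form below. (By symmetry of second derivatives the flip
  has this form in the coordinates induced by any chart.)
\<close>

definition canonical_flip :: "('a \<times> 'e) \<times> ('e \<times> 'e) \<Rightarrow> ('a \<times> 'e) \<times> ('e \<times> 'e)" where
  "canonical_flip = (\<lambda>((p, v), (a, b)). ((p, a), (v, b)))"

text \<open>
  For an embedded submanifold \<open>S\<close>, such as a left-invariant distribution, the velocities of curves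
  running inside \<open>S\<close> are exactly the elements of its tangent spaces.
\<close>

definition tangent_to ::
  "('a, 'e::real_normed_vector) manifold \<Rightarrow> 'a set \<Rightarrow> 'a \<times> 'e \<Rightarrow> bool" where
  "tangent_to N S w \<longleftrightarrow>
     (\<exists>\<epsilon>>0. \<exists>x. smooth_curve N {-\<epsilon><..<\<epsilon>} x \<and> x ` {-\<epsilon><..<\<epsilon>} \<subseteq> S \<and>
        tangent_lift N {-\<epsilon><..<\<epsilon>} x 0 = w)"

text \<open>
  Lie bracket of vector fields \<open>X p \<in> T\<^sub>p M\<close>, computed at \<open>p\<close> in the preferred chart at \<open>p\<close>:
  \<open>[X, Y] = DY(X) - DX(Y)\<close>.
\<close>

definition vector_field_rep ::
  "('a, 'e::real_normed_vector) manifold \<Rightarrow> ('a, 'e) chart \<Rightarrow> ('a \<Rightarrow> 'a \<times> 'e) \<Rightarrow> 'e \<Rightarrow> 'e" where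
  "vector_field_rep M c X = (\<lambda>x. snd (snd (tangent_chart M c) (X (chart_inv c x))))"

definition lie_bracket ::
  "('a, 'e::real_normed_vector) manifold \<Rightarrow> ('a \<Rightarrow> 'a \<times> 'e) \<Rightarrow> ('a \<Rightarrow> 'a \<times> 'e) \<Rightarrow> 'a \<Rightarrow> 'a \<times> 'e" where
  "lie_bracket M X Y p =
     (let X' = vector_field_rep M (chart_at M p) X;
          Y' = vector_field_rep M (chart_at M p) Y;
          x = coord_at M p
      in (p, frechet_derivative Y' (at x) (X' x) - frechet_derivative X' (at x) (Y' x)))"

section \<open>Lie groups\<close>

definition lie_group :: "('a, 'g) monoid_scheme \<Rightarrow> ('a, 'e::real_normed_vector) manifold \<Rightarrow> bool" where
  "lie_group G M \<longleftrightarrow>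
     group G \<and> smooth_manifold M \<and> points M = carrier G \<and>
     smooth_map (prod_manifold M M) M (\<lambda>(g, h). g \<otimes>\<^bsub>G\<^esub> h) \<and>
     smooth_map M M (\<lambda>g. inv\<^bsub>G\<^esub> g)"

text \<open>
  The Lie algebra is the tangent space at \<open>\<one>\<close>, i.e. the model space \<open>'e\<close> (components in the
  preferred chart at \<open>\<one>\<close>).
  \<open>left_push G M h \<eta>\<close> is \<open>h\<^sub>*\<eta>\<close>, and \<open>left_pull G M (h, v)\<close> is the \<open>\<eta>\<close> with \<open>h\<^sub>*\<eta> = (h, v)\<close>.
\<close>

definition left_push ::
  "('a, 'g) monoid_scheme \<Rightarrow> ('a, 'e::real_normed_vector) manifold \<Rightarrow> 'a \<Rightarrow> 'e \<Rightarrow> 'a \<times> 'e" where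
  "left_push G M h \<eta> = tangent_map M M (\<lambda>g. h \<otimes>\<^bsub>G\<^esub> g) (\<one>\<^bsub>G\<^esub>, \<eta>)"

definition left_pull ::
  "('a, 'g) monoid_scheme \<Rightarrow> ('a, 'e::real_normed_vector) manifold \<Rightarrow> 'a \<times> 'e \<Rightarrow> 'e" where
  "left_pull G M w = snd (tangent_map M M (\<lambda>g. inv\<^bsub>G\<^esub> (fst w) \<otimes>\<^bsub>G\<^esub> g) w)"

definition lie_algebra_bracket ::
  "('a, 'g) monoid_scheme \<Rightarrow> ('a, 'e::real_normed_vector) manifold \<Rightarrow> 'e \<Rightarrow> 'e \<Rightarrow> 'e" where
  "lie_algebra_bracket G M \<eta> \<xi> =
     snd (lie_bracket M (\<lambda>h. left_push G M h \<eta>) (\<lambda>h. left_push G M h \<xi>) \<one>\<^bsub>G\<^esub>)"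

definition ad_star ::
  "('a, 'g) monoid_scheme \<Rightarrow> ('a, 'e::real_normed_vector) manifold \<Rightarrow> 'e \<Rightarrow> ('e \<Rightarrow> real) \<Rightarrow> 'e \<Rightarrow> real"
where
  "ad_star G M \<eta> \<phi> = (\<lambda>\<xi>. \<phi> (lie_algebra_bracket G M \<eta> \<xi>))"

text \<open>\<open>h\<^sup>*\<phi>\<close> for a covector \<open>\<phi>\<close> on the tangent space at \<open>h\<close>.\<close>

definition covector_pull ::
  "('a, 'g) monoid_scheme \<Rightarrow> ('a, 'e::real_normed_vector) manifold \<Rightarrow> 'a \<Rightarrow> ('a \<times> 'e \<Rightarrow> real) \<Rightarrow>
     'e \<Rightarrow> real" where
  "covector_pull G M h \<phi> = (\<lambda>\<xi>. \<phi> (left_push G M h \<xi>))"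

definition dual_map :: "('e \<Rightarrow> 'e) \<Rightarrow> ('e \<Rightarrow> real) \<Rightarrow> 'e \<Rightarrow> real" where
  "dual_map A \<phi> = \<phi> \<circ> A"

definition annihilator :: "'e::real_vector set \<Rightarrow> ('e \<Rightarrow> real) set" where
  "annihilator d = {\<phi>. linear \<phi> \<and> (\<forall>x\<in>d. \<phi> x = 0)}"

definition splitting ::
  "'e::real_vector set \<Rightarrow> 'e set \<Rightarrow> ('e \<Rightarrow> 'e) \<Rightarrow> ('e \<Rightarrow> 'e) \<Rightarrow> bool" where
  "splitting d d' P P' \<longleftrightarrow>
     subspace d \<and> subspace d' \<and> d \<inter> d' = {0} \<and>
     (\<forall>x. P x \<in> d \<and> P' x \<in> d' \<and> P x + P' x = x)"

section \<open>Lagrangians and extremals\<close>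

text \<open>
  Lagrangians are functions on the tangent bundle; the partial differentials are those of
  \<open>(h, \<eta>) \<mapsto> L (h\<^sub>*\<eta>)\<close>.
\<close>

definition partial_h ::
  "('a, 'g) monoid_scheme \<Rightarrow> ('a, 'e::real_normed_vector) manifold \<Rightarrow> ('a \<times> 'e \<Rightarrow> real) \<Rightarrow>
     'a \<Rightarrow> 'e \<Rightarrow> 'a \<times> 'e \<Rightarrow> real" where
  "partial_h G M L h \<eta> =
     (\<lambda>w. if fst w = h then differential M (\<lambda>g. L (left_push G M g \<eta>)) w else 0)"

definition partial_eta ::
  "('a, 'g) monoid_scheme \<Rightarrow> ('a, 'e::real_normed_vector) manifold \<Rightarrow> ('a \<times> 'e \<Rightarrow> real) \<Rightarrow>
     'a \<Rightarrow> 'e \<Rightarrow> 'e \<Rightarrow> real" where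
  "partial_eta G M L h \<eta> = frechet_derivative (\<lambda>\<zeta>. L (left_push G M h \<zeta>)) (at \<eta>)"

definition covector_derivative :: "real set \<Rightarrow> (real \<Rightarrow> 'e \<Rightarrow> real) \<Rightarrow> real \<Rightarrow> 'e \<Rightarrow> real" where
  "covector_derivative I \<phi> t = (\<lambda>\<xi>. vector_derivative (\<lambda>s. \<phi> s \<xi>) (at t within I))"

definition admissible ::
  "('a, 'g) monoid_scheme \<Rightarrow> ('a, 'e::real_normed_vector) manifold \<Rightarrow> real set \<Rightarrow>
     (real \<Rightarrow> 'a) \<Rightarrow> (real \<Rightarrow> 'e) \<Rightarrow> bool" where
  "admissible G M I h \<eta> \<longleftrightarrow>
     smooth_curve M I h \<and> smooth_on I \<eta> \<and>
     (\<forall>t\<in>I. left_push G M (h t) (\<eta> t) = tangent_lift M I h t)"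

definition admissible_variation ::
  "('a, 'g) monoid_scheme \<Rightarrow> ('a, 'e::real_normed_vector) manifold \<Rightarrow> real set \<Rightarrow>
     (real \<Rightarrow> 'a) \<Rightarrow> (real \<Rightarrow> 'e) \<Rightarrow> real \<Rightarrow> ('a \<times> 'e) \<times> ('e \<times> 'e)" where
  "admissible_variation G M I h \<xi> t =
     canonical_flip (tangent_lift (tangent_bundle M) I (\<lambda>s. left_push G M (h s) (\<xi> s)) t)"

text \<open>The Lagrangian may depend on time; the base point of \<open>w t\<close> is the point \<open>\<gamma> t\<close>.\<close>

definition action_differential ::
  "('a, 'e::real_normed_vector) manifold \<Rightarrow> real set \<Rightarrow> (real \<Rightarrow> 'a \<times> 'e \<Rightarrow> real) \<Rightarrow>
     (real \<Rightarrow> ('a \<times> 'e) \<times> ('e \<times> 'e)) \<Rightarrow> real" where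
  "action_differential M I L w = integral I (\<lambda>t. differential (tangent_bundle M) (L t) (w t))"

definition generators :: "real \<Rightarrow> real \<Rightarrow> (real \<Rightarrow> 'e::real_normed_vector) set" where
  "generators t0 t1 = {\<xi>. smooth_on {t0..t1} \<xi> \<and> \<xi> t0 = 0 \<and> \<xi> t1 = 0}"

definition constraint_distribution ::
  "('a, 'g) monoid_scheme \<Rightarrow> ('a, 'e::real_normed_vector) manifold \<Rightarrow> 'e set \<Rightarrow> ('a \<times> 'e) set" where
  "constraint_distribution G M d = {left_push G M h \<eta> | h \<eta>. h \<in> carrier G \<and> \<eta> \<in> d}"

definition extremal_wrt ::
  "('a, 'g) monoid_scheme \<Rightarrow> ('a, 'e::real_normed_vector) manifold \<Rightarrow> real \<Rightarrow> real \<Rightarrow> 'e set \<Rightarrow>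
     (real \<Rightarrow> 'e) set \<Rightarrow> (real \<Rightarrow> 'a \<times> 'e \<Rightarrow> real) \<Rightarrow> (real \<Rightarrow> 'a) \<Rightarrow> (real \<Rightarrow> 'e) \<Rightarrow> bool" where
  "extremal_wrt G M t0 t1 d V L h \<eta> \<longleftrightarrow>
     admissible G M {t0..t1} h \<eta> \<and> (\<forall>t\<in>{t0..t1}. \<eta> t \<in> d) \<and>
     (\<forall>\<xi>\<in>V. action_differential M {t0..t1} L (admissible_variation G M {t0..t1} h \<xi>) = 0)"

definition unconstrained_extremal ::
  "('a, 'g) monoid_scheme \<Rightarrow> ('a, 'e::real_normed_vector) manifold \<Rightarrow> real \<Rightarrow> real \<Rightarrow> 'e set \<Rightarrow>
     (real \<Rightarrow> 'a \<times> 'e \<Rightarrow> real) \<Rightarrow> (real \<Rightarrow> 'a) \<Rightarrow> (real \<Rightarrow> 'e) \<Rightarrow> bool" where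
  "unconstrained_extremal G M t0 t1 d L h \<eta> \<longleftrightarrow>
     extremal_wrt G M t0 t1 d (generators t0 t1) L h \<eta>"

definition nonholonomic_extremal ::
  "('a, 'g) monoid_scheme \<Rightarrow> ('a, 'e::real_normed_vector) manifold \<Rightarrow> real \<Rightarrow> real \<Rightarrow> 'e set \<Rightarrow>
     (real \<Rightarrow> 'a \<times> 'e \<Rightarrow> real) \<Rightarrow> (real \<Rightarrow> 'a) \<Rightarrow> (real \<Rightarrow> 'e) \<Rightarrow> bool" where
  "nonholonomic_extremal G M t0 t1 d L h \<eta> \<longleftrightarrow>
     extremal_wrt G M t0 t1 d {\<xi> \<in> generators t0 t1. \<forall>t\<in>{t0..t1}. \<xi> t \<in> d} L h \<eta>"

definition vakonomic_extremal ::
  "('a, 'g) monoid_scheme \<Rightarrow> ('a, 'e::real_normed_vector) manifold \<Rightarrow> real \<Rightarrow> real \<Rightarrow> 'e set \<Rightarrow>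
     (real \<Rightarrow> 'a \<times> 'e \<Rightarrow> real) \<Rightarrow> (real \<Rightarrow> 'a) \<Rightarrow> (real \<Rightarrow> 'e) \<Rightarrow> bool" where
  "vakonomic_extremal G M t0 t1 d L h \<eta> \<longleftrightarrow>
     extremal_wrt G M t0 t1 d
       {\<xi> \<in> generators t0 t1. \<forall>t\<in>{t0..t1}.
          tangent_to (tangent_bundle M) (constraint_distribution G M d)
            (admissible_variation G M {t0..t1} h \<xi> t)} L h \<eta>"

text \<open>\<open>L(h, \<eta>) - \<langle>\<lambda>(t), P'(\<eta>)\<rangle>\<close> as a time-dependent function on the tangent bundle.\<close>

definition modified_lagrangian ::
  "('a, 'g) monoid_scheme \<Rightarrow> ('a, 'e::real_normed_vector) manifold \<Rightarrow> ('e \<Rightarrow> 'e) \<Rightarrow>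
     ('a \<times> 'e \<Rightarrow> real) \<Rightarrow> (real \<Rightarrow> 'e \<Rightarrow> real) \<Rightarrow> real \<Rightarrow> 'a \<times> 'e \<Rightarrow> real" where
  "modified_lagrangian G M P' L lam t w = L w - lam t (P' (left_pull G M w))"

text \<open>
  A multiplier is a smooth curve in the annihilator of \<open>d\<close>, fixed by the dual of \<open>P'\<close>;
  smoothness of a curve in the (finite-dimensional) dual space is smoothness of all its evaluations.
  A vakonomic extremal corresponding to a multiplier is by definition a solution of
  the unconstrained problem for the modified Lagrangian (along curves in \<open>d\<close>); on variations
  tangent to the constraint the extra term does not contribute.
\<close>

definition multiplier ::
  "real \<Rightarrow> real \<Rightarrow> 'e::real_normed_vector set \<Rightarrow> ('e \<Rightarrow> 'e) \<Rightarrow> (real \<Rightarrow> 'e \<Rightarrow> real) \<Rightarrow> bool" where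
  "multiplier t0 t1 d P' lam \<longleftrightarrow>
     (\<forall>t\<in>{t0..t1}. lam t \<in> annihilator d \<and> dual_map P' (lam t) = lam t) \<and>
     (\<forall>x. smooth_on {t0..t1} (\<lambda>t. lam t x))"

definition vakonomic_extremal_with_multiplier ::
  "('a, 'g) monoid_scheme \<Rightarrow> ('a, 'e::real_normed_vector) manifold \<Rightarrow> real \<Rightarrow> real \<Rightarrow> 'e set \<Rightarrow>
     ('e \<Rightarrow> 'e) \<Rightarrow> ('a \<times> 'e \<Rightarrow> real) \<Rightarrow> (real \<Rightarrow> 'e \<Rightarrow> real) \<Rightarrow> (real \<Rightarrow> 'a) \<Rightarrow> (real \<Rightarrow> 'e) \<Rightarrow> bool" where
  "vakonomic_extremal_with_multiplier G M t0 t1 d P' L lam h \<eta> \<longleftrightarrow>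
     multiplier t0 t1 d P' lam \<and>
     unconstrained_extremal G M t0 t1 d (modified_lagrangian G M P' L lam) h \<eta>"

end

theory Submission
  imports Defs
begin

text \<open>
  In the left trivialisation of the tangent bundle the theorem is a consequence of two facts about
  an admissible curve \<open>(h, \<eta>)\<close> and a generator \<open>\<xi>\<close>. Write \<open>force = h\<^sup>*(\<partial>L/\<partial>h)\<close> and
  \<open>momentum = \<partial>L/\<partial>\<eta>\<close>. Then

  \<^item> \<open>\<langle>dL, \<delta>\<^sub>\<xi>\<gamma>\<rangle> = \<langle>force, \<xi>\<rangle> + \<langle>momentum, \<xi>' + [\<eta>, \<xi>]\<rangle>\<close> (\<open>first_variation\<close>);

  \<^item> for \<open>\<eta>\<close> in \<open>d\<close>, the variation is tangent to \<open>D\<close> exactly when \<open>\<xi>' + [\<eta>, \<xi>] \<in> d\<close>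
    (\<open>admissible_variation_tangent_iff\<close>).

  Both hold because the variation has the components \<open>\<xi>\<close> and \<open>\<xi>' + [\<eta>, \<xi>]\<close> in the trivialisation. The
  bracket enters as follows. In a chart, left translation of a vector \<open>\<zeta>\<close> of the Lie algebra to the
  point \<open>y\<close> is \<open>A(y)\<zeta>\<close> for a smooth family of linear maps \<open>A\<close> (\<open>triv\<close> below). Differentiating
  \<open>A(h(t))\<xi>(t)\<close> and applying the flip gives \<open>DA(A\<eta>)\<xi> + A\<xi>'\<close>, whereas the trivialisation
  of a tangent vector over \<open>A\<eta>\<close> with base component \<open>A\<xi>\<close> subtracts \<open>DA(A\<xi>)\<eta>\<close>. The difference
  \<open>DA(A\<eta>)\<xi> - DA(A\<xi>)\<eta>\<close> is the bracket of the left-invariant fields of \<open>\<eta>\<close> and \<open>\<xi>\<close>, hence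
  \<open>A[\<eta>, \<xi>]\<close>; that this bracket is again left-invariant (\<open>bracket_left_invariant\<close>) comes from the
  symmetry of second derivatives of left translations.

  Granted this, each part is short.

  (a) Integration by parts turns the first variation into the integral of the Euler covector applied
  to \<open>\<xi>\<close>. A nonholonomic extremal kills the \<open>d\<close>-component of every generator, so only the
  \<open>d'\<close>-component is left, and the fundamental lemma of the calculus of variations applies to it.

  (b) For \<open>\<xi> = a + b\<close> with \<open>a\<close> in \<open>d\<close> and \<open>b\<close> in \<open>d'\<close>, applying \<open>P'\<close> to \<open>\<xi>' + [\<eta>, \<xi>]\<close> gives the
  differential equation for \<open>b\<close>, because \<open>P'a' = 0\<close> and \<open>P'b' = b'\<close>. The first variation along \<open>a\<close>
  vanishes for a nonholonomic extremal, and in what remains \<open>b' + [\<eta>, b]\<close> may be replaced by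
  \<open>P[\<eta>, b] - P'[\<eta>, a]\<close>.

  (c) The modified Lagrangian only changes the momentum, by \<open>-\<lambda>P'\<close>. For \<open>\<xi>\<close> in \<open>d\<close> the
  extra term is \<open>-\<langle>\<lambda>, P'[\<eta>, \<xi>]\<rangle>\<close>, since \<open>P'\<xi>' = 0\<close>; again the fundamental lemma concludes.

  The test functions in the fundamental lemma are polynomials times \<open>(t - t0)(t1 - t)\<close>; they are
  smooth for trivial reasons and suffice by the Weierstrass approximation theorem.
\<close>

section \<open>Finite-dimensional inner product spaces\<close>

text \<open>
  The model space of a manifold is an inner product space with a finite spanning set, possibly zero.
  A finite Parseval frame (for instance an orthonormal basis) gives coordinates in it; the vector
  zero may belong to a frame, which makes products of frames easy to form.
\<close>

definition frame :: "'x::real_inner set \<Rightarrow> bool" where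
  "frame B \<longleftrightarrow> finite B \<and> (\<forall>x. (\<Sum>b\<in>B. (x \<bullet> b) *\<^sub>R b) = x)"

lemma frame_finite: "frame B \<Longrightarrow> finite B"
  and frame_expand: "frame B \<Longrightarrow> (\<Sum>b\<in>B. (x \<bullet> b) *\<^sub>R b) = x"
  by (simp_all add: frame_def)

text \<open>
  Gram-Schmidt orthogonalisation, followed by normalisation of the nonzero vectors.
\<close>

lemma frame_exists:
  fixes B :: "'x::real_inner set"
  assumes "finite B" "span B = UNIV"
  obtains F :: "'x set" where "frame F"
proof -
  obtain C :: "'x set" where C: "finite C" "span C = UNIV" "pairwise orthogonal C"
    using basis_orthogonal[OF assms(1)] assms(2) by metis
  define F where "F = (\<lambda>c. c /\<^sub>R norm c) ` (C - {0})"
  have fin: "finite F" using C by (simp add: F_def)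
  have orth: "x \<bullet> y = (if x = y then 1 else 0)" if xy: "x \<in> F" "y \<in> F" for x y
  proof -
    obtain a b :: 'x where a: "a \<in> C" "a \<noteq> 0" "x = a /\<^sub>R norm a"
      and b: "b \<in> C" "b \<noteq> 0" "y = b /\<^sub>R norm b"
      using xy unfolding F_def by blast
    show ?thesis
    proof (cases "a = b")
      case True
      then show ?thesis using a b
        by (simp add: dot_square_norm power2_eq_square)
    next
      case False
      then have "a \<bullet> b = 0" using C(3) a b by (auto simp: pairwise_def orthogonal_def)
      then have "x \<bullet> y = 0" using a b by simp
      moreover have "x \<bullet> x \<noteq> 0" using a by simp
      ultimately show ?thesis by metis
    qed
  qed
  have sp: "span F = UNIV"
  proof -
    have "c \<in> span F" if "c \<in> C" for c
    proof (cases "c = 0")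
      case False
      then have "c /\<^sub>R norm c \<in> span F" using that by (auto simp: F_def intro!: span_base)
      then have "norm c *\<^sub>R (c /\<^sub>R norm c) \<in> span F" by (rule span_mul)
      then show ?thesis using False by simp
    qed (simp add: span_zero)
    then have "span C \<subseteq> span F" by (intro span_minimal) auto
    then show ?thesis using C by auto
  qed
  have "(\<Sum>b\<in>F. (x \<bullet> b) *\<^sub>R b) = x" for x
  proof -
    have "x \<in> span F" using sp by simp
    then show ?thesis
    proof (induction rule: span_induct_alt)
      case base
      then show ?case by simp
    next
      case (step a c y)
      have "(\<Sum>b\<in>F. (c \<bullet> b) *\<^sub>R b) = (\<Sum>b\<in>F. if b = c then b else 0)"
        by (rule sum.cong) (use orth step in auto)
      also have "\<dots> = c" using fin step by simp
      finally show ?case using step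
        by (simp add: inner_add_left scaleR_add_left sum.distrib
            flip: scaleR_scaleR scaleR_sum_right)
    qed
  qed
  then show ?thesis using that[of F] fin by (simp add: frame_def)
qed

lemma frame_prod:
  assumes "frame B" "frame C"
  shows "frame ((\<lambda>b. (b, 0)) ` B \<union> (\<lambda>c. (0, c)) ` C)"
proof -
  have "(\<Sum>b\<in>(\<lambda>b. (b, 0)) ` B \<union> (\<lambda>c. (0, c)) ` C. (x \<bullet> b) *\<^sub>R b) = x" for x :: "'a \<times> 'b"
  proof -
    have "(\<Sum>b\<in>(\<lambda>b. (b, 0)) ` B \<union> (\<lambda>c. (0, c)) ` C. (x \<bullet> b) *\<^sub>R b)
        = (\<Sum>b\<in>(\<lambda>b. (b, 0)) ` B. (x \<bullet> b) *\<^sub>R b) + (\<Sum>b\<in>(\<lambda>c. (0, c)) ` C. (x \<bullet> b) *\<^sub>R b)"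
      using assms by (intro sum.union_inter_neutral) (auto simp: frame_finite simp flip: zero_prod_def)
    also have "(\<Sum>b\<in>(\<lambda>b. (b, 0)) ` B. (x \<bullet> b) *\<^sub>R b) = (\<Sum>b\<in>B. ((fst x \<bullet> b) *\<^sub>R b, 0))"
      by (subst sum.reindex) (auto simp: inj_on_def inner_prod_def)
    also have "(\<Sum>b\<in>(\<lambda>c. (0, c)) ` C. (x \<bullet> b) *\<^sub>R b) = (\<Sum>b\<in>C. (0, (snd x \<bullet> b) *\<^sub>R b))"
      by (subst sum.reindex) (auto simp: inj_on_def inner_prod_def)
    finally show ?thesis
      using assms by (simp add: prod_eq_iff fst_sum snd_sum frame_expand)
  qed
  then show ?thesis using assms by (auto simp: frame_def)
qed

lemma frame_linear:
  fixes B :: "'x::real_inner set" and f :: "'x \<Rightarrow> 'y::real_normed_vector"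
  assumes "frame B" "linear f"
  shows "f x = (\<Sum>b\<in>B. (x \<bullet> b) *\<^sub>R f b)"
proof -
  have "f x = f (\<Sum>b\<in>B. (x \<bullet> b) *\<^sub>R b)" using assms by (simp add: frame_expand)
  also have "\<dots> = (\<Sum>b\<in>B. (x \<bullet> b) *\<^sub>R f b)"
    using assms(2) by (simp add: linear_sum linear_scale)
  finally show ?thesis .
qed

lemma frame_bounded_linear:
  fixes B :: "'x::real_inner set" and f :: "'x \<Rightarrow> 'y::real_normed_vector"
  assumes "frame B" "linear f"
  shows "bounded_linear f"
proof -
  have eq: "f = (\<lambda>x. \<Sum>b\<in>B. (x \<bullet> b) *\<^sub>R f b)"
    by (rule ext) (rule frame_linear[OF assms])
  have "bounded_linear (\<lambda>x. \<Sum>b\<in>B. (x \<bullet> b) *\<^sub>R f b)"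
    by (intro bounded_linear_sum bounded_linear_scaleR_const bounded_linear_inner_left)
  then show ?thesis unfolding eq[symmetric] .
qed

section \<open>Calculus of smooth maps\<close>

declare Ck_on.simps(2) [simp del]

lemma Ck_on_SucE:
  assumes "Ck_on (Suc k) S f"
  obtains f' where "\<And>x. x \<in> S \<Longrightarrow> (f has_derivative f' x) (at x within S)"
    "\<And>v. Ck_on k S (\<lambda>x. f' x v)"
  using assms unfolding Ck_on.simps(2) by blast

lemma Ck_on_SucI:
  assumes "\<And>x. x \<in> S \<Longrightarrow> (f has_derivative f' x) (at x within S)"
    "\<And>v. Ck_on k S (\<lambda>x. f' x v)"
  shows "Ck_on (Suc k) S f"
  using assms unfolding Ck_on.simps(2) by blast

lemma Ck_on_subset: "Ck_on k T f \<Longrightarrow> S \<subseteq> T \<Longrightarrow> Ck_on k S f"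
proof (induction k arbitrary: f)
  case 0
  then show ?case by (auto intro: continuous_on_subset)
next
  case (Suc k)
  obtain f' where f': "\<And>x. x \<in> T \<Longrightarrow> (f has_derivative f' x) (at x within T)"
    "\<And>v. Ck_on k T (\<lambda>x. f' x v)" using Suc.prems(1) unfolding Ck_on.simps(2) by blast
  show ?case
    by (rule Ck_on_SucI[of _ _ f'])
      (use f' Suc has_derivative_subset in blast)+
qed

lemma Ck_on_cong:
  assumes "\<And>x. x \<in> S \<Longrightarrow> f x = g x" "Ck_on k S f"
  shows "Ck_on k S g"
proof (cases k)
  case 0
  then show ?thesis using assms continuous_on_cong[of S S f g] by simp
next
  case (Suc j)
  obtain f' where f': "\<And>x. x \<in> S \<Longrightarrow> (f has_derivative f' x) (at x within S)"
    "\<And>v. Ck_on j S (\<lambda>x. f' x v)" using assms(2) unfolding Suc Ck_on.simps(2) by blast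
  have "(g has_derivative f' x) (at x within S)" if "x \<in> S" for x
    using f'(1) assms(1) that has_derivative_transform[of x S g f] by auto
  then show ?thesis using f' Suc by (auto intro: Ck_on_SucI)
qed

lemma Ck_on_SucD: "Ck_on (Suc k) S f \<Longrightarrow> Ck_on k S f"
proof (induction k arbitrary: f)
  case 0
  then show ?case by (auto elim!: Ck_on_SucE intro: has_derivative_continuous_on)
next
  case (Suc k)
  obtain f' where f': "\<And>x. x \<in> S \<Longrightarrow> (f has_derivative f' x) (at x within S)"
    "\<And>v. Ck_on (Suc k) S (\<lambda>x. f' x v)" using Suc.prems unfolding Ck_on.simps(2) by blast
  show ?case by (rule Ck_on_SucI[of _ _ f']) (use f' Suc.IH in auto)
qed

lemma Ck_on_const: "Ck_on k S (\<lambda>x. c)"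
  by (induction k arbitrary: c) (auto intro!: Ck_on_SucI[where f' = "\<lambda>x v. 0"])

lemma Ck_on_bounded_linear:
  assumes T: "bounded_linear T"
  shows "Ck_on k S f \<Longrightarrow> Ck_on k S (\<lambda>x. T (f x))"
proof (induction k arbitrary: f)
  case 0
  then show ?case using assms by (simp add: bounded_linear.continuous_on)
next
  case (Suc k)
  obtain f' where f': "\<And>x. x \<in> S \<Longrightarrow> (f has_derivative f' x) (at x within S)"
    "\<And>v. Ck_on k S (\<lambda>x. f' x v)" using Suc.prems unfolding Ck_on.simps(2) by blast
  show ?case
    by (rule Ck_on_SucI[where f' = "\<lambda>x v. T (f' x v)"])
      (use f' Suc.IH bounded_linear.has_derivative[OF T] in blast)+
qed

lemma Ck_on_id: "Ck_on k S (\<lambda>x. x)"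
  by (cases k) (auto intro!: Ck_on_SucI[where f' = "\<lambda>x v. v"] Ck_on_const)

lemma Ck_on_add:
  "Ck_on k S f \<Longrightarrow> Ck_on k S g \<Longrightarrow> Ck_on k S (\<lambda>x. f x + g x)"
proof (induction k arbitrary: f g)
  case 0
  then show ?case by (auto intro: continuous_on_add)
next
  case (Suc k)
  obtain f' where f': "\<And>x. x \<in> S \<Longrightarrow> (f has_derivative f' x) (at x within S)"
    "\<And>v. Ck_on k S (\<lambda>x. f' x v)" using Suc.prems(1) unfolding Ck_on.simps(2) by blast
  obtain g' where g': "\<And>x. x \<in> S \<Longrightarrow> (g has_derivative g' x) (at x within S)"
    "\<And>v. Ck_on k S (\<lambda>x. g' x v)" using Suc.prems(2) unfolding Ck_on.simps(2) by blast
  show ?case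
    by (rule Ck_on_SucI[where f' = "\<lambda>x v. f' x v + g' x v"])
      (use f' g' Suc.IH in \<open>auto intro: has_derivative_add\<close>)
qed

lemma Ck_on_sum:
  "finite A \<Longrightarrow> (\<And>i. i \<in> A \<Longrightarrow> Ck_on k S (f i)) \<Longrightarrow> Ck_on k S (\<lambda>x. \<Sum>i\<in>A. f i x)"
  by (induction A rule: finite_induct) (auto intro: Ck_on_const Ck_on_add)

lemma Ck_on_scaleR:
  fixes a :: "'x::real_normed_vector \<Rightarrow> real"
  shows "Ck_on k S a \<Longrightarrow> Ck_on k S f \<Longrightarrow> Ck_on k S (\<lambda>x. a x *\<^sub>R f x)"
proof (induction k arbitrary: a f)
  case 0
  then show ?case by (auto intro: continuous_on_scaleR)
next
  case (Suc k)
  obtain f' where f': "\<And>x. x \<in> S \<Longrightarrow> (f has_derivative f' x) (at x within S)"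
    "\<And>v. Ck_on k S (\<lambda>x. f' x v)" using Suc.prems(2) unfolding Ck_on.simps(2) by blast
  obtain a' where a': "\<And>x. x \<in> S \<Longrightarrow> (a has_derivative a' x) (at x within S)"
    "\<And>v. Ck_on k S (\<lambda>x. a' x v)" using Suc.prems(1) unfolding Ck_on.simps(2) by blast
  show ?case
    by (rule Ck_on_SucI[where f' = "\<lambda>x v. a x *\<^sub>R f' x v + a' x v *\<^sub>R f x"])
      (use f' a' Suc.IH Suc.prems[THEN Ck_on_SucD] in
        \<open>auto intro!: has_derivative_scaleR Ck_on_add\<close>)
qed

text \<open>
  The chain rule writes the derivative of the composition as \<open>f'(g x)(g' x v)\<close>, where both factors
  depend on \<open>x\<close>. Expanding \<open>g' x v\<close> in a frame turns this into a finite sum of products of maps of one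
  order less, to which the induction hypothesis applies.
\<close>

lemma Ck_on_compose:
  fixes g :: "'x::real_normed_vector \<Rightarrow> 'y::real_inner" and f :: "'y \<Rightarrow> 'z::real_normed_vector"
  assumes B: "frame (B :: 'y set)" and gS: "g ` S \<subseteq> T"
  shows "Ck_on k S g \<Longrightarrow> Ck_on k T f \<Longrightarrow> Ck_on k S (\<lambda>x. f (g x))"
proof (induction k arbitrary: f)
  case 0
  then show ?case using gS by (auto intro: continuous_on_compose2)
next
  case (Suc k)
  obtain f' where f': "\<And>x. x \<in> T \<Longrightarrow> (f has_derivative f' x) (at x within T)"
    "\<And>v. Ck_on k T (\<lambda>x. f' x v)" using Suc.prems(2) unfolding Ck_on.simps(2) by blast
  obtain g' where g': "\<And>x. x \<in> S \<Longrightarrow> (g has_derivative g' x) (at x within S)"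
    "\<And>v. Ck_on k S (\<lambda>x. g' x v)" using Suc.prems(1) unfolding Ck_on.simps(2) by blast
  have der: "((\<lambda>x. f (g x)) has_derivative (\<lambda>v. f' (g x) (g' x v))) (at x within S)"
    if "x \<in> S" for x
    using that f' g' gS by (intro has_derivative_in_compose2[of T f f' g S]) auto
  have "Ck_on k S (\<lambda>x. f' (g x) (g' x v))" for v
  proof (rule Ck_on_cong)
    show "Ck_on k S (\<lambda>x. \<Sum>b\<in>B. (g' x v \<bullet> b) *\<^sub>R f' (g x) b)"
      using Suc.IH[of "\<lambda>y. f' y _"] Ck_on_SucD[OF Suc.prems(1)] f'(2) g'(2)
      by (intro Ck_on_sum Ck_on_scaleR Ck_on_bounded_linear[OF bounded_linear_inner_left]
          frame_finite[OF B]) auto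
    fix x assume "x \<in> S"
    then have "linear (f' (g x))" using f'(1)[of "g x"] gS by (auto dest: has_derivative_linear)
    then show "(\<Sum>b\<in>B. (g' x v \<bullet> b) *\<^sub>R f' (g x) b) = f' (g x) (g' x v)"
      using frame_linear[OF B] by metis
  qed
  then show ?case using der by (intro Ck_on_SucI)
qed

lemma smooth_on_subset: "smooth_on T f \<Longrightarrow> S \<subseteq> T \<Longrightarrow> smooth_on S f"
  by (auto simp: smooth_on_def intro: Ck_on_subset)

lemma smooth_on_cong: "smooth_on S f \<Longrightarrow> (\<And>x. x \<in> S \<Longrightarrow> f x = g x) \<Longrightarrow> smooth_on S g"
  unfolding smooth_on_def using Ck_on_cong by blast

lemma smooth_on_const: "smooth_on S (\<lambda>x. c)"
  and smooth_on_id: "smooth_on S (\<lambda>x. x)"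
  and smooth_on_bounded_linear:
    "bounded_linear u \<Longrightarrow> smooth_on S f \<Longrightarrow> smooth_on S (\<lambda>x. u (f x))"
  and smooth_on_add:
    "smooth_on S f \<Longrightarrow> smooth_on S g \<Longrightarrow> smooth_on S (\<lambda>x. f x + g x)"
  and smooth_on_sum:
    "finite A \<Longrightarrow> (\<And>i. i \<in> A \<Longrightarrow> smooth_on S (h i)) \<Longrightarrow> smooth_on S (\<lambda>x. \<Sum>i\<in>A. h i x)"
  and smooth_on_scaleR:
    "smooth_on S a \<Longrightarrow> smooth_on S f \<Longrightarrow> smooth_on S (\<lambda>x. a x *\<^sub>R f x)"
  by (auto simp: smooth_on_def
      intro: Ck_on_const Ck_on_id Ck_on_bounded_linear Ck_on_add Ck_on_sum Ck_on_scaleR)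

lemma smooth_on_compose:
  fixes q :: "'y::real_inner \<Rightarrow> 'z::real_normed_vector"
  assumes "frame (B :: 'y set)" "smooth_on T q" "smooth_on S p" "p ` S \<subseteq> T"
  shows "smooth_on S (\<lambda>x. q (p x))"
  using Ck_on_compose[OF assms(1,4)] assms(2,3) unfolding smooth_on_def by blast

lemma smooth_on_Pair:
  assumes "smooth_on S f" "smooth_on S g"
  shows "smooth_on S (\<lambda>x. (f x, g x))"
proof -
  have "smooth_on S (\<lambda>x. (f x, 0) + (0, g x))"
    using assms
    by (intro smooth_on_add smooth_on_bounded_linear[of "\<lambda>x. (x, 0)"]
        smooth_on_bounded_linear[of "\<lambda>x. (0, x)"])
       (auto intro!: bounded_linear_Pair bounded_linear_ident bounded_linear_zero)
  then show ?thesis by simp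
qed

lemma smooth_on_fst: "smooth_on S f \<Longrightarrow> smooth_on S (\<lambda>x. fst (f x))"
  and smooth_on_snd: "smooth_on S f \<Longrightarrow> smooth_on S (\<lambda>x. snd (f x))"
  by (auto intro: smooth_on_bounded_linear bounded_linear_fst bounded_linear_snd)

lemma smooth_on_mult:
  fixes f g :: "'x::real_normed_vector \<Rightarrow> real"
  shows "smooth_on S f \<Longrightarrow> smooth_on S g \<Longrightarrow> smooth_on S (\<lambda>x. f x * g x)"
  using smooth_on_scaleR[of S f g] by simp

lemma smooth_on_continuous: "smooth_on S f \<Longrightarrow> continuous_on S f"
  unfolding smooth_on_def using Ck_on.simps(1) by blast

lemma smooth_on_has_derivative:
  assumes "smooth_on S f" "open S" "x \<in> S"
  shows "(f has_derivative frechet_derivative f (at x)) (at x)"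
proof -
  have "Ck_on (Suc 0) S f" using assms by (simp add: smooth_on_def)
  then obtain f' where f': "\<And>x. x \<in> S \<Longrightarrow> (f has_derivative f' x) (at x within S)"
    "\<And>v. Ck_on 0 S (\<lambda>x. f' x v)" unfolding Ck_on.simps(2) by blast
  then have "(f has_derivative f' x) (at x)"
    using f'(1)[OF assms(3)] at_within_open[OF assms(3,2)] by simp
  then show ?thesis by (metis frechet_derivative_at)
qed

lemma smooth_on_frechet_derivative:
  assumes "smooth_on S f" "open S"
  shows "smooth_on S (\<lambda>x. frechet_derivative f (at x) v)"
  unfolding smooth_on_def
proof
  fix k
  have "Ck_on (Suc k) S f" using assms by (simp add: smooth_on_def)
  then obtain f' where f': "\<And>x. x \<in> S \<Longrightarrow> (f has_derivative f' x) (at x within S)"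
    "\<And>v. Ck_on k S (\<lambda>x. f' x v)" unfolding Ck_on.simps(2) by blast
  have eq: "f' x = frechet_derivative f (at x)" if "x \<in> S" for x
    using f'(1)[OF that] at_within_open[OF that assms(2)] by (intro frechet_derivative_at) simp
  show "Ck_on k S (\<lambda>x. frechet_derivative f (at x) v)"
    by (rule Ck_on_cong[OF _ f'(2)[of v]]) (metis eq)
qed

text \<open>
  The form in which smoothness of derivatives is used throughout: base point and direction may both
  depend smoothly on a parameter.
\<close>

lemma smooth_on_directional_derivative:
  fixes f :: "'y::real_inner \<Rightarrow> 'z::real_normed_vector"
  assumes B: "frame (B :: 'y set)" and f: "smooth_on S f" "open S"
    and p: "smooth_on T p" "p ` T \<subseteq> S" and w: "smooth_on T w"
  shows "smooth_on T (\<lambda>x. frechet_derivative f (at (p x)) (w x))"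
proof (rule smooth_on_cong)
  show "smooth_on T (\<lambda>x. \<Sum>b\<in>B. (w x \<bullet> b) *\<^sub>R frechet_derivative f (at (p x)) b)"
    using B f p w
    by (intro smooth_on_sum smooth_on_scaleR smooth_on_bounded_linear[OF bounded_linear_inner_left]
        smooth_on_compose[OF B smooth_on_frechet_derivative]) (auto simp: frame_finite)
  fix x assume "x \<in> T"
  then have "linear (frechet_derivative f (at (p x)))"
    using smooth_on_has_derivative[OF f] p by (auto intro: has_derivative_linear)
  then show "(\<Sum>b\<in>B. (w x \<bullet> b) *\<^sub>R frechet_derivative f (at (p x)) b)
      = frechet_derivative f (at (p x)) (w x)"
    using frame_linear[OF B] by metis
qed

lemma frechet_derivative_cong_open:
  assumes "open U" "x \<in> U" "\<And>y. y \<in> U \<Longrightarrow> f y = g y"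
  shows "frechet_derivative f (at x) = frechet_derivative g (at x)"
proof -
  have "(f has_derivative D) (at x) \<longleftrightarrow> (g has_derivative D) (at x)" for D
    using assms has_derivative_transform_within_open[of f D x UNIV U g]
      has_derivative_transform_within_open[of g D x UNIV U f] by auto
  then show ?thesis by (simp add: frechet_derivative_def)
qed

text \<open>
  Curves are smooth on relatively open subsets of the time interval, one for each chart, while all
  derivatives are taken within the whole interval; the two agree.
\<close>

lemma at_within_openin:
  fixes I :: "'x::metric_space set"
  assumes "openin (top_of_set I) U" "t \<in> U"
  shows "at t within U = at t within I"
proof -
  obtain T where T: "open T" "U = I \<inter> T" using assms(1) by (auto simp: openin_open)
  show ?thesis by (rule at_within_nhd[of t T]) (use T assms in auto)
qed

lemma smooth_on_differentiable_within:
  assumes "smooth_on S f" "x \<in> S"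
  shows "f differentiable (at x within S)"
proof -
  have "Ck_on (Suc 0) S f" using assms by (simp add: smooth_on_def)
  then show ?thesis using assms(2) unfolding Ck_on.simps(2) differentiable_def by blast
qed

lemma smooth_on_has_vector_derivative:
  assumes "smooth_on S f" "t \<in> S"
  shows "(f has_vector_derivative vector_derivative f (at t within S)) (at t within S)"
  using smooth_on_differentiable_within[OF assms] by (simp add: vector_derivative_works)

text \<open>
  Product rule for \<open>F x (w x)\<close> with \<open>F x\<close> linear. Only the pointwise derivatives of \<open>F\<close> are assumed;
  finite dimension of the middle space makes up for uniformity.
\<close>

lemma has_derivative_linear_family:
  fixes F :: "'x::real_normed_vector \<Rightarrow> 'y::real_inner \<Rightarrow> 'z::real_normed_vector"
  assumes B: "frame (B :: 'y set)" and lin: "\<And>x. x \<in> S \<Longrightarrow> linear (F x)" and x0: "x0 \<in> S"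
    and F: "\<And>v. ((\<lambda>x. F x v) has_derivative F' v) (at x0 within S)"
    and w: "(w has_derivative w') (at x0 within S)"
  shows "((\<lambda>x. F x (w x)) has_derivative (\<lambda>u. F' (w x0) u + F x0 (w' u))) (at x0 within S)"
proof -
  \<comment> \<open>With \<open>F x (w x) = F x (w x0) + F x (w x - w x0)\<close>, only the second summand needs expanding in
    the frame; its coefficients vanish at \<open>x0\<close>, so the derivatives of \<open>F\<close> drop out of it.\<close>
  have "((\<lambda>x. ((w x - w x0) \<bullet> b) *\<^sub>R F x b) has_derivative (\<lambda>u. (w' u \<bullet> b) *\<^sub>R F x0 b)) (at x0 within S)"
    for b
  proof -
    have "((\<lambda>x. (w x - w x0) \<bullet> b) has_derivative (\<lambda>u. w' u \<bullet> b)) (at x0 within S)"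
      by (rule has_derivative_inner_left) (use w in \<open>auto intro!: derivative_eq_intros\<close>)
    from has_derivative_scaleR[OF this F[of b]] show ?thesis by simp
  qed
  then have "((\<lambda>x. \<Sum>b\<in>B. ((w x - w x0) \<bullet> b) *\<^sub>R F x b)
      has_derivative (\<lambda>u. \<Sum>b\<in>B. (w' u \<bullet> b) *\<^sub>R F x0 b)) (at x0 within S)"
    by (intro has_derivative_sum)
  also have "(\<lambda>u. \<Sum>b\<in>B. (w' u \<bullet> b) *\<^sub>R F x0 b) = (\<lambda>u. F x0 (w' u))"
    using frame_linear[OF B lin[OF x0]] by metis
  finally have "((\<lambda>x. F x (w x0) + (\<Sum>b\<in>B. ((w x - w x0) \<bullet> b) *\<^sub>R F x b))
      has_derivative (\<lambda>u. F' (w x0) u + F x0 (w' u))) (at x0 within S)"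
    by (intro has_derivative_add F)
  then show ?thesis
  proof (rule has_derivative_transform[OF x0, rotated])
    fix x assume xS: "x \<in> S"
    show "F x (w x) = F x (w x0) + (\<Sum>b\<in>B. ((w x - w x0) \<bullet> b) *\<^sub>R F x b)"
      unfolding frame_linear[OF B lin[OF xS], of "w x - w x0", symmetric]
      by (simp add: linear_diff[OF lin[OF xS]])
  qed
qed

lemma continuous_on_linear_family:
  fixes F :: "'x::topological_space \<Rightarrow> 'y::real_inner \<Rightarrow> 'z::real_normed_vector"
  assumes B: "frame (B :: 'y set)" and lin: "\<And>t. t \<in> S \<Longrightarrow> linear (F t)"
    and F: "\<And>v. continuous_on S (\<lambda>t. F t v)" and w: "continuous_on S w"
  shows "continuous_on S (\<lambda>t. F t (w t))"
proof -
  have "continuous_on S (\<lambda>t. \<Sum>b\<in>B. (w t \<bullet> b) *\<^sub>R F t b)"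
    by (intro continuous_intros w F)
  then show ?thesis
    by (rule continuous_on_eq) (rule frame_linear[OF B lin, symmetric])
qed

section \<open>Symmetry of second derivatives\<close>

text \<open>
  Two applications of the mean value theorem, the first to \<open>s \<mapsto> f(x + su + hv) - f(x + su)\<close>. The left
  side of the resulting identity is symmetric in \<open>u\<close> and \<open>v\<close>.
\<close>

lemma second_difference_mean_value:
  fixes f :: "'x::real_normed_vector \<Rightarrow> real"
  assumes f: "\<And>y. y \<in> ball x r \<Longrightarrow> (f has_derivative f' y) (at y)"
    and fu: "\<And>y. y \<in> ball x r \<Longrightarrow> ((\<lambda>y. f' y u) has_derivative f'' y) (at y)"
    and h: "0 < h" "h * (norm u + norm v) < r"
  obtains s t where "0 < s" "s < h" "0 < t" "t < h"
    "f (x + h *\<^sub>R u + h *\<^sub>R v) - f (x + h *\<^sub>R u) - f (x + h *\<^sub>R v) + f x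
       = h * h * f'' (x + s *\<^sub>R u + t *\<^sub>R v) v"
proof -
  have inb: "x + s *\<^sub>R u + t *\<^sub>R v \<in> ball x r" if "0 \<le> s" "s \<le> h" "0 \<le> t" "t \<le> h" for s t
  proof -
    have "norm (s *\<^sub>R u + t *\<^sub>R v) \<le> s * norm u + t * norm v"
      using that by (intro norm_triangle_le) simp
    also have "\<dots> \<le> h * norm u + h * norm v"
      using that by (intro add_mono mult_right_mono) auto
    also have "\<dots> < r" using h by (simp add: algebra_simps)
    finally show ?thesis by (simp add: dist_norm norm_minus_commute algebra_simps)
  qed
  define g where "g s = f (x + s *\<^sub>R u + h *\<^sub>R v) - f (x + s *\<^sub>R u)" for s
  have line_u: "((\<lambda>s. f (x + s *\<^sub>R u + t *\<^sub>R v)) has_real_derivative f' (x + s *\<^sub>R u + t *\<^sub>R v) u) (at s)"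
    if "0 \<le> s" "s \<le> h" "0 \<le> t" "t \<le> h" for s t
  proof -
    have F: "(f has_derivative f' (x + s *\<^sub>R u + t *\<^sub>R v)) (at (x + s *\<^sub>R u + t *\<^sub>R v))"
      using f inb that by blast
    have "((\<lambda>s. x + s *\<^sub>R u + t *\<^sub>R v) has_derivative (\<lambda>d. d *\<^sub>R u)) (at s)"
      by (auto intro!: derivative_eq_intros)
    from has_derivative_compose[OF this F]
    have "((\<lambda>s. f (x + s *\<^sub>R u + t *\<^sub>R v)) has_derivative
        (\<lambda>d. f' (x + s *\<^sub>R u + t *\<^sub>R v) (d *\<^sub>R u))) (at s)" .
    then show ?thesis
      using linear_scale[OF has_derivative_linear[OF F]]
      by (simp add: has_field_derivative_def mult.commute[of _ "f' _ _"] mult_commute_abs)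
  qed
  have "(g has_real_derivative f' (x + s *\<^sub>R u + h *\<^sub>R v) u - f' (x + s *\<^sub>R u) u) (at s)"
    if "0 \<le> s" "s \<le> h" for s
    unfolding g_def using line_u[of s h] line_u[of s 0] that h
    by (intro derivative_intros) auto
  then obtain s where s: "0 < s" "s < h"
    "g h - g 0 = h * (f' (x + s *\<^sub>R u + h *\<^sub>R v) u - f' (x + s *\<^sub>R u) u)"
    using MVT2[of 0 h g "\<lambda>s. f' (x + s *\<^sub>R u + h *\<^sub>R v) u - f' (x + s *\<^sub>R u) u"] h by auto
  have "((\<lambda>t. f' (x + s *\<^sub>R u + t *\<^sub>R v) u) has_real_derivative f'' (x + s *\<^sub>R u + t *\<^sub>R v) v) (at t)"
    if "0 \<le> t" "t \<le> h" for t
  proof -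
    have F: "((\<lambda>y. f' y u) has_derivative f'' (x + s *\<^sub>R u + t *\<^sub>R v)) (at (x + s *\<^sub>R u + t *\<^sub>R v))"
      using fu inb that s by auto
    have "((\<lambda>t. x + s *\<^sub>R u + t *\<^sub>R v) has_derivative (\<lambda>d. d *\<^sub>R v)) (at t)"
      by (auto intro!: derivative_eq_intros)
    from has_derivative_compose[OF this F]
    have "((\<lambda>t. f' (x + s *\<^sub>R u + t *\<^sub>R v) u) has_derivative
        (\<lambda>d. f'' (x + s *\<^sub>R u + t *\<^sub>R v) (d *\<^sub>R v))) (at t)" .
    then show ?thesis
      using linear_scale[OF has_derivative_linear[OF F]]
      by (simp add: has_field_derivative_def mult.commute[of _ "f'' _ _"] mult_commute_abs)
  qed
  then obtain t where t: "0 < t" "t < h"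
    "f' (x + s *\<^sub>R u + h *\<^sub>R v) u - f' (x + s *\<^sub>R u) u = h * f'' (x + s *\<^sub>R u + t *\<^sub>R v) v"
    using MVT2[of 0 h "\<lambda>t. f' (x + s *\<^sub>R u + t *\<^sub>R v) u" "\<lambda>t. f'' (x + s *\<^sub>R u + t *\<^sub>R v) v"] h
    by auto
  show ?thesis
    by (rule that[OF s(1,2) t(1,2)]) (use s(3) t(3) in \<open>simp add: g_def algebra_simps\<close>)
qed

text \<open>
  For small \<open>h\<close> both mixed derivatives are, up to an arbitrarily small error, the second difference
  quotient with step \<open>h\<close>.
\<close>

lemma symmetric_second_derivative_real:
  fixes f :: "'x::real_normed_vector \<Rightarrow> real"
  assumes S: "open S" "x \<in> S"
    and f: "\<And>y. y \<in> S \<Longrightarrow> (f has_derivative f' y) (at y)"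
    and fu: "\<And>y. y \<in> S \<Longrightarrow> ((\<lambda>y. f' y u) has_derivative fu y) (at y)"
    and fv: "\<And>y. y \<in> S \<Longrightarrow> ((\<lambda>y. f' y v) has_derivative fv y) (at y)"
    and cont: "continuous_on S (\<lambda>y. fu y v)" "continuous_on S (\<lambda>y. fv y u)"
  shows "fu x v = fv x u"
proof (rule ccontr)
  assume ne: "fu x v \<noteq> fv x u"
  define e where "e = \<bar>fu x v - fv x u\<bar> / 2"
  have e: "e > 0" using ne by (simp add: e_def)
  have "continuous (at x) (\<lambda>y. fu y v)" "continuous (at x) (\<lambda>y. fv y u)"
    using cont S by (simp_all add: continuous_on_eq_continuous_at)
  then have "\<exists>d>0. \<forall>y. dist y x < d \<longrightarrow> dist (fu y v) (fu x v) < e"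
    "\<exists>d>0. \<forall>y. dist y x < d \<longrightarrow> dist (fv y u) (fv x u) < e"
    using e by (simp_all add: continuous_at_eps_delta)
  then obtain r1 r2 where r: "r1 > 0" "\<And>y. dist y x < r1 \<Longrightarrow> dist (fu y v) (fu x v) < e"
     "r2 > 0" "\<And>y. dist y x < r2 \<Longrightarrow> dist (fv y u) (fv x u) < e" by blast
  obtain r3 where r3: "r3 > 0" "ball x r3 \<subseteq> S" using S by (meson openE)
  define r where "r = min r1 (min r2 r3)"
  have r0: "r > 0" using r r3 by (simp add: r_def)
  \<comment> \<open>The step is chosen to keep the whole parallelogram inside the ball of radius \<open>r\<close>; the \<open>1\<close>
    covers the case \<open>u = v = 0\<close>.\<close>
  define h where "h = r / (2 * (norm u + norm v + 1))"
  have pos: "norm u + norm v + 1 > 0" by (smt (verit) norm_ge_zero)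
  have h: "h > 0" using r0 pos by (simp add: h_def)
  have hr: "h * (norm u + norm v) < r"
  proof -
    have "h * (norm u + norm v) \<le> h * (norm u + norm v + 1)" using h by (simp add: mult_left_mono)
    also have "\<dots> = r / 2" using pos by (simp add: h_def field_simps)
    finally show ?thesis using r0 by simp
  qed
  have hr': "h * (norm v + norm u) < r" using hr by (simp add: add.commute)
  have sub: "ball x r \<subseteq> S" using r3 by (auto simp: r_def)
  have near: "dist (x + s *\<^sub>R a + t *\<^sub>R b) x < r"
    if "0 < s" "s < h" "0 < t" "t < h" "h * (norm a + norm b) < r" for s t and a b :: 'x
  proof -
    have "dist (x + s *\<^sub>R a + t *\<^sub>R b) x = norm (s *\<^sub>R a + t *\<^sub>R b)"
      by (simp add: dist_norm algebra_simps)
    also have "\<dots> \<le> s * norm a + t * norm b" using that by (intro norm_triangle_le) simp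
    also have "\<dots> \<le> h * norm a + h * norm b"
      using that by (intro add_mono mult_right_mono) auto
    finally show ?thesis using that by (simp add: algebra_simps)
  qed
  obtain s t where st: "0 < s" "s < h" "0 < t" "t < h"
    "f (x + h *\<^sub>R u + h *\<^sub>R v) - f (x + h *\<^sub>R u) - f (x + h *\<^sub>R v) + f x
       = h * h * fu (x + s *\<^sub>R u + t *\<^sub>R v) v"
    using second_difference_mean_value[of x r f f' u fu h v] f fu sub h hr by blast
  obtain s' t' where st': "0 < s'" "s' < h" "0 < t'" "t' < h"
    "f (x + h *\<^sub>R v + h *\<^sub>R u) - f (x + h *\<^sub>R v) - f (x + h *\<^sub>R u) + f x
       = h * h * fv (x + s' *\<^sub>R v + t' *\<^sub>R u) u"
    using second_difference_mean_value[of x r f f' v fv h u] f fv sub h hr' by blast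
  have "h * h * fu (x + s *\<^sub>R u + t *\<^sub>R v) v = h * h * fv (x + s' *\<^sub>R v + t' *\<^sub>R u) u"
    using st(5) st'(5) by (simp add: algebra_simps)
  then have "fu (x + s *\<^sub>R u + t *\<^sub>R v) v = fv (x + s' *\<^sub>R v + t' *\<^sub>R u) u" using h by simp
  moreover have "dist (fu (x + s *\<^sub>R u + t *\<^sub>R v) v) (fu x v) < e"
    using near[OF st(1-4) hr] r(2) by (simp add: r_def)
  moreover have "dist (fv (x + s' *\<^sub>R v + t' *\<^sub>R u) u) (fv x u) < e"
    using near[OF st'(1-4) hr'] r(4) by (simp add: r_def)
  ultimately have "dist (fu x v) (fv x u) < e + e"
    using dist_triangle3[of "fu x v" "fv x u" "fu (x + s *\<^sub>R u + t *\<^sub>R v) v"] by simp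
  then show False by (simp add: dist_real_def e_def)
qed

lemma symmetric_second_derivative:
  fixes f :: "'x::real_normed_vector \<Rightarrow> 'y::real_inner"
  assumes S: "open S" "x \<in> S" and f: "smooth_on S f"
  shows "frechet_derivative (\<lambda>y. frechet_derivative f (at y) u) (at x) v
    = frechet_derivative (\<lambda>y. frechet_derivative f (at y) v) (at x) u" (is "?l = ?r")
proof -
  define D where "D y = frechet_derivative f (at y)" for y
  define DD where "DD w y = frechet_derivative (\<lambda>y. D y w) (at y)" for w y
  have D: "(f has_derivative D y) (at y)" if "y \<in> S" for y
    using smooth_on_has_derivative[OF f S(1) that] by (simp add: D_def)
  have sD: "smooth_on S (\<lambda>y. D y w)" for w
    unfolding D_def using smooth_on_frechet_derivative[OF f S(1)] .
  have DD: "((\<lambda>y. D y w) has_derivative DD w y) (at y)" if "y \<in> S" for y w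
    using smooth_on_has_derivative[OF sD S(1) that] by (simp add: DD_def)
  have c: "continuous_on S (\<lambda>y. DD w y z)" for w z
    unfolding DD_def using smooth_on_continuous[OF smooth_on_frechet_derivative[OF sD S(1)]] .
  have "DD u x v \<bullet> w = DD v x u \<bullet> w" for w
  proof (rule symmetric_second_derivative_real[where f = "\<lambda>y. f y \<bullet> w" and f' = "\<lambda>y z. D y z \<bullet> w"
          and fu = "\<lambda>y z. DD u y z \<bullet> w" and fv = "\<lambda>y z. DD v y z \<bullet> w", OF S])
    show "((\<lambda>y. f y \<bullet> w) has_derivative (\<lambda>z. D y z \<bullet> w)) (at y)" if "y \<in> S" for y
      by (rule has_derivative_inner_left[OF D[OF that]])
    show "((\<lambda>y. D y u \<bullet> w) has_derivative (\<lambda>z. DD u y z \<bullet> w)) (at y)" if "y \<in> S" for y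
      by (rule has_derivative_inner_left[OF DD[OF that]])
    show "((\<lambda>y. D y v \<bullet> w) has_derivative (\<lambda>z. DD v y z \<bullet> w)) (at y)" if "y \<in> S" for y
      by (rule has_derivative_inner_left[OF DD[OF that]])
    show "continuous_on S (\<lambda>y. DD u y v \<bullet> w)"
      by (rule continuous_on_inner[OF c continuous_on_const])
    show "continuous_on S (\<lambda>y. DD v y u \<bullet> w)"
      by (rule continuous_on_inner[OF c continuous_on_const])
  qed
  then have "DD u x v = DD v x u" using vector_eq_rdot by blast
  then show ?thesis by (simp only: DD_def D_def)
qed

section \<open>The fundamental lemma of the calculus of variations\<close>

lemma smooth_on_real_polynomial_function:
  "real_polynomial_function p \<Longrightarrow> smooth_on S p"
  by (induction rule: real_polynomial_function.induct)
    (auto intro: smooth_on_bounded_linear[OF _ smooth_on_id] smooth_on_const smooth_on_add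
      smooth_on_mult)

text \<open>
  Let \<open>g = (t - a)(b - t)f\<close>. By hypothesis \<open>g\<close> is orthogonal to all polynomials, and approximating
  \<open>g\<close> itself uniformly by polynomials shows that the integral of its square is zero. So \<open>f\<close> vanishes in
  the interior, and at the end-points by continuity.
\<close>

lemma fundamental_lemma_calculus_of_variations:
  fixes f :: "real \<Rightarrow> real"
  assumes ab: "a < b" and f: "continuous_on {a..b} f"
    and zero: "\<And>p. real_polynomial_function p \<Longrightarrow>
      integral {a..b} (\<lambda>t. (t - a) * (b - t) * p t * f t) = 0"
    and t: "t \<in> {a..b}"
  shows "f t = 0"
proof -
  define g where "g t = (t - a) * (b - t) * f t" for t
  have g: "continuous_on {a..b} g"
    unfolding g_def by (intro continuous_intros f)
  have g2: "continuous_on {a..b} (\<lambda>t. g t * g t)" by (intro continuous_intros g)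
  have "bounded (g ` {a..b})" by (intro compact_imp_bounded compact_continuous_image g) simp
  then obtain C where C: "C > 0" "\<And>t. t \<in> {a..b} \<Longrightarrow> \<bar>g t\<bar> \<le> C"
    unfolding bounded_pos by auto
  have le: "integral {a..b} (\<lambda>t. g t * g t) \<le> e" if e: "e > 0" for e
  proof -
    define r where "r = e / (C * (b - a))"
    have r: "r > 0" using e C ab by (simp add: r_def)
    obtain p where p: "real_polynomial_function p" "\<And>t. t \<in> {a..b} \<Longrightarrow> \<bar>g t - p t\<bar> < r"
      using Stone_Weierstrass_real_polynomial_function[OF compact_Icc g r] by metis
    have pc: "continuous_on {a..b} p"
      by (rule smooth_on_continuous[OF smooth_on_real_polynomial_function[OF p(1)]])
    have "integral {a..b} (\<lambda>t. g t * p t) = 0"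
      using zero[OF p(1)] by (simp add: g_def mult_ac)
    then have "integral {a..b} (\<lambda>t. g t * g t) = integral {a..b} (\<lambda>t. g t * g t - g t * p t)"
      by (subst integral_diff) (auto intro!: integrable_continuous_interval continuous_intros g pc)
    also have "\<dots> \<le> integral {a..b} (\<lambda>t. C * r)"
    proof (rule integral_le)
      show "(\<lambda>t. g t * g t - g t * p t) integrable_on {a..b}"
        by (intro integrable_continuous_interval continuous_intros g pc)
      fix t assume t: "t \<in> {a..b}"
      have "g t * g t - g t * p t = g t * (g t - p t)" by (simp add: algebra_simps)
      also have "\<dots> \<le> \<bar>g t\<bar> * \<bar>g t - p t\<bar>" by (metis abs_ge_self abs_mult)
      also have "\<dots> \<le> C * r" using C t p(2)[OF t] by (intro mult_mono) auto
      finally show "g t * g t - g t * p t \<le> C * r" .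
    qed auto
    also have "\<dots> = e" using ab C by (simp add: r_def)
    finally show ?thesis .
  qed
  have "integral {a..b} (\<lambda>t. g t * g t) \<le> 0" by (rule field_le_epsilon) (use le in simp)
  moreover have "integral {a..b} (\<lambda>t. g t * g t) \<ge> 0"
    by (intro integral_nonneg integrable_continuous_interval g2) auto
  ultimately have "integral {a..b} (\<lambda>t. g t * g t) = 0" by simp
  then have "\<forall>t\<in>{a..b}. g t * g t = 0"
    using integral_eq_0_iff[OF g2 ab] by simp
  then have "f t = 0" if "t \<in> {a<..<b}" for t
    using that by (auto simp: g_def)
  moreover have "closure {a<..<b} = {a..b}" using ab by simp
  ultimately show ?thesis
    using continuous_constant_on_closure[of "{a<..<b}" f 0 t] f t by auto
qed

section \<open>Splittings\<close>

text \<open>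
  The maps of a splitting are only assumed to pick components; linearity follows from uniqueness
  of the decomposition.
\<close>

lemma splitting_linear:
  assumes s: "splitting d d' P P'"
  shows "linear P" "linear P'"
proof -
  have unique: "a = P (a + b) \<and> b = P' (a + b)" if "a \<in> d" "b \<in> d'" for a b
  proof -
    have "P (a + b) - a \<in> d" "b - P' (a + b) \<in> d'"
      using s that by (auto simp: splitting_def intro!: subspace_diff)
    moreover have "P (a + b) - a = b - P' (a + b)"
      using s by (simp add: splitting_def algebra_simps)
    ultimately have "P (a + b) - a \<in> d \<inter> d'" by (metis IntI)
    moreover have "d \<inter> d' = {0}" using s by (simp add: splitting_def)
    ultimately have "P (a + b) - a = 0" by blast
    then show ?thesis using \<open>P (a + b) - a = b - P' (a + b)\<close> by simp
  qed
  have mem: "P x \<in> d" "P' x \<in> d'" and sum: "P x + P' x = x" for x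
    using s by (auto simp: splitting_def)
  have sub: "subspace d" "subspace d'" using s by (auto simp: splitting_def)
  have add: "P (x + y) = P x + P y \<and> P' (x + y) = P' x + P' y" for x y
  proof -
    have "(P x + P y) + (P' x + P' y) = (P x + P' x) + (P y + P' y)" by (simp only: add_ac)
    also have "\<dots> = x + y" by (simp only: sum)
    finally show ?thesis
      using unique[OF subspace_add[OF sub(1) mem(1) mem(1), of x y]
          subspace_add[OF sub(2) mem(2) mem(2), of x y]] by simp
  qed
  have scale: "P (r *\<^sub>R x) = r *\<^sub>R P x \<and> P' (r *\<^sub>R x) = r *\<^sub>R P' x" for r x
  proof -
    have "r *\<^sub>R P x + r *\<^sub>R P' x = r *\<^sub>R x" by (simp only: sum flip: scaleR_add_right)
    then show ?thesis
      using unique[OF subspace_scale[OF sub(1) mem(1), of r x] subspace_scale[OF sub(2) mem(2), of r x]]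
      by simp
  qed
  show "linear P" "linear P'" using add scale by (auto intro!: linearI)
qed

lemma splitting_mem_iff:
  assumes s: "splitting d d' P P'"
  shows "x \<in> d \<longleftrightarrow> P' x = 0" "x \<in> d' \<longleftrightarrow> P x = 0"
proof -
  have sum: "P x + P' x = x" and mem: "P x \<in> d" "P' x \<in> d'" and inter: "d \<inter> d' = {0}"
    and sub: "subspace d" "subspace d'"
    using s by (auto simp: splitting_def)
  have "P' x = x - P x" "P x = x - P' x" using sum by (simp_all add: algebra_simps)
  then have "x \<in> d \<Longrightarrow> P' x \<in> d \<inter> d'" "x \<in> d' \<Longrightarrow> P x \<in> d \<inter> d'"
    using mem sub by (metis IntI subspace_diff)+
  then show "x \<in> d \<longleftrightarrow> P' x = 0" "x \<in> d' \<longleftrightarrow> P x = 0"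
    using inter mem sum by (metis add.right_neutral add.left_neutral singletonD)+
qed

section \<open>Left translations in charts\<close>

text \<open>
  Everything is expressed through local representatives of left translations \<open>x \<mapsto> g x\<close> and their
  derivatives. Transition maps of charts are the case \<open>g = \<one>\<close>, so that one functoriality
  statement (\<open>trans_deriv_comp\<close>) governs both changes of charts and left translations.
\<close>

locale lie_group_charts =
  fixes G :: "('a, 'g) monoid_scheme" (structure)
    and M :: "('a, 'e::real_inner) manifold" and E :: "'e set"
  assumes lie: "lie_group G M" and E: "frame E"
begin

sublocale group G
  using lie by (simp add: lie_group_def)

lemma smooth_manifold: "smooth_manifold M"
  and points_eq: "points M = carrier G"
  and smooth_mult: "smooth_map (prod_manifold M M) M (\<lambda>(g, h). g \<otimes> h)"
  and smooth_inv: "smooth_map M M (\<lambda>g. inv g)"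
  using lie by (simp_all add: lie_group_def)

lemma chart_inj: "c \<in> atlas M \<Longrightarrow> inj_on (snd c) (fst c)"
  and chart_open: "c \<in> atlas M \<Longrightarrow> open (snd c ` fst c)"
  and chart_subset: "c \<in> atlas M \<Longrightarrow> g \<in> fst c \<Longrightarrow> g \<in> carrier G"
  and chart_at_atlas: "g \<in> carrier G \<Longrightarrow> chart_at M g \<in> atlas M"
  and chart_at_mem: "g \<in> carrier G \<Longrightarrow> g \<in> fst (chart_at M g)"
  using smooth_manifold by (auto simp: smooth_manifold_def points_eq)

lemma chart_inv_coord: "c \<in> atlas M \<Longrightarrow> g \<in> fst c \<Longrightarrow> chart_inv c (snd c g) = g"
  by (simp add: chart_inj)

abbreviation one_chart where "one_chart \<equiv> chart_at M \<one>"

lemma one_chart: "one_chart \<in> atlas M" "\<one> \<in> fst one_chart"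
  by (simp_all add: chart_at_atlas chart_at_mem)

definition mult_rep where
  "mult_rep a b c = (\<lambda>(y, z). snd c (chart_inv a y \<otimes> chart_inv b z))"

definition mult_dom where
  "mult_dom a b c = {(snd a g, snd b x) | g x. g \<in> fst a \<and> x \<in> fst b \<and> g \<otimes> x \<in> fst c}"

lemma mult_rep_smooth:
  assumes "a \<in> atlas M" "b \<in> atlas M" "c \<in> atlas M"
  shows "open (mult_dom a b c)" and "smooth_on (mult_dom a b c) (mult_rep a b c)"
proof -
  define p where "p = (fst a \<times> fst b, \<lambda>(g, x). (snd a g, snd b x))"
  have "p \<in> atlas (prod_manifold M M)"
    using assms unfolding prod_manifold_def p_def Let_def manifold.simps mem_Collect_eq by blast
  then have *: "open (snd p ` (fst p \<inter> (\<lambda>(g, h). g \<otimes> h) -` fst c))"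
    "smooth_on (snd p ` (fst p \<inter> (\<lambda>(g, h). g \<otimes> h) -` fst c))
       (snd c \<circ> (\<lambda>(g, h). g \<otimes> h) \<circ> chart_inv p)"
    using smooth_mult assms by (auto simp: smooth_map_def)
  have dom: "snd p ` (fst p \<inter> (\<lambda>(g, h). g \<otimes> h) -` fst c) = mult_dom a b c"
    by (auto simp: p_def mult_dom_def image_iff)
  show "open (mult_dom a b c)" using * dom by simp
  have inj: "inj_on (snd p) (fst p)"
    using chart_inj[OF assms(1)] chart_inj[OF assms(2)] by (auto simp: p_def inj_on_def)
  show "smooth_on (mult_dom a b c) (mult_rep a b c)"
  proof (rule smooth_on_cong)
    show "smooth_on (mult_dom a b c) (snd c \<circ> (\<lambda>(g, h). g \<otimes> h) \<circ> chart_inv p)"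
      using * dom by simp
    fix w assume "w \<in> mult_dom a b c"
    then obtain g x where w: "w = (snd a g, snd b x)" "g \<in> fst a" "x \<in> fst b"
      by (auto simp: mult_dom_def)
    have "chart_inv p (snd p (g, x)) = (g, x)"
      using w by (intro inv_into_f_f inj) (simp add: p_def)
    then have "chart_inv p w = (g, x)" using w by (simp add: p_def)
    then show "(snd c \<circ> (\<lambda>(g, h). g \<otimes> h) \<circ> chart_inv p) w = mult_rep a b c w"
      using w assms by (simp add: mult_rep_def chart_inv_coord del: inv_into_f_f)
  qed
qed

definition trans_rep where
  "trans_rep g a b = (\<lambda>z. snd b (g \<otimes> chart_inv a z))"

definition trans_dom where
  "trans_dom g a b = {snd a x | x. x \<in> fst a \<and> g \<otimes> x \<in> fst b}"

definition trans_deriv where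
  "trans_deriv g a b x = frechet_derivative (trans_rep g a b) (at (snd a x))"

text \<open>
  A left translation is multiplication with one argument frozen, so its smoothness, and the smooth
  dependence of its derivative on \<open>g\<close>, are inherited from the multiplication.
\<close>

lemma trans_rep_eq:
  assumes "c \<in> atlas M" "g \<in> fst c" "a \<in> atlas M" "b \<in> atlas M"
  shows "trans_rep g a b z = mult_rep c a b (snd c g, z)"
    and "trans_dom g a b = Pair (snd c g) -` mult_dom c a b"
  using assms chart_inj[OF assms(1)]
  by (auto simp: trans_rep_def mult_rep_def chart_inv_coord trans_dom_def mult_dom_def inj_on_def
      simp del: inv_into_f_f)

lemma trans_rep_smooth:
  assumes "g \<in> carrier G" "a \<in> atlas M" "b \<in> atlas M"
  shows "open (trans_dom g a b)" and "smooth_on (trans_dom g a b) (trans_rep g a b)"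
proof -
  define c where "c = chart_at M g"
  have c: "c \<in> atlas M" "g \<in> fst c" using assms by (auto simp: c_def chart_at_atlas chart_at_mem)
  note eq = trans_rep_eq[OF c assms(2,3)] and m = mult_rep_smooth[OF c(1) assms(2,3)]
  show "open (trans_dom g a b)"
    unfolding eq by (intro open_vimage m continuous_intros)
  have "smooth_on (Pair (snd c g) -` mult_dom c a b) (\<lambda>z. mult_rep c a b (snd c g, z))"
    by (rule smooth_on_compose[OF frame_prod[OF E E] m(2)])
       (auto intro: smooth_on_Pair smooth_on_const smooth_on_id)
  then show "smooth_on (trans_dom g a b) (trans_rep g a b)"
    unfolding eq(2) by (rule smooth_on_cong) (simp add: eq)
qed

lemma trans_deriv_eq:
  assumes "c \<in> atlas M" "g \<in> fst c" "a \<in> atlas M" "b \<in> atlas M" "x \<in> fst a" "g \<otimes> x \<in> fst b"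
  shows "trans_deriv g a b x v = frechet_derivative (mult_rep c a b) (at (snd c g, snd a x)) (0, v)"
proof -
  have in_dom: "(snd c g, snd a x) \<in> mult_dom c a b" using assms by (auto simp: mult_dom_def)
  have "(mult_rep c a b has_derivative frechet_derivative (mult_rep c a b) (at (snd c g, snd a x)))
      (at (snd c g, snd a x))"
    by (rule smooth_on_has_derivative[OF mult_rep_smooth(2,1) in_dom]) (use assms in auto)
  moreover have "(Pair (snd c g) has_derivative (\<lambda>v. (0, v))) (at (snd a x))"
    by (auto intro!: derivative_eq_intros)
  ultimately have "((\<lambda>z. mult_rep c a b (snd c g, z)) has_derivative
      (\<lambda>v. frechet_derivative (mult_rep c a b) (at (snd c g, snd a x)) (0, v))) (at (snd a x))"
    using has_derivative_compose[of "Pair (snd c g)"] by blast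
  then have "(trans_rep g a b has_derivative
      (\<lambda>v. frechet_derivative (mult_rep c a b) (at (snd c g, snd a x)) (0, v))) (at (snd a x))"
    unfolding trans_rep_eq(1)[OF assms(1-4), symmetric] .
  from fun_cong[OF frechet_derivative_at[OF this], of v] show ?thesis
    unfolding trans_deriv_def by (rule sym)
qed

lemma trans_rep_has_derivative:
  assumes "g \<in> carrier G" "a \<in> atlas M" "b \<in> atlas M" "x \<in> fst a" "g \<otimes> x \<in> fst b"
  shows "(trans_rep g a b has_derivative trans_deriv g a b x) (at (snd a x))"
  unfolding trans_deriv_def
  by (rule smooth_on_has_derivative[OF trans_rep_smooth(2,1)])
    (use assms in \<open>auto simp: trans_dom_def\<close>)

lemma trans_deriv_linear:
  assumes "g \<in> carrier G" "a \<in> atlas M" "b \<in> atlas M" "x \<in> fst a" "g \<otimes> x \<in> fst b"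
  shows "linear (trans_deriv g a b x)"
  using trans_rep_has_derivative[OF assms] by (rule has_derivative_linear)

text \<open>
  The chain rule for \<open>g(hx) = (gh)x\<close>, read in three charts.
\<close>

lemma trans_deriv_comp:
  assumes "g \<in> carrier G" "h \<in> carrier G" "a \<in> atlas M" "b \<in> atlas M" "c \<in> atlas M"
    and "x \<in> fst a" "h \<otimes> x \<in> fst b" "g \<otimes> (h \<otimes> x) \<in> fst c"
  shows "trans_deriv g b c (h \<otimes> x) (trans_deriv h a b x v) = trans_deriv (g \<otimes> h) a c x v"
proof -
  have x: "x \<in> carrier G" using chart_subset assms by blast
  have "(trans_rep h a b has_derivative trans_deriv h a b x) (at (snd a x))"
    by (rule trans_rep_has_derivative) (use assms in auto)
  moreover have "trans_rep h a b (snd a x) = snd b (h \<otimes> x)"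
    using assms by (simp add: trans_rep_def chart_inv_coord del: inv_into_f_f)
  moreover have "(trans_rep g b c has_derivative trans_deriv g b c (h \<otimes> x)) (at (snd b (h \<otimes> x)))"
    by (rule trans_rep_has_derivative) (use assms in auto)
  ultimately have "((\<lambda>z. trans_rep g b c (trans_rep h a b z)) has_derivative
      (\<lambda>v. trans_deriv g b c (h \<otimes> x) (trans_deriv h a b x v))) (at (snd a x))"
    using has_derivative_compose[of "trans_rep h a b"] by metis
  then have "(trans_rep (g \<otimes> h) a c has_derivative
      (\<lambda>v. trans_deriv g b c (h \<otimes> x) (trans_deriv h a b x v))) (at (snd a x))"
  proof (rule has_derivative_transform_within_open)
    show "open (trans_dom h a b)" by (rule trans_rep_smooth) (use assms in auto)
    show "snd a x \<in> trans_dom h a b" using assms by (auto simp: trans_dom_def)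
    fix z assume "z \<in> trans_dom h a b"
    then obtain q where q: "z = snd a q" "q \<in> fst a" "h \<otimes> q \<in> fst b"
      by (auto simp: trans_dom_def)
    moreover have "q \<in> carrier G" using q assms chart_subset by blast
    ultimately show "trans_rep g b c (trans_rep h a b z) = trans_rep (g \<otimes> h) a c z"
      using assms by (simp add: trans_rep_def chart_inv_coord m_assoc del: inv_into_f_f)
  qed
  from fun_cong[OF frechet_derivative_at[OF this], of v] show ?thesis
    unfolding trans_deriv_def[of "g \<otimes> h"] .
qed

lemma trans_deriv_one:
  assumes "a \<in> atlas M" "x \<in> fst a"
  shows "trans_deriv \<one> a a x v = v"
proof -
  have "trans_rep \<one> a a z = z" if z: "z \<in> snd a ` fst a" for z
  proof -
    obtain q where "z = snd a q" "q \<in> fst a" using z by blast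
    moreover have "q \<in> carrier G" using calculation assms chart_subset by blast
    ultimately show ?thesis
      using assms by (simp add: trans_rep_def chart_inv_coord del: inv_into_f_f)
  qed
  then have "trans_deriv \<one> a a x = frechet_derivative (\<lambda>z. z) (at (snd a x))"
    unfolding trans_deriv_def
    by (rule frechet_derivative_cong_open[rotated 2]) (use assms chart_open in auto)
  then show ?thesis by simp
qed

section \<open>Tangent bundle charts and the left trivialisation\<close>

text \<open>
  Near \<open>p\<close> a transition map is the local representative of the translation by \<open>\<one>\<close>.
\<close>

lemma tangent_chart_eq:
  assumes c: "c \<in> atlas M" and p: "p \<in> fst c"
  shows "snd (tangent_chart M c) (p, v) = (snd c p, trans_deriv \<one> (chart_at M p) c p v)"
proof -
  let ?a = "chart_at M p"
  have pG: "p \<in> carrier G" using c p chart_subset by blast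
  have "transition ?a c z = trans_rep \<one> ?a c z" if z: "z \<in> snd ?a ` fst ?a" for z
  proof -
    obtain q where "z = snd ?a q" "q \<in> fst ?a" using z by blast
    moreover have "q \<in> carrier G" using calculation chart_at_atlas[OF pG] chart_subset by blast
    ultimately show ?thesis
      using chart_at_atlas[OF pG]
      by (simp add: trans_rep_def transition_def chart_inv_coord del: inv_into_f_f)
  qed
  then have "frechet_derivative (transition ?a c) (at (coord_at M p)) = trans_deriv \<one> ?a c p"
    unfolding trans_deriv_def coord_at_def
    by (rule frechet_derivative_cong_open[rotated 2])
      (use chart_open chart_at_atlas[OF pG] chart_at_mem[OF pG] in auto)
  then show ?thesis by (simp add: tangent_chart_def)
qed

lemma tangent_chart_preferred:
  assumes "p \<in> carrier G"
  shows "snd (tangent_chart M (chart_at M p)) (p, v) = (coord_at M p, v)"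
  using assms
  by (simp add: tangent_chart_eq chart_at_atlas chart_at_mem trans_deriv_one coord_at_def)

lemma tangent_chart_inj:
  assumes c: "c \<in> atlas M"
  shows "inj_on (snd (tangent_chart M c)) (fst (tangent_chart M c))"
proof (rule inj_onI, clarify)
  fix p v q w
  assume mem: "(p, v) \<in> fst (tangent_chart M c)" "(q, w) \<in> fst (tangent_chart M c)"
    and eq: "snd (tangent_chart M c) (p, v) = snd (tangent_chart M c) (q, w)"
  have pq: "p \<in> fst c" "q \<in> fst c" using mem by (auto simp: tangent_chart_def)
  have "snd c p = snd c q" using eq pq c by (simp add: tangent_chart_eq)
  then have qp: "q = p" using pq chart_inj[OF c] by (auto simp: inj_on_def)
  have pG: "p \<in> carrier G" using c pq chart_subset by blast
  let ?a = "chart_at M p"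
  have rev: "trans_deriv \<one> c ?a p (trans_deriv \<one> ?a c p u) = u" for u
    using trans_deriv_comp[of "\<one>" "\<one>" ?a c ?a p u] c pq pG
    by (simp add: chart_at_atlas chart_at_mem trans_deriv_one)
  have "trans_deriv \<one> ?a c p v = trans_deriv \<one> ?a c p w"
    using eq pq c qp by (simp add: tangent_chart_eq)
  then show "p = q \<and> v = w" using rev qp by metis
qed

text \<open>
  Every fibre is hit, because the transition derivatives in the two directions are mutually inverse.
\<close>

lemma tangent_chart_image:
  assumes c: "c \<in> atlas M"
  shows "snd (tangent_chart M c) ` fst (tangent_chart M c) = (snd c ` fst c) \<times> UNIV"
    (is "?T ` _ = _")
proof -
  have dom: "fst (tangent_chart M c) = fst c \<times> UNIV" by (simp add: tangent_chart_def)
  show ?thesis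
    unfolding dom
  proof (intro equalityI subsetI)
    fix w assume "w \<in> ?T ` (fst c \<times> UNIV)"
    then obtain p u where "w = ?T (p, u)" "p \<in> fst c" by blast
    then show "w \<in> (snd c ` fst c) \<times> UNIV" using c by (simp add: tangent_chart_eq)
  next
    fix w assume "w \<in> (snd c ` fst c) \<times> (UNIV :: 'e set)"
    then obtain p u where w: "w = (snd c p, u)" and p: "p \<in> fst c" by blast
    have pG: "p \<in> carrier G" using c p chart_subset by blast
    let ?a = "chart_at M p"
    have "trans_deriv \<one> ?a c p (trans_deriv \<one> c ?a p u) = u"
      using trans_deriv_comp[of "\<one>" "\<one>" c ?a c p u] c p pG
      by (simp add: chart_at_atlas chart_at_mem trans_deriv_one)
    then have "?T (p, trans_deriv \<one> c ?a p u) = w"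
      using c p w by (simp add: tangent_chart_eq)
    moreover have "(p, trans_deriv \<one> c ?a p u) \<in> fst c \<times> UNIV" using p by simp
    ultimately show "w \<in> ?T ` (fst c \<times> UNIV)" by (metis imageI)
  qed
qed

lemma left_push_eq:
  assumes "g \<in> carrier G"
  shows "left_push G M g \<zeta> = (g, trans_deriv g one_chart (chart_at M g) \<one> \<zeta>)"
  using assms
  by (simp add: left_push_def tangent_map_def trans_deriv_def trans_rep_def coord_at_def comp_def)

text \<open>
  The left trivialisation in the chart \<open>c\<close>: \<open>triv c y \<zeta>\<close> is the component vector of \<open>g\<^sub>*\<zeta>\<close> in \<open>c\<close>, where
  \<open>y\<close> are the coordinates of \<open>g\<close>. As a function of \<open>y\<close> it represents a left-invariant vector field.
\<close>

definition triv where
  "triv c y = trans_deriv (chart_inv c y) one_chart c \<one>"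

lemma tangent_chart_left_push:
  assumes c: "c \<in> atlas M" and g: "g \<in> fst c"
  shows "snd (tangent_chart M c) (left_push G M g \<zeta>) = (snd c g, triv c (snd c g) \<zeta>)"
proof -
  have gG: "g \<in> carrier G" using c g chart_subset by blast
  have "trans_deriv \<one> (chart_at M g) c (g \<otimes> \<one>) (trans_deriv g one_chart (chart_at M g) \<one> \<zeta>)
      = trans_deriv (\<one> \<otimes> g) one_chart c \<one> \<zeta>"
    by (rule trans_deriv_comp) (use c g gG one_chart in \<open>auto simp: chart_at_atlas chart_at_mem\<close>)
  then show ?thesis
    using c g gG
    by (simp add: left_push_eq tangent_chart_eq triv_def chart_inv_coord del: inv_into_f_f)
qed

lemma left_push_preferred:
  assumes "g \<in> carrier G"
  shows "left_push G M g \<zeta> = (g, triv (chart_at M g) (coord_at M g) \<zeta>)"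
  using assms
  by (simp add: left_push_eq triv_def coord_at_def chart_inv_coord chart_at_atlas chart_at_mem
      del: inv_into_f_f)

text \<open>
  By \<open>trans_deriv_eq\<close> the trivialisation is a partial derivative of the multiplication at the unit,
  taken at base points that depend smoothly on \<open>y\<close>.
\<close>

lemma triv_smooth:
  assumes c: "c \<in> atlas M"
  shows "smooth_on ((snd c ` fst c) \<times> UNIV) (\<lambda>(y, \<zeta>). triv c y \<zeta>)"
proof -
  let ?m = "mult_rep c one_chart c"
  have "smooth_on ((snd c ` fst c) \<times> UNIV)
      (\<lambda>w. frechet_derivative ?m (at (fst w, snd one_chart \<one>)) (0, snd w))"
  proof (rule smooth_on_directional_derivative[OF frame_prod[OF E E] mult_rep_smooth(2,1)])
    show "(\<lambda>w. (fst w, snd one_chart \<one>)) ` ((snd c ` fst c) \<times> UNIV) \<subseteq> mult_dom c one_chart c"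
      using c one_chart chart_subset[OF c] by (force simp: mult_dom_def)
  qed (use c one_chart in
      \<open>auto intro!: smooth_on_Pair smooth_on_fst smooth_on_snd smooth_on_id smooth_on_const\<close>)
  then show ?thesis
  proof (rule smooth_on_cong)
    fix w assume "w \<in> (snd c ` fst c) \<times> (UNIV :: 'e set)"
    then obtain g \<zeta> where w: "w = (snd c g, \<zeta>)" "g \<in> fst c" by auto
    then show "frechet_derivative ?m (at (fst w, snd one_chart \<one>)) (0, snd w)
        = (case w of (y, \<zeta>) \<Rightarrow> triv c y \<zeta>)"
      using trans_deriv_eq[of c g one_chart c "\<one>" \<zeta>] c one_chart chart_subset[OF c]
      by (simp add: triv_def chart_inv_coord del: inv_into_f_f)
  qed
qed

lemma triv_linear:
  assumes "c \<in> atlas M" "y \<in> snd c ` fst c"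
  shows "linear (triv c y)"
proof -
  obtain g where g: "y = snd c g" "g \<in> fst c" using assms by blast
  then have "g \<in> carrier G" using assms chart_subset by blast
  then show ?thesis
    using g assms one_chart unfolding triv_def
    by (intro trans_deriv_linear) (simp_all add: chart_inv_coord del: inv_into_f_f)
qed

lemma triv_one: "triv one_chart (coord_at M \<one>) \<zeta> = \<zeta>"
  using one_chart
  by (simp add: triv_def coord_at_def trans_deriv_one chart_inv_coord del: inv_into_f_f)

text \<open>
  The inverse of the trivialisation: translation by \<open>g\<^sup>-\<^sup>1\<close> back to the unit, read in \<open>c\<close>.
\<close>

definition itriv where
  "itriv c y = trans_deriv (inv (chart_inv c y)) c one_chart (chart_inv c y)"

lemma itriv_triv:
  assumes c: "c \<in> atlas M" and y: "y \<in> snd c ` fst c"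
  shows "itriv c y (triv c y \<zeta>) = \<zeta>"
proof -
  obtain g where g: "y = snd c g" "g \<in> fst c" using y by blast
  have gG: "g \<in> carrier G" using c g chart_subset by blast
  have "trans_deriv (inv g) c one_chart (g \<otimes> \<one>) (trans_deriv g one_chart c \<one> \<zeta>)
      = trans_deriv (inv g \<otimes> g) one_chart one_chart \<one> \<zeta>"
    by (rule trans_deriv_comp) (use c g gG one_chart in auto)
  then show ?thesis
    using c g gG one_chart
    by (simp add: itriv_def triv_def chart_inv_coord trans_deriv_one del: inv_into_f_f)
qed

lemma left_pull_eq:
  assumes c: "c \<in> atlas M" and p: "p \<in> fst c"
  shows "left_pull G M (p, v) = itriv c (snd c p) (snd (snd (tangent_chart M c) (p, v)))"
proof -
  have pG: "p \<in> carrier G" using c p chart_subset by blast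
  let ?a = "chart_at M p"
  have "left_pull G M (p, v) = trans_deriv (inv p) ?a one_chart p v"
    using pG
    by (simp add: left_pull_def tangent_map_def trans_deriv_def trans_rep_def coord_at_def comp_def)
  moreover have "trans_deriv (inv p) c one_chart (\<one> \<otimes> p) (trans_deriv \<one> ?a c p v)
      = trans_deriv (inv p \<otimes> \<one>) ?a one_chart p v"
    by (rule trans_deriv_comp) (use c p pG one_chart in \<open>auto simp: chart_at_atlas chart_at_mem\<close>)
  ultimately show ?thesis
    using c p pG by (simp add: itriv_def tangent_chart_eq chart_inv_coord del: inv_into_f_f)
qed

lemma left_pull_left_push:
  assumes "g \<in> carrier G"
  shows "left_pull G M (left_push G M g \<zeta>) = \<zeta>"
proof -
  have "coord_at M g \<in> snd (chart_at M g) ` fst (chart_at M g)"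
    using assms chart_at_mem by (simp add: coord_at_def)
  then show ?thesis
    using assms left_pull_eq[of "chart_at M g" g] itriv_triv[of "chart_at M g" "coord_at M g"]
    by (simp add: left_push_preferred chart_at_atlas chart_at_mem tangent_chart_preferred
        flip: coord_at_def)
qed

text \<open>
  The inverse \<open>g\<^sup>-\<^sup>1\<close> has to be read in some chart around it, so that the argument works only on
  the part \<open>V\<close> of the chart domain where the inverses stay in that chart.
\<close>

lemma itriv_smooth:
  assumes c: "c \<in> atlas M" and y0: "y0 \<in> snd c ` fst c"
  obtains V where "open V" "y0 \<in> V" "V \<subseteq> snd c ` fst c"
    "smooth_on (V \<times> UNIV) (\<lambda>(y, v). itriv c y v)"
proof -
  obtain g where g: "y0 = snd c g" "g \<in> fst c" using y0 by blast
  have gG: "g \<in> carrier G" using c g chart_subset by blast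
  define a where "a = chart_at M (inv g)"
  have a: "a \<in> atlas M" "inv g \<in> fst a"
    using gG by (simp_all add: a_def chart_at_atlas chart_at_mem)
  define i where "i = snd a \<circ> (\<lambda>g. inv g) \<circ> chart_inv c"
  define V where "V = snd c ` (fst c \<inter> (\<lambda>g. inv g) -` fst a)"
  have V: "open V" "smooth_on V i"
    using smooth_inv c a by (auto simp: smooth_map_def V_def i_def)
  have Vsub: "V \<subseteq> snd c ` fst c" by (auto simp: V_def)
  have yV: "y0 \<in> V" using g a by (auto simp: V_def)
  let ?m = "mult_rep a c one_chart"
  have "smooth_on (V \<times> UNIV) (\<lambda>w. frechet_derivative ?m (at (i (fst w), fst w)) (0, snd w))"
  proof (rule smooth_on_directional_derivative[OF frame_prod[OF E E] mult_rep_smooth(2,1)])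
    show "(\<lambda>w. (i (fst w), fst w)) ` (V \<times> UNIV) \<subseteq> mult_dom a c one_chart"
    proof clarsimp
      fix y assume "y \<in> V"
      then obtain x where x: "y = snd c x" "x \<in> fst c" "inv x \<in> fst a" by (auto simp: V_def)
      moreover have "x \<in> carrier G" using c x chart_subset by blast
      ultimately have "i y = snd a (inv x)" "inv x \<otimes> x \<in> fst one_chart"
        using c one_chart by (simp_all add: i_def chart_inv_coord del: inv_into_f_f)
      then show "(i y, y) \<in> mult_dom a c one_chart"
        using x unfolding mult_dom_def by blast
    qed
    have "smooth_on (V \<times> (UNIV :: 'e set)) (\<lambda>w. i (fst w))"
      by (rule smooth_on_compose[OF E V(2)]) (auto intro!: smooth_on_fst smooth_on_id)
    then show "smooth_on (V \<times> (UNIV :: 'e set)) (\<lambda>w. (i (fst w), fst w))"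
      by (auto intro!: smooth_on_Pair smooth_on_fst smooth_on_id)
  qed (use c a one_chart in
      \<open>auto intro!: smooth_on_Pair smooth_on_snd smooth_on_id smooth_on_const\<close>)
  then have "smooth_on (V \<times> UNIV) (\<lambda>(y, v). itriv c y v)"
  proof (rule smooth_on_cong)
    fix w assume "w \<in> V \<times> (UNIV :: 'e set)"
    then obtain x v where w: "w = (snd c x, v)" "x \<in> fst c" "inv x \<in> fst a" by (auto simp: V_def)
    moreover have "x \<in> carrier G" using c w chart_subset by blast
    ultimately show "frechet_derivative ?m (at (i (fst w), fst w)) (0, snd w)
        = (case w of (y, v) \<Rightarrow> itriv c y v)"
      using trans_deriv_eq[of a "inv x" c one_chart x v] c a one_chart
      by (simp add: itriv_def i_def chart_inv_coord del: inv_into_f_f)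
  qed
  then show ?thesis using that V yV Vsub by blast
qed

text \<open>
  Derivative of the trivialisation in the direction \<open>u\<close> of its base point.
\<close>

definition dtriv where
  "dtriv c y u \<zeta> = frechet_derivative (\<lambda>y. triv c y \<zeta>) (at y) u"

lemma triv_smooth_fixed:
  assumes "c \<in> atlas M"
  shows "smooth_on (snd c ` fst c) (\<lambda>y. triv c y \<zeta>)"
proof -
  have "smooth_on (snd c ` fst c) (\<lambda>y. (y, \<zeta>))"
    by (intro smooth_on_Pair smooth_on_id smooth_on_const)
  from smooth_on_compose[OF frame_prod[OF E E] triv_smooth[OF assms] this]
  show ?thesis by auto
qed

lemma triv_has_derivative:
  assumes "c \<in> atlas M" "y \<in> snd c ` fst c"
  shows "((\<lambda>y. triv c y \<zeta>) has_derivative (\<lambda>u. dtriv c y u \<zeta>)) (at y)"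
  unfolding dtriv_def
  by (rule smooth_on_has_derivative[OF triv_smooth_fixed chart_open]) (use assms in auto)

lemma triv_has_derivative_along:
  assumes c: "c \<in> atlas M" and xS: "\<And>s. s \<in> S \<Longrightarrow> x s \<in> snd c ` fst c" and s0: "s0 \<in> S"
    and x: "(x has_derivative x') (at s0 within S)" and w: "(w has_derivative w') (at s0 within S)"
  shows "((\<lambda>s. triv c (x s) (w s)) has_derivative
    (\<lambda>u. dtriv c (x s0) (x' u) (w s0) + triv c (x s0) (w' u))) (at s0 within S)"
proof (rule has_derivative_linear_family[OF E _ s0 _ w])
  show "linear (triv c (x s))" if "s \<in> S" for s
    by (rule triv_linear[OF c xS[OF that]])
  show "((\<lambda>s. triv c (x s) v) has_derivative (\<lambda>u. dtriv c (x s0) (x' u) v)) (at s0 within S)" for v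
    by (rule has_derivative_compose[OF x triv_has_derivative[OF c xS[OF s0]]])
qed

lemma dtriv_linear_left:
  assumes "c \<in> atlas M" "y \<in> snd c ` fst c"
  shows "linear (\<lambda>u. dtriv c y u \<zeta>)"
  using triv_has_derivative[OF assms] by (rule has_derivative_linear)

text \<open>
  Uniqueness of derivatives transfers linearity of \<open>triv c y\<close> to its derivative in \<open>y\<close>.
\<close>

lemma dtriv_linear_right:
  assumes c: "c \<in> atlas M" and y: "y \<in> snd c ` fst c"
  shows "linear (dtriv c y u)"
proof (rule linearI)
  fix a b :: 'e and r :: real
  have "((\<lambda>y. triv c y (a + b)) has_derivative (\<lambda>u. dtriv c y u a + dtriv c y u b)) (at y)"
    by (rule has_derivative_transform_within_open[OF has_derivative_add[OF
            triv_has_derivative[OF c y] triv_has_derivative[OF c y]] chart_open[OF c] y])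
      (simp add: linear_add[OF triv_linear[OF c]])
  from fun_cong[OF has_derivative_unique[OF triv_has_derivative[OF c y] this], of u]
  show "dtriv c y u (a + b) = dtriv c y u a + dtriv c y u b" .
  have "((\<lambda>y. triv c y (r *\<^sub>R a)) has_derivative (\<lambda>u. r *\<^sub>R dtriv c y u a)) (at y)"
    by (rule has_derivative_transform_within_open[OF has_derivative_scaleR_right[OF
            triv_has_derivative[OF c y]] chart_open[OF c] y])
      (simp add: linear_scale[OF triv_linear[OF c]])
  from fun_cong[OF has_derivative_unique[OF triv_has_derivative[OF c y] this], of u]
  show "dtriv c y u (r *\<^sub>R a) = r *\<^sub>R dtriv c y u a" .
qed

section \<open>The Lie bracket in the left trivialisation\<close>

abbreviation bracket where "bracket \<equiv> lie_algebra_bracket G M"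

lemma one_coord: "coord_at M \<one> \<in> snd one_chart ` fst one_chart"
  using one_chart by (simp add: coord_at_def)

text \<open>
  In the preferred chart at the unit the trivialisation is the identity at the unit itself, so the
  bracket of left-invariant fields is the antisymmetrised derivative of the trivialisation there.
\<close>

lemma bracket_eq:
  "bracket \<eta> \<xi> = dtriv one_chart (coord_at M \<one>) \<eta> \<xi> - dtriv one_chart (coord_at M \<one>) \<xi> \<eta>"
proof -
  let ?X = "\<lambda>\<zeta>. vector_field_rep M one_chart (\<lambda>h. left_push G M h \<zeta>)"
  have X: "?X \<zeta> y = triv one_chart y \<zeta>" if y: "y \<in> snd one_chart ` fst one_chart" for y \<zeta>
  proof -
    obtain g where "y = snd one_chart g" "g \<in> fst one_chart" using y by blast
    then show ?thesis
      using one_chart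
      by (simp add: vector_field_rep_def tangent_chart_left_push chart_inv_coord del: inv_into_f_f)
  qed
  have "frechet_derivative (?X \<zeta>) (at (coord_at M \<one>)) u = dtriv one_chart (coord_at M \<one>) u \<zeta>" for \<zeta> u
    unfolding dtriv_def
    by (rule fun_cong[OF frechet_derivative_cong_open[OF chart_open[OF one_chart(1)] one_coord]])
      (rule X)
  then show ?thesis
    by (simp add: lie_algebra_bracket_def lie_bracket_def Let_def X[OF one_coord] triv_one)
qed

lemma bracket_linear_right: "linear (bracket \<eta>)"
proof -
  have "bracket \<eta> = (\<lambda>\<xi>. dtriv one_chart (coord_at M \<one>) \<eta> \<xi> - dtriv one_chart (coord_at M \<one>) \<xi> \<eta>)"
    by (rule ext) (rule bracket_eq)
  then show ?thesis
    using linear_compose_sub[OF dtriv_linear_right[OF one_chart(1) one_coord]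
        dtriv_linear_left[OF one_chart(1) one_coord]] by metis
qed

lemma bracket_antisym: "bracket \<eta> \<xi> = - bracket \<xi> \<eta>"
  by (simp add: bracket_eq)

lemma bracket_linear_left: "linear (\<lambda>\<eta>. bracket \<eta> \<xi>)"
proof -
  have "linear (\<lambda>\<eta>. - bracket \<xi> \<eta>)" by (intro linear_compose_neg bracket_linear_right)
  then show ?thesis by (simp add: bracket_antisym[of _ \<xi>])
qed

lemma bracket_continuous:
  assumes "continuous_on S \<eta>" "continuous_on S \<xi>"
  shows "continuous_on S (\<lambda>t. bracket (\<eta> t) (\<xi> t))"
proof -
  have "bracket (\<eta> t) (\<xi> t)
      = (\<Sum>a\<in>E. (\<eta> t \<bullet> a) *\<^sub>R (\<Sum>b\<in>E. (\<xi> t \<bullet> b) *\<^sub>R bracket a b))" for t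
    using frame_linear[OF E bracket_linear_left, of "\<eta> t" "\<xi> t"]
      frame_linear[OF E bracket_linear_right, of _ "\<xi> t"] by simp
  then show ?thesis using assms by (simp) (intro continuous_intros)
qed

text \<open>
  Let \<open>\<phi>\<close> be the translation by \<open>p\<close> read in charts, and \<open>D\<close> its derivative. Left invariance of the fields says
  \<open>A(\<phi> z)\<zeta> = D z (A\<^sub>1(z)\<zeta>)\<close>, with \<open>A\<close> and \<open>A\<^sub>1\<close> the trivialisations in \<open>c\<close> and in the chart at the unit.
  Differentiating at the unit in the direction \<open>u\<close> gives
  \<open>DA(A u)\<zeta> = D\<^sup>2\<phi>(u, \<zeta>) + A(DA\<^sub>1(u)\<zeta>)\<close>. Antisymmetrising in \<open>u\<close> and \<open>\<zeta>\<close> removes the symmetric second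
  derivative and leaves the bracket at the unit.
\<close>

lemma bracket_left_invariant:
  assumes c: "c \<in> atlas M" and p: "p \<in> fst c"
  shows "dtriv c (snd c p) (triv c (snd c p) \<eta>) \<xi> - dtriv c (snd c p) (triv c (snd c p) \<xi>) \<eta>
    = triv c (snd c p) (bracket \<eta> \<xi>)"
proof -
  have pG: "p \<in> carrier G" using c p chart_subset by blast
  define \<phi> where "\<phi> = trans_rep p one_chart c"
  define V where "V = trans_dom p one_chart c"
  define D where "D z = frechet_derivative \<phi> (at z)" for z
  define e where "e = coord_at M \<one>"
  have V: "open V" "smooth_on V \<phi>"
    unfolding V_def \<phi>_def using trans_rep_smooth[OF pG one_chart(1) c] by auto
  have eV: "e \<in> V"
    unfolding V_def e_def trans_dom_def coord_at_def using one_chart p pG by auto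
  have \<phi>e: "\<phi> e = snd c p"
    using one_chart pG by (simp add: \<phi>_def trans_rep_def e_def coord_at_def chart_inv_coord
        del: inv_into_f_f)
  have D\<phi>: "(\<phi> has_derivative D z) (at z)" if "z \<in> V" for z
    unfolding D_def using smooth_on_has_derivative[OF V(2,1) that] .
  have De: "D e = triv c (snd c p)"
    using c p by (simp add: D_def triv_def trans_deriv_def \<phi>_def e_def coord_at_def chart_inv_coord
        del: inv_into_f_f)
  have inv: "D z (triv one_chart z \<zeta>) = triv c (\<phi> z) \<zeta>" if zV: "z \<in> V" for z \<zeta>
  proof -
    obtain g where g: "z = snd one_chart g" "g \<in> fst one_chart" "p \<otimes> g \<in> fst c"
      using zV by (auto simp: V_def trans_dom_def)
    have gG: "g \<in> carrier G" using g one_chart chart_subset by blast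
    have "trans_deriv p one_chart c (g \<otimes> \<one>) (trans_deriv g one_chart one_chart \<one> \<zeta>)
        = trans_deriv (p \<otimes> g) one_chart c \<one> \<zeta>"
      by (rule trans_deriv_comp) (use c g gG pG one_chart in auto)
    then show ?thesis
      using c g gG pG one_chart
      by (simp add: D_def triv_def trans_deriv_def[of p] \<phi>_def trans_rep_def[of p] chart_inv_coord
          del: inv_into_f_f flip: trans_deriv_def)
  qed
  have Vsub: "V \<subseteq> snd one_chart ` fst one_chart" by (auto simp: V_def trans_dom_def)
  have main: "dtriv c (snd c p) (triv c (snd c p) u) \<zeta>
      = frechet_derivative (\<lambda>z. D z \<zeta>) (at e) u + triv c (snd c p) (dtriv one_chart e u \<zeta>)" for u \<zeta>
  proof -
    have "((\<lambda>z. D z (triv one_chart z \<zeta>)) has_derivative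
        (\<lambda>u. frechet_derivative (\<lambda>z. D z (triv one_chart e \<zeta>)) (at e) u + D e (dtriv one_chart e u \<zeta>)))
        (at e within V)"
    proof (rule has_derivative_linear_family[where F = D and w = "\<lambda>z. triv one_chart z \<zeta>"
          and F' = "\<lambda>v. frechet_derivative (\<lambda>z. D z v) (at e)", OF E _ eV])
      show "linear (D z)" if "z \<in> V" for z using D\<phi>[OF that] by (rule has_derivative_linear)
      show "((\<lambda>z. D z v) has_derivative frechet_derivative (\<lambda>z. D z v) (at e)) (at e within V)" for v
        unfolding D_def
        by (rule has_derivative_at_withinI[OF
              smooth_on_has_derivative[OF smooth_on_frechet_derivative[OF V(2,1)] V(1) eV]])
      show "((\<lambda>z. triv one_chart z \<zeta>) has_derivative (\<lambda>u. dtriv one_chart e u \<zeta>)) (at e within V)"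
        by (rule has_derivative_at_withinI[OF triv_has_derivative]) (use one_chart eV Vsub in auto)
    qed
    then have "((\<lambda>z. D z (triv one_chart z \<zeta>)) has_derivative
        (\<lambda>u. frechet_derivative (\<lambda>z. D z \<zeta>) (at e) u + D e (dtriv one_chart e u \<zeta>))) (at e)"
      by (simp add: at_within_open[OF eV V(1)] triv_one[folded e_def])
    then have 1: "((\<lambda>z. triv c (\<phi> z) \<zeta>) has_derivative
        (\<lambda>u. frechet_derivative (\<lambda>z. D z \<zeta>) (at e) u + D e (dtriv one_chart e u \<zeta>))) (at e)"
      by (rule has_derivative_transform_within_open[OF _ V(1) eV inv])
    have 2: "((\<lambda>z. triv c (\<phi> z) \<zeta>) has_derivative (\<lambda>u. dtriv c (\<phi> e) (D e u) \<zeta>)) (at e)"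
      by (rule has_derivative_compose[OF D\<phi>[OF eV] triv_has_derivative]) (use c p \<phi>e in auto)
    from fun_cong[OF has_derivative_unique[OF 2 1], of u] show ?thesis
      unfolding \<phi>e De .
  qed
  have "frechet_derivative (\<lambda>z. D z \<xi>) (at e) \<eta> = frechet_derivative (\<lambda>z. D z \<eta>) (at e) \<xi>"
    unfolding D_def by (rule symmetric_second_derivative[OF V(1) eV V(2)])
  moreover have "linear (triv c (snd c p))" by (rule triv_linear) (use c p in auto)
  ultimately show ?thesis
    by (simp add: main bracket_eq e_def linear_diff)
qed

section \<open>Functions on the tangent bundle in the left trivialisation\<close>

definition trivialised where
  "trivialised K c = (\<lambda>(y, \<zeta>). K (left_push G M (chart_inv c y) \<zeta>))"

lemma left_push_mem:
  assumes "c \<in> atlas M" "g \<in> fst c"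
  shows "left_push G M g \<zeta> \<in> fst (tangent_chart M c)"
  using assms chart_subset[OF assms] by (simp add: left_push_eq tangent_chart_def)

lemma trivialised_eq:
  assumes c: "c \<in> atlas M" and y: "y \<in> snd c ` fst c"
  shows "trivialised K c (y, \<zeta>) = (K \<circ> chart_inv (tangent_chart M c)) (y, triv c y \<zeta>)"
proof -
  obtain g where g: "y = snd c g" "g \<in> fst c" using y by blast
  have "chart_inv (tangent_chart M c) (snd (tangent_chart M c) (left_push G M g \<zeta>)) = left_push G M g \<zeta>"
    by (rule inv_into_f_f[OF tangent_chart_inj[OF c] left_push_mem[OF c g(2)]])
  then show ?thesis
    using c g by (simp add: trivialised_def tangent_chart_left_push chart_inv_coord del: inv_into_f_f)
qed

text \<open>
  Tangent map of the trivialisation \<open>(y, \<zeta>) \<mapsto> (y, triv c y \<zeta>)\<close>. All statements about the double tangent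
  bundle below are read off from this formula.
\<close>

lemma trivialisation_has_derivative:
  assumes c: "c \<in> atlas M" and y: "y \<in> snd c ` fst c"
  shows "((\<lambda>(y, \<zeta>). (y, triv c y \<zeta>)) has_derivative
    (\<lambda>(u, \<zeta>). (u, dtriv c y u \<eta> + triv c y \<zeta>))) (at (y, \<eta>))"
proof -
  let ?S = "(snd c ` fst c) \<times> (UNIV :: 'e set)"
  have S: "open ?S" "(y, \<eta>) \<in> ?S" using y chart_open[OF c] by (auto intro: open_Times)
  have "((\<lambda>w. triv c (fst w) (snd w)) has_derivative
    (\<lambda>u. dtriv c (fst (y, \<eta>)) (fst u) (snd (y, \<eta>)) + triv c (fst (y, \<eta>)) (snd u))) (at (y, \<eta>) within ?S)"
    by (rule triv_has_derivative_along[OF c _ S(2)]) (auto intro!: derivative_eq_intros)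
  then have "((\<lambda>w. triv c (fst w) (snd w)) has_derivative
    (\<lambda>u. dtriv c y (fst u) \<eta> + triv c y (snd u))) (at (y, \<eta>))"
    unfolding at_within_open[OF S(2,1)] by simp
  moreover have "(fst has_derivative fst) (at (y, \<eta>))" by (auto intro!: derivative_eq_intros)
  ultimately show ?thesis
    by (simp add: has_derivative_Pair case_prod_unfold)
qed

lemma trivialised_has_derivative:
  assumes c: "c \<in> atlas M" and y: "y \<in> snd c ` fst c"
    and l: "((K \<circ> chart_inv (tangent_chart M c)) has_derivative l) (at (y, triv c y \<eta>))"
  shows "(trivialised K c has_derivative (\<lambda>(u, \<zeta>). l (u, dtriv c y u \<eta> + triv c y \<zeta>))) (at (y, \<eta>))"
proof -
  let ?S = "(snd c ` fst c) \<times> (UNIV :: 'e set)"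
  have S: "open ?S" "(y, \<eta>) \<in> ?S" using y chart_open[OF c] by (auto intro: open_Times)
  have "((\<lambda>w. (K \<circ> chart_inv (tangent_chart M c)) ((\<lambda>(y, \<zeta>). (y, triv c y \<zeta>)) w)) has_derivative
     (\<lambda>w. l ((\<lambda>(u, \<zeta>). (u, dtriv c y u \<eta> + triv c y \<zeta>)) w))) (at (y, \<eta>))"
    by (rule has_derivative_compose[OF trivialisation_has_derivative[OF c y]])
      (use l in \<open>simp add: comp_def\<close>)
  then show ?thesis
    unfolding case_prod_unfold
  proof (rule has_derivative_transform_within_open[OF _ S])
    fix w assume "w \<in> ?S"
    then show "(K \<circ> chart_inv (tangent_chart M c)) (fst w, triv c (fst w) (snd w)) = trivialised K c w"
      using trivialised_eq[OF c, of "fst w" K "snd w"] by auto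
  qed
qed

lemma trivialised_smooth:
  assumes L: "smooth_fun (tangent_bundle M) L" and c: "c \<in> atlas M"
  shows "smooth_on ((snd c ` fst c) \<times> UNIV) (L \<circ> chart_inv (tangent_chart M c))"
    and "smooth_on ((snd c ` fst c) \<times> UNIV) (trivialised L c)"
proof -
  show l: "smooth_on ((snd c ` fst c) \<times> UNIV) (L \<circ> chart_inv (tangent_chart M c))"
    using L c by (auto simp: smooth_fun_def tangent_bundle_def simp flip: tangent_chart_image[OF c])
  have "smooth_on ((snd c ` fst c) \<times> UNIV) (\<lambda>w. (fst w, (\<lambda>(y, \<zeta>). triv c y \<zeta>) w))"
    by (intro smooth_on_Pair smooth_on_fst smooth_on_id triv_smooth[OF c])
  then have "smooth_on ((snd c ` fst c) \<times> UNIV)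
     (\<lambda>w. (L \<circ> chart_inv (tangent_chart M c)) (fst w, (\<lambda>(y, \<zeta>). triv c y \<zeta>) w))"
    by (rule smooth_on_compose[OF frame_prod[OF E E] l]) auto
  then show "smooth_on ((snd c ` fst c) \<times> UNIV) (trivialised L c)"
    by (rule smooth_on_cong) (auto simp: trivialised_eq[OF c])
qed

text \<open>
  The next two lemmas identify the partial differentials of \<open>K\<close> with those of its trivialised form in
  an arbitrary chart around \<open>g\<close>, not just the preferred one. This is what allows \<open>g\<close> to move along
  a curve while the chart stays fixed.
\<close>

lemma partial_eta_eq:
  assumes c: "c \<in> atlas M" and g: "g \<in> fst c"
    and D: "(trivialised K c has_derivative D) (at (snd c g, \<eta>))"
  shows "partial_eta G M K g \<eta> v = D (0, v)"
proof -
  have "(Pair (snd c g) has_derivative (\<lambda>v. (0, v))) (at \<eta>)"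
    by (auto intro!: derivative_eq_intros)
  from has_derivative_compose[OF this D]
  have "((\<lambda>\<zeta>. K (left_push G M g \<zeta>)) has_derivative (\<lambda>v. D (0, v))) (at \<eta>)"
    using c g by (simp add: trivialised_def chart_inv_coord del: inv_into_f_f)
  from fun_cong[OF frechet_derivative_at[OF this], of v] show ?thesis
    unfolding partial_eta_def by (rule sym)
qed

lemma covector_pull_partial_h_eq:
  assumes c: "c \<in> atlas M" and g: "g \<in> fst c"
    and D: "(trivialised K c has_derivative D) (at (snd c g, \<eta>))"
  shows "covector_pull G M g (partial_h G M K g \<eta>) \<xi> = D (triv c (snd c g) \<xi>, 0)"
proof -
  have gG: "g \<in> carrier G" using c g chart_subset by blast
  let ?a = "chart_at M g"
  have a: "?a \<in> atlas M" "g \<in> fst ?a" using gG chart_at_atlas chart_at_mem by auto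
  let ?v = "trans_deriv g one_chart ?a \<one> \<xi>"
  let ?f = "\<lambda>q. K (left_push G M q \<eta>)"
  have "trans_rep \<one> ?a c (snd ?a g) = snd c g"
    using a gG by (simp add: trans_rep_def chart_inv_coord del: inv_into_f_f)
  moreover have "(trans_rep \<one> ?a c has_derivative trans_deriv \<one> ?a c g) (at (snd ?a g))"
    by (rule trans_rep_has_derivative) (use a c g gG in auto)
  ultimately have "((\<lambda>z. (trans_rep \<one> ?a c z, \<eta>)) has_derivative (\<lambda>v. (trans_deriv \<one> ?a c g v, 0)))
      (at (snd ?a g))" "(trivialised K c has_derivative D) (at (trans_rep \<one> ?a c (snd ?a g), \<eta>))"
    using D by (auto intro!: has_derivative_Pair)
  from has_derivative_compose[OF this]
  have "((\<lambda>z. trivialised K c (trans_rep \<one> ?a c z, \<eta>)) has_derivative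
      (\<lambda>v. D (trans_deriv \<one> ?a c g v, 0))) (at (snd ?a g))" .
  then have "((?f \<circ> chart_inv ?a) has_derivative (\<lambda>v. D (trans_deriv \<one> ?a c g v, 0))) (at (snd ?a g))"
  proof (rule has_derivative_transform_within_open)
    show "open (trans_dom \<one> ?a c)" by (rule trans_rep_smooth) (use a c in auto)
    show "snd ?a g \<in> trans_dom \<one> ?a c" using a g gG by (auto simp: trans_dom_def)
    fix z assume "z \<in> trans_dom \<one> ?a c"
    then obtain q where q: "z = snd ?a q" "q \<in> fst ?a" "\<one> \<otimes> q \<in> fst c"
      by (auto simp: trans_dom_def)
    moreover have "q \<in> carrier G" using q a chart_subset by blast
    ultimately show "trivialised K c (trans_rep \<one> ?a c z, \<eta>) = (?f \<circ> chart_inv ?a) z"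
      using a c by (simp add: trans_rep_def trivialised_def chart_inv_coord del: inv_into_f_f)
  qed
  from fun_cong[OF frechet_derivative_at[OF this], of ?v]
  have "differential M ?f (g, ?v) = D (trans_deriv \<one> ?a c g ?v, 0)"
    by (simp add: differential_def coord_at_def)
  moreover have "trans_deriv \<one> ?a c (g \<otimes> \<one>) ?v = trans_deriv (\<one> \<otimes> g) one_chart c \<one> \<xi>"
    by (rule trans_deriv_comp) (use a c g gG one_chart in auto)
  ultimately show ?thesis
    using gG c g by (simp add: covector_pull_def partial_h_def left_push_eq triv_def chart_inv_coord
        del: inv_into_f_f)
qed

section \<open>Variations of admissible curves\<close>

text \<open>
  In the trivialisation, the distribution is the product of the group with \<open>d\<close>, so its tangent
  vectors at a point with fibre component in \<open>d\<close> are the pairs \<open>(u, \<zeta>)\<close> with \<open>\<zeta> \<in> d\<close>. The map \<open>Q\<close>, with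
  kernel \<open>d\<close>, makes membership in \<open>d\<close> an equation that can be differentiated.

  For the forward direction the fibre component of a curve in the distribution is recovered with the
  smooth inverse trivialisation and annihilated by \<open>Q\<close>; its derivative is \<open>\<zeta>\<close>. For the converse
  the curve \<open>(y + su, \<eta> + s\<zeta>)\<close> in the trivialisation lies in the distribution and has the required velocity.
\<close>

lemma tangent_to_distribution_iff:
  assumes p: "p \<in> carrier G" and \<eta>: "\<eta> \<in> d"
    and Q: "bounded_linear Q" and d: "d = {x. Q x = 0}"
  defines "c \<equiv> chart_at M p" and "y \<equiv> coord_at M p"
  shows "tangent_to (tangent_bundle M) (constraint_distribution G M d)
      ((p, triv c y \<eta>), (u, dtriv c y u \<eta> + triv c y \<zeta>)) \<longleftrightarrow> \<zeta> \<in> d"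
    (is "?T \<longleftrightarrow> _")
proof
  have c: "c \<in> atlas M" "p \<in> fst c" using p by (simp_all add: c_def chart_at_atlas chart_at_mem)
  have yp: "y = snd c p" by (simp add: y_def c_def coord_at_def)
  have y: "y \<in> snd c ` fst c" using c yp by blast
  have p\<eta>: "left_push G M p \<eta> = (p, triv c y \<eta>)"
    using p by (simp add: left_push_preferred c_def y_def)
  have chart_TM: "chart_at (tangent_bundle M) (p, v) = tangent_chart M c" for v
    by (simp add: tangent_bundle_def c_def)
  note push = trivialisation_has_derivative[OF c(1) y, of \<eta>]
  let ?\<Phi>' = "\<lambda>(u, \<zeta>). (u, dtriv c y u \<eta> + triv c y \<zeta>)"
  {
    assume ?T
    then obtain \<epsilon> x where \<epsilon>: "\<epsilon> > 0" and x: "smooth_curve (tangent_bundle M) {-\<epsilon><..<\<epsilon>} x"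
      and xD: "x ` {-\<epsilon><..<\<epsilon>} \<subseteq> constraint_distribution G M d"
      and lift: "tangent_lift (tangent_bundle M) {-\<epsilon><..<\<epsilon>} x 0
         = ((p, triv c y \<eta>), (u, dtriv c y u \<eta> + triv c y \<zeta>))"
      unfolding tangent_to_def by blast
    define I where "I = {-\<epsilon><..<\<epsilon>}"
    have x0: "x 0 = (p, triv c y \<eta>)" using lift by (simp add: tangent_lift_def)
    define O' where "O' = I \<inter> x -` fst (tangent_chart M c)"
    have "tangent_chart M c \<in> atlas (tangent_bundle M)" using c by (simp add: tangent_bundle_def)
    then have O': "openin (top_of_set I) O'" "smooth_on O' (snd (tangent_chart M c) \<circ> x)"
      using x by (auto simp: smooth_curve_def O'_def I_def)
    have openO: "open O'" using O'(1) by (rule openin_open_trans) (simp add: I_def)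
    have zero: "0 \<in> O'" using \<epsilon> x0 c by (simp add: O'_def I_def tangent_chart_def)
    define z where "z = snd (tangent_chart M c) \<circ> x"
    have z0: "z 0 = (y, triv c y \<eta>)"
      using tangent_chart_preferred[OF p] x0 by (simp add: z_def c_def y_def)
    have "(z has_vector_derivative vector_derivative z (at 0 within O')) (at 0 within O')"
      unfolding z_def by (rule smooth_on_has_vector_derivative[OF O'(2) zero])
    moreover have "vector_derivative z (at 0 within O') = ?\<Phi>' (u, \<zeta>)"
      using lift unfolding at_within_openin[OF O'(1) zero]
      by (simp add: tangent_lift_def x0 chart_TM z_def I_def)
    ultimately have "(z has_vector_derivative ?\<Phi>' (u, \<zeta>)) (at 0)"
      unfolding at_within_open[OF zero openO] by simp
    then have z': "(z has_derivative (\<lambda>r. r *\<^sub>R ?\<Phi>' (u, \<zeta>))) (at 0)"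
      unfolding has_vector_derivative_def .
    obtain V where V: "open V" "y \<in> V" "V \<subseteq> snd c ` fst c"
      and sm: "smooth_on (V \<times> UNIV) (\<lambda>(y, v). itriv c y v)"
      using itriv_smooth[OF c(1) y] .
    define J where "J = frechet_derivative (\<lambda>(y, v). itriv c y v) (at (y, triv c y \<eta>))"
    have J: "((\<lambda>(y, v). itriv c y v) has_derivative J) (at (y, triv c y \<eta>))"
      unfolding J_def by (rule smooth_on_has_derivative[OF sm]) (use V in \<open>auto intro: open_Times\<close>)
    have "((\<lambda>w. (\<lambda>(y, v). itriv c y v) ((\<lambda>(y, \<zeta>). (y, triv c y \<zeta>)) w)) has_derivative
        (\<lambda>w. J (?\<Phi>' w))) (at (y, \<eta>))"
      by (rule has_derivative_compose[OF push]) (use J in simp)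
    then have "(snd has_derivative (\<lambda>w. J (?\<Phi>' w))) (at (y, \<eta>))"
      by (rule has_derivative_transform_within_open[where s = "V \<times> UNIV"])
         (use V c in \<open>auto intro!: open_Times itriv_triv\<close>)
    moreover have "(snd has_derivative snd) (at (y, \<eta>))" by (auto intro!: derivative_eq_intros)
    \<comment> \<open>\<open>itriv\<close> undoes the trivialisation, so its derivative \<open>J\<close> undoes the tangent map.\<close>
    ultimately have J_eq: "(\<lambda>w. J (?\<Phi>' w)) = snd" by (rule has_derivative_unique)
    have J\<zeta>: "J (?\<Phi>' (u, \<zeta>)) = \<zeta>" using fun_cong[OF J_eq, of "(u, \<zeta>)"] by simp
    have "((\<lambda>s. (\<lambda>(y, v). itriv c y v) (z s)) has_derivative (\<lambda>r. J (r *\<^sub>R ?\<Phi>' (u, \<zeta>)))) (at 0)"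
      by (rule has_derivative_compose[OF z']) (use J z0 in simp)
    then have der: "((\<lambda>s. Q ((\<lambda>(y, v). itriv c y v) (z s))) has_derivative
        (\<lambda>r. Q (J (r *\<^sub>R ?\<Phi>' (u, \<zeta>))))) (at 0)"
      by (rule bounded_linear.has_derivative[OF Q])
    have "Q ((\<lambda>(y, v). itriv c y v) (z s)) = 0" if s: "s \<in> O'" for s
    proof -
      have "x s \<in> constraint_distribution G M d" using s xD by (auto simp: O'_def I_def)
      then obtain g \<theta> where g: "x s = left_push G M g \<theta>" "g \<in> carrier G" "\<theta> \<in> d"
        by (auto simp: constraint_distribution_def)
      have "g \<in> fst c" using s g by (simp add: O'_def left_push_eq tangent_chart_def)
      then have "(\<lambda>(y, v). itriv c y v) (z s) = \<theta>"
        using g c by (simp add: z_def tangent_chart_left_push itriv_triv)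
      then show ?thesis using g d by simp
    qed
    \<comment> \<open>The fibre component stays in the kernel of \<open>Q\<close> for all \<open>s\<close>, hence so does its derivative.\<close>
    from has_derivative_transform_within_open[OF der openO zero this]
    have "((\<lambda>s. 0) has_derivative (\<lambda>r. Q (J (r *\<^sub>R ?\<Phi>' (u, \<zeta>))))) (at 0)" .
    from fun_cong[OF has_derivative_unique[OF this has_derivative_const], of 1]
    have "Q \<zeta> = 0" using J\<zeta> by simp
    then show "\<zeta> \<in> d" using d by simp
  }
  {
    assume \<zeta>: "\<zeta> \<in> d"
    have "open ((\<lambda>s::real. y + s *\<^sub>R u) -` (snd c ` fst c))"
      by (intro open_vimage chart_open c continuous_intros)
    then have "open {s::real. y + s *\<^sub>R u \<in> snd c ` fst c}" by (simp add: vimage_def)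
    moreover have "0 \<in> {s::real. y + s *\<^sub>R u \<in> snd c ` fst c}" using y by simp
    ultimately obtain \<epsilon> where \<epsilon>: "\<epsilon> > 0" and sub: "ball 0 \<epsilon> \<subseteq> {s::real. y + s *\<^sub>R u \<in> snd c ` fst c}"
      by (meson openE)
    define I where "I = {-\<epsilon><..<\<epsilon>}"
    have zero: "0 \<in> I" "open I" using \<epsilon> by (auto simp: I_def)
    have yU: "y + s *\<^sub>R u \<in> snd c ` fst c" if "s \<in> I" for s
    proof -
      have "s \<in> ball 0 \<epsilon>" using that by (auto simp: I_def dist_real_def)
      then show ?thesis using sub by blast
    qed
    define g where "g s = chart_inv c (y + s *\<^sub>R u)" for s :: real
    have g: "g s \<in> fst c" "snd c (g s) = y + s *\<^sub>R u" "g s \<in> carrier G" if "s \<in> I" for s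
    proof -
      show "g s \<in> fst c" unfolding g_def using yU[OF that] by (rule inv_into_into)
      then show "g s \<in> carrier G" using c chart_subset by blast
      show "snd c (g s) = y + s *\<^sub>R u" unfolding g_def using yU[OF that] by (rule f_inv_into_f)
    qed
    have g0: "g 0 = p" using c by (simp add: g_def yp chart_inv_coord del: inv_into_f_f)
    define x where "x s = left_push G M (g s) (\<eta> + s *\<^sub>R \<zeta>)" for s
    have x0: "x 0 = (p, triv c y \<eta>)" by (simp add: x_def g0 p\<eta>)
    have curve: "smooth_curve (tangent_bundle M) I x"
      unfolding smooth_curve_def
    proof (intro conjI ballI)
      show "x ` I \<subseteq> points (tangent_bundle M)"
        using g by (auto simp: x_def left_push_eq tangent_bundle_def points_eq)
    next
      fix a assume "a \<in> atlas (tangent_bundle M)"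
      then obtain c' where c': "c' \<in> atlas M" and a: "a = tangent_chart M c'"
        by (auto simp: tangent_bundle_def)
      let ?O = "I \<inter> x -` fst a"
      let ?line = "\<lambda>s::real. y + s *\<^sub>R u"
      \<comment> \<open>Smoothness must hold in every chart \<open>c'\<close>; on the overlap with \<open>c\<close> the base curve is a transition
        map applied to a straight line, and the fibre is given by the trivialisation in \<open>c'\<close>.\<close>
      have mem: "x s \<in> fst a \<longleftrightarrow> ?line s \<in> trans_dom \<one> c c'" if s: "s \<in> I" for s
      proof -
        have "x s \<in> fst a \<longleftrightarrow> g s \<in> fst c'"
          using g[OF s] by (simp add: x_def left_push_eq a tangent_chart_def)
        also have "\<dots> \<longleftrightarrow> snd c (g s) \<in> trans_dom \<one> c c'"
        proof
          assume "g s \<in> fst c'"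
          then have "\<one> \<otimes> g s \<in> fst c'" using g(3)[OF s] by simp
          then show "snd c (g s) \<in> trans_dom \<one> c c'"
            unfolding trans_dom_def using g(1)[OF s] by blast
        next
          assume "snd c (g s) \<in> trans_dom \<one> c c'"
          then obtain q where q: "snd c (g s) = snd c q" "q \<in> fst c" "\<one> \<otimes> q \<in> fst c'"
            unfolding trans_dom_def by blast
          then have "g s = q" using inj_onD[OF chart_inj[OF c(1)] q(1) g(1)[OF s] q(2)] by simp
          then show "g s \<in> fst c'" using q(3) g(3)[OF s] by simp
        qed
        finally show ?thesis using g[OF s] by simp
      qed
      have O: "?O = I \<inter> ?line -` trans_dom \<one> c c'"
        unfolding vimage_def using mem by blast
      have "open (?line -` trans_dom \<one> c c')"
        by (intro open_vimage trans_rep_smooth c c' continuous_intros) auto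
      then show "openin (top_of_set I) ?O" unfolding O by (auto simp: openin_open)
      have line: "smooth_on ?O ?line"
        by (intro smooth_on_add smooth_on_const smooth_on_scaleR smooth_on_id)
      have "?line ` ?O \<subseteq> trans_dom \<one> c c'" using mem by blast
      from smooth_on_compose[OF E trans_rep_smooth(2)[OF one_closed c(1) c'] line this]
      have 1: "smooth_on ?O (\<lambda>s. trans_rep \<one> c c' (?line s))" .
      have cg: "trans_rep \<one> c c' (?line s) = snd c' (g s)" if "s \<in> I" for s
        using g[OF that] by (simp add: trans_rep_def flip: g_def)
      have "smooth_on ?O (\<lambda>s. (trans_rep \<one> c c' (?line s), \<eta> + s *\<^sub>R \<zeta>))"
        by (intro smooth_on_Pair 1 smooth_on_add smooth_on_const smooth_on_scaleR smooth_on_id)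
      moreover have "(\<lambda>s. (trans_rep \<one> c c' (?line s), \<eta> + s *\<^sub>R \<zeta>)) ` ?O \<subseteq> (snd c' ` fst c') \<times> UNIV"
        using cg g by (auto simp: x_def left_push_eq a tangent_chart_def)
      ultimately have 2: "smooth_on ?O (\<lambda>s. (\<lambda>(y, \<zeta>). triv c' y \<zeta>) (trans_rep \<one> c c' (?line s), \<eta> + s *\<^sub>R \<zeta>))"
        by (rule smooth_on_compose[OF frame_prod[OF E E] triv_smooth[OF c']])
      have "smooth_on ?O (\<lambda>s. (trans_rep \<one> c c' (?line s),
          (\<lambda>(y, \<zeta>). triv c' y \<zeta>) (trans_rep \<one> c c' (?line s), \<eta> + s *\<^sub>R \<zeta>)))"
        by (rule smooth_on_Pair[OF 1 2])
      then show "smooth_on ?O (snd a \<circ> x)"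
      proof (rule smooth_on_cong)
        fix s assume s: "s \<in> ?O"
        then have "g s \<in> fst c'" using g by (auto simp: x_def left_push_eq a tangent_chart_def)
        then show "(trans_rep \<one> c c' (?line s),
          (\<lambda>(y, \<zeta>). triv c' y \<zeta>) (trans_rep \<one> c c' (?line s), \<eta> + s *\<^sub>R \<zeta>)) = (snd a \<circ> x) s"
          using s cg c' by (simp add: x_def a tangent_chart_left_push)
      qed
    qed
    have "x s \<in> constraint_distribution G M d" if "s \<in> I" for s
    proof -
      have "Q (\<eta> + s *\<^sub>R \<zeta>) = 0"
        using \<eta> \<zeta> d by (simp add: linear_simps[OF Q])
      then show ?thesis using g[OF that] d by (auto simp: constraint_distribution_def x_def)
    qed
    then have sub: "x ` I \<subseteq> constraint_distribution G M d" by blast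
    have "((\<lambda>s. (y + s *\<^sub>R u, \<eta> + s *\<^sub>R \<zeta>)) has_derivative (\<lambda>r. r *\<^sub>R (u, \<zeta>))) (at 0)"
      by (auto intro!: derivative_eq_intros)
    from has_derivative_compose[OF this, of "\<lambda>(y, \<zeta>). (y, triv c y \<zeta>)" ?\<Phi>'] push
    have "((\<lambda>s. (y + s *\<^sub>R u, triv c (y + s *\<^sub>R u) (\<eta> + s *\<^sub>R \<zeta>)))
        has_derivative (\<lambda>r. ?\<Phi>' (r *\<^sub>R (u, \<zeta>)))) (at 0)"
      by simp
    then have "((snd (tangent_chart M c) \<circ> x) has_derivative (\<lambda>r. ?\<Phi>' (r *\<^sub>R (u, \<zeta>)))) (at 0)"
      by (rule has_derivative_transform_within_open[OF _ zero(2,1)])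
        (simp add: x_def g c tangent_chart_left_push)
    moreover have "(\<lambda>r. ?\<Phi>' (r *\<^sub>R (u, \<zeta>))) = (\<lambda>r. r *\<^sub>R ?\<Phi>' (u, \<zeta>))"
      by (rule ext) (simp add: linear_scale[OF dtriv_linear_left[OF c(1) y]]
          linear_scale[OF triv_linear[OF c(1) y]] scaleR_right_distrib)
    ultimately have "((snd (tangent_chart M c) \<circ> x) has_vector_derivative ?\<Phi>' (u, \<zeta>)) (at 0)"
      by (simp add: has_vector_derivative_def)
    then have "vector_derivative (snd (tangent_chart M c) \<circ> x) (at 0 within I) = ?\<Phi>' (u, \<zeta>)"
      by (simp add: at_within_open[OF zero] vector_derivative_at)
    then have "tangent_lift (tangent_bundle M) I x 0
        = ((p, triv c y \<eta>), (u, dtriv c y u \<eta> + triv c y \<zeta>))"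
      by (simp add: tangent_lift_def x0 chart_TM)
    then show ?T unfolding tangent_to_def using \<epsilon> curve sub unfolding I_def by blast
  }
qed

end

locale admissible_curve = lie_group_charts G M E
  for G :: "('a, 'g) monoid_scheme" (structure)
    and M :: "('a, 'e::real_inner) manifold" and E :: "'e set" +
  fixes t0 t1 :: real and h :: "real \<Rightarrow> 'a" and \<eta> :: "real \<Rightarrow> 'e"
  assumes t01: "t0 < t1" and adm: "admissible G M {t0..t1} h \<eta>"
begin

abbreviation I where "I \<equiv> {t0..t1}"

lemma vector_derivative_I:
  "t \<in> I \<Longrightarrow> (f has_vector_derivative f') (at t within I) \<Longrightarrow> vector_derivative f (at t within I) = f'"
  using vector_derivative_within_cbox[OF t01, of t f f'] by simp

lemma curve_in_group: "t \<in> I \<Longrightarrow> h t \<in> carrier G"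
  using adm by (auto simp: admissible_def smooth_curve_def points_eq)

lemma eta_smooth: "smooth_on I \<eta>"
  using adm by (simp add: admissible_def)

text \<open>
  The times at which the curve lies in the domain of \<open>c\<close>; these sets cover the interval.
\<close>

definition chart_times where "chart_times c = I \<inter> h -` fst c"

lemma chart_times_openin: "c \<in> atlas M \<Longrightarrow> openin (top_of_set I) (chart_times c)"
  and curve_coord_smooth: "c \<in> atlas M \<Longrightarrow> smooth_on (chart_times c) (snd c \<circ> h)"
  using adm by (auto simp: admissible_def smooth_curve_def chart_times_def)

lemma chart_times_at:
  assumes "t \<in> I"
  shows "chart_at M (h t) \<in> atlas M" "t \<in> chart_times (chart_at M (h t))"
  using assms curve_in_group by (auto simp: chart_times_def chart_at_atlas chart_at_mem)

lemma curve_velocity: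
  assumes t: "t \<in> I"
  defines "c \<equiv> chart_at M (h t)"
  shows "((snd c \<circ> h) has_vector_derivative triv c (coord_at M (h t)) (\<eta> t)) (at t within I)"
proof -
  have c: "c \<in> atlas M" "t \<in> chart_times c" using chart_times_at[OF t] by (simp_all add: c_def)
  have "left_push G M (h t) (\<eta> t) = tangent_lift M I h t" using adm t by (simp add: admissible_def)
  then have "vector_derivative (snd c \<circ> h) (at t within I) = triv c (coord_at M (h t)) (\<eta> t)"
    using curve_in_group[OF t] by (simp add: left_push_preferred tangent_lift_def c_def)
  then show ?thesis
    using smooth_on_has_vector_derivative[OF curve_coord_smooth[OF c(1)] c(2)]
    by (simp add: at_within_openin[OF chart_times_openin[OF c(1)] c(2)])
qed

text \<open>
  The velocity of \<open>s \<mapsto> h(s)\<^sub>*\<xi>(s)\<close> has the fibre part \<open>DA(A\<eta>)\<xi> + A\<xi>'\<close>, since the base velocity is \<open>A\<eta>\<close>. Rewriting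
  it with \<open>bracket_left_invariant\<close> exhibits the variation as the image of \<open>(A\<xi>, \<xi>' + [\<eta>, \<xi>])\<close> under
  the tangent map of the trivialisation.
\<close>

lemma admissible_variation_eq:
  assumes t: "t \<in> I" and \<xi>: "(\<xi> has_vector_derivative \<xi>') (at t within I)"
  defines "c \<equiv> chart_at M (h t)" and "y \<equiv> coord_at M (h t)"
  shows "admissible_variation G M I h \<xi> t = ((h t, triv c y (\<eta> t)),
    (triv c y (\<xi> t), dtriv c y (triv c y (\<xi> t)) (\<eta> t) + triv c y (\<xi>' + bracket (\<eta> t) (\<xi> t))))"
proof -
  have c: "c \<in> atlas M" "t \<in> chart_times c" using chart_times_at[OF t] by (simp_all add: c_def)
  have hc: "h t \<in> fst c" using c by (simp add: chart_times_def)
  have y_eq: "y = snd c (h t)" by (simp add: y_def c_def coord_at_def)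
  note within = at_within_openin[OF chart_times_openin[OF c(1)] c(2)]
  let ?O = "chart_times c"
  let ?v = "triv c y (\<eta> t)"
  let ?x = "\<lambda>s. left_push G M (h s) (\<xi> s)"
  have x': "((\<lambda>s. snd c (h s)) has_derivative (\<lambda>r. r *\<^sub>R ?v)) (at t within ?O)"
    using curve_velocity[OF t]
    by (simp add: within has_vector_derivative_def comp_def flip: c_def y_def)
  have \<xi>': "(\<xi> has_derivative (\<lambda>r. r *\<^sub>R \<xi>')) (at t within ?O)"
    using \<xi> by (simp add: within has_vector_derivative_def)
  have "((\<lambda>s. triv c (snd c (h s)) (\<xi> s)) has_derivative
      (\<lambda>r. dtriv c (snd c (h t)) (r *\<^sub>R ?v) (\<xi> t) + triv c (snd c (h t)) (r *\<^sub>R \<xi>'))) (at t within ?O)"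
    by (rule triv_has_derivative_along[OF c(1) _ c(2) x' \<xi>']) (simp add: chart_times_def)
  then have "((\<lambda>s. (snd c (h s), triv c (snd c (h s)) (\<xi> s))) has_derivative
      (\<lambda>r. (r *\<^sub>R ?v, dtriv c y (r *\<^sub>R ?v) (\<xi> t) + triv c y (r *\<^sub>R \<xi>')))) (at t within ?O)"
    unfolding y_eq[symmetric] by (rule has_derivative_Pair[OF x'])
  moreover have "(\<lambda>r. (r *\<^sub>R ?v, dtriv c y (r *\<^sub>R ?v) (\<xi> t) + triv c y (r *\<^sub>R \<xi>')))
      = (\<lambda>r. r *\<^sub>R (?v, dtriv c y ?v (\<xi> t) + triv c y \<xi>'))"
    using c hc by (intro ext) (simp add: y_eq linear_scale[OF dtriv_linear_left]
          linear_scale[OF triv_linear] scaleR_right_distrib)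
  ultimately have "((\<lambda>s. (snd c (h s), triv c (snd c (h s)) (\<xi> s))) has_vector_derivative
      (?v, dtriv c y ?v (\<xi> t) + triv c y \<xi>')) (at t within ?O)"
    by (simp add: has_vector_derivative_def)
  then have "((snd (tangent_chart M c) \<circ> ?x) has_vector_derivative
      (?v, dtriv c y ?v (\<xi> t) + triv c y \<xi>')) (at t within ?O)"
    by (rule has_vector_derivative_transform[OF c(2), rotated])
      (simp add: tangent_chart_left_push[OF c(1)] chart_times_def)
  then have "vector_derivative (snd (tangent_chart M c) \<circ> ?x) (at t within I)
      = (?v, dtriv c y ?v (\<xi> t) + triv c y \<xi>')"
    by (intro vector_derivative_I[OF t]) (simp add: within)
  moreover have "?x t = (h t, triv c y (\<xi> t))"
    using curve_in_group[OF t] by (simp add: left_push_preferred c_def y_def)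
  moreover have "chart_at (tangent_bundle M) (h t, v) = tangent_chart M c" for v
    by (simp add: tangent_bundle_def c_def)
  ultimately have "admissible_variation G M I h \<xi> t
      = ((h t, ?v), (triv c y (\<xi> t), dtriv c y ?v (\<xi> t) + triv c y \<xi>'))"
    by (simp add: admissible_variation_def canonical_flip_def tangent_lift_def)
  moreover have "dtriv c y ?v (\<xi> t) = dtriv c y (triv c y (\<xi> t)) (\<eta> t) + triv c y (bracket (\<eta> t) (\<xi> t))"
    using bracket_left_invariant[OF c(1) hc, of "\<eta> t" "\<xi> t"] by (simp add: y_eq algebra_simps)
  moreover have "linear (triv c y)" unfolding y_eq by (rule triv_linear) (use c hc in auto)
  ultimately show ?thesis by (simp add: linear_add)
qed

lemma admissible_variation_tangent_iff:
  assumes t: "t \<in> I" and \<xi>: "(\<xi> has_vector_derivative \<xi>') (at t within I)"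
    and \<eta>: "\<eta> t \<in> d" and Q: "bounded_linear Q" and d: "d = {x. Q x = 0}"
  shows "tangent_to (tangent_bundle M) (constraint_distribution G M d)
      (admissible_variation G M I h \<xi> t) \<longleftrightarrow> \<xi>' + bracket (\<eta> t) (\<xi> t) \<in> d"
  unfolding admissible_variation_eq[OF t \<xi>]
  by (rule tangent_to_distribution_iff[OF curve_in_group[OF t] \<eta> Q d])

text \<open>
  The chain rule for the trivialised function, evaluated on \<open>(A\<xi>, \<xi>' + [\<eta>, \<xi>])\<close>. It is stated for any
  function differentiable at the relevant point, so that it covers the modified Lagrangian at a
  fixed time.
\<close>

lemma first_variation:
  assumes t: "t \<in> I" and \<xi>: "(\<xi> has_vector_derivative \<xi>') (at t within I)"
  defines "c \<equiv> chart_at M (h t)" and "y \<equiv> coord_at M (h t)"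
  assumes K: "(K \<circ> chart_inv (tangent_chart M c)) differentiable (at (y, triv c y (\<eta> t)))"
  shows "differential (tangent_bundle M) K (admissible_variation G M I h \<xi> t)
    = covector_pull G M (h t) (partial_h G M K (h t) (\<eta> t)) (\<xi> t)
      + partial_eta G M K (h t) (\<eta> t) (\<xi>' + bracket (\<eta> t) (\<xi> t))"
proof -
  have c: "c \<in> atlas M" "h t \<in> fst c" using chart_times_at[OF t] by (simp_all add: c_def chart_times_def)
  have y: "y = snd c (h t)" by (simp add: y_def c_def coord_at_def)
  have yU: "y \<in> snd c ` fst c" using c y by simp
  let ?l = "frechet_derivative (K \<circ> chart_inv (tangent_chart M c)) (at (y, triv c y (\<eta> t)))"
  let ?D = "\<lambda>(u, \<zeta>). ?l (u, dtriv c y u (\<eta> t) + triv c y \<zeta>)"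
  have D: "(trivialised K c has_derivative ?D) (at (snd c (h t), \<eta> t))"
    unfolding y[symmetric]
    by (rule trivialised_has_derivative[OF c(1) yU]) (use K frechet_derivative_works in blast)
  let ?u = "triv c y (\<xi> t)" and ?w = "\<xi>' + bracket (\<eta> t) (\<xi> t)"
  have "differential (tangent_bundle M) K (admissible_variation G M I h \<xi> t) = ?D (?u, ?w)"
    unfolding admissible_variation_eq[OF t \<xi>]
    using tangent_chart_preferred[OF curve_in_group[OF t], of "triv c y (\<eta> t)"]
    by (simp add: differential_def tangent_bundle_def coord_at_def[of "tangent_bundle M"]
        coord_at_def[of "\<lparr>points = _, atlas = _, chart_at = _\<rparr>"]
        flip: c_def y_def)
  also have "?D (?u, ?w) = ?D ((?u, 0) + (0, ?w))" by simp
  also have "\<dots> = ?D (?u, 0) + ?D (0, ?w)"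
    using linear_add[OF has_derivative_linear[OF D]] .
  finally show ?thesis
    using covector_pull_partial_h_eq[OF c D] partial_eta_eq[OF c D] by (simp add: y)
qed

lemma lagrangian_differentiable:
  assumes L: "smooth_fun (tangent_bundle M) L" and t: "t \<in> I"
  defines "c \<equiv> chart_at M (h t)" and "y \<equiv> coord_at M (h t)"
  shows "(L \<circ> chart_inv (tangent_chart M c)) differentiable (at (y, v))"
proof -
  have c: "c \<in> atlas M" "h t \<in> fst c" using chart_times_at[OF t] by (simp_all add: c_def chart_times_def)
  have yU: "y \<in> snd c ` fst c" using c by (simp add: y_def c_def coord_at_def)
  have "open (snd c ` fst c \<times> (UNIV :: 'e set))" using chart_open[OF c(1)] by (simp add: open_Times)
  from smooth_on_has_derivative[OF trivialised_smooth(1)[OF L c(1)] this, of "(y, v)"] yU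
  show ?thesis by (auto simp: differentiable_def)
qed

text \<open>
  In the trivialisation the extra term is \<open>\<zeta> \<mapsto> \<langle>\<lambda>, P'\<zeta>\<rangle>\<close>, independent of the base point: the force is
  unchanged and the momentum loses \<open>\<lambda>P'\<close>. Smoothness of \<open>itriv\<close> provides differentiability.
\<close>

lemma first_variation_modified:
  assumes L: "smooth_fun (tangent_bundle M) L"
    and t: "t \<in> I" and \<xi>: "(\<xi> has_vector_derivative \<xi>') (at t within I)"
    and f: "linear (\<lambda>x. lam t (P' x))"
  shows "differential (tangent_bundle M) (modified_lagrangian G M P' L lam t)
      (admissible_variation G M I h \<xi> t)
    = covector_pull G M (h t) (partial_h G M L (h t) (\<eta> t)) (\<xi> t)
      + partial_eta G M L (h t) (\<eta> t) (\<xi>' + bracket (\<eta> t) (\<xi> t))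
      - lam t (P' (\<xi>' + bracket (\<eta> t) (\<xi> t)))"
proof -
  define c where "c = chart_at M (h t)"
  define y where "y = coord_at M (h t)"
  define f where "f x = lam t (P' x)" for x
  have bf: "bounded_linear f" unfolding f_def by (rule frame_bounded_linear[OF E f])
  let ?K = "modified_lagrangian G M P' L lam t"
  let ?v = "triv c y (\<eta> t)"
  have c: "c \<in> atlas M" "h t \<in> fst c" using chart_times_at[OF t] by (simp_all add: c_def chart_times_def)
  have y_eq: "y = snd c (h t)" by (simp add: y_def c_def coord_at_def)
  have yU: "y \<in> snd c ` fst c" using c y_eq by simp
  obtain V where V: "open V" "y \<in> V" "V \<subseteq> snd c ` fst c"
    and sm: "smooth_on (V \<times> UNIV) (\<lambda>(y, v). itriv c y v)"
    using itriv_smooth[OF c(1) yU] .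
  have oV: "open (V \<times> (UNIV :: 'e set))" using V by (simp add: open_Times)
  have "(\<lambda>(y, v). itriv c y v) differentiable (at (y, ?v))"
    using smooth_on_has_derivative[OF sm oV, of "(y, ?v)"] V by (auto simp: differentiable_def)
  then have "(\<lambda>w. f ((\<lambda>(y, v). itriv c y v) w)) differentiable (at (y, ?v))"
    using bounded_linear.has_derivative[OF bf] unfolding differentiable_def by blast
  with lagrangian_differentiable[OF L t, of ?v, folded c_def y_def]
  have "(\<lambda>w. (L \<circ> chart_inv (tangent_chart M c)) w - f ((\<lambda>(y, v). itriv c y v) w))
      differentiable (at (y, ?v))"
    by (rule differentiable_diff)
  then obtain k where k: "((\<lambda>w. (L \<circ> chart_inv (tangent_chart M c)) w - f ((\<lambda>(y, v). itriv c y v) w))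
      has_derivative k) (at (y, ?v))"
    unfolding differentiable_def by blast
  have "((?K \<circ> chart_inv (tangent_chart M c)) has_derivative k) (at (y, ?v))"
  proof (rule has_derivative_transform_within_open[OF k oV])
    show "(y, ?v) \<in> V \<times> UNIV" using V by simp
    fix w assume "w \<in> V \<times> (UNIV :: 'e set)"
    then have w: "w \<in> snd (tangent_chart M c) ` fst (tangent_chart M c)"
      unfolding tangent_chart_image[OF c(1)] using V by blast
    let ?w = "chart_inv (tangent_chart M c) w"
    have tw: "snd (tangent_chart M c) ?w = w" using w by (rule f_inv_into_f)
    have "?w \<in> fst (tangent_chart M c)" using w by (rule inv_into_into)
    then have p: "fst ?w \<in> fst c" by (cases ?w) (simp add: tangent_chart_def)
    have "left_pull G M ?w = itriv c (snd c (fst ?w)) (snd w)"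
      using left_pull_eq[OF c(1) p, of "snd ?w"] tw by simp
    moreover have "snd c (fst ?w) = fst w"
      using tangent_chart_eq[OF c(1) p, of "snd ?w"] tw by (metis fst_conv prod.collapse)
    ultimately show "(L \<circ> chart_inv (tangent_chart M c)) w - f ((\<lambda>(y, v). itriv c y v) w)
        = (?K \<circ> chart_inv (tangent_chart M c)) w"
      by (simp add: modified_lagrangian_def f_def case_prod_unfold)
  qed
  then have dK: "(?K \<circ> chart_inv (tangent_chart M c)) differentiable (at (y, ?v))"
    by (auto simp: differentiable_def)
  let ?D = "frechet_derivative (trivialised L c) (at (snd c (h t), \<eta> t))"
  let ?S = "(snd c ` fst c) \<times> (UNIV :: 'e set)"
  have S: "open ?S" "(snd c (h t), \<eta> t) \<in> ?S"
    using c chart_open[OF c(1)] by (auto intro: open_Times)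
  have D: "(trivialised L c has_derivative ?D) (at (snd c (h t), \<eta> t))"
    by (rule smooth_on_has_derivative[OF trivialised_smooth(2)[OF L c(1)] S])
  have "((\<lambda>w. f (snd w)) has_derivative (\<lambda>w. f (snd w))) (at (snd c (h t), \<eta> t))"
    by (intro bounded_linear.has_derivative[OF bf] derivative_eq_intros) auto
  from has_derivative_diff[OF D this]
  have DK: "(trivialised ?K c has_derivative (\<lambda>w. ?D w - f (snd w))) (at (snd c (h t), \<eta> t))"
  proof (rule has_derivative_transform_within_open[OF _ S])
    fix w assume "w \<in> ?S"
    then obtain g \<zeta> where w: "w = (snd c g, \<zeta>)" "g \<in> fst c" by auto
    then show "trivialised L c w - f (snd w) = trivialised ?K c w"
      using c chart_subset[OF c(1)]
      by (simp add: trivialised_def modified_lagrangian_def f_def chart_inv_coord left_pull_left_push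
          del: inv_into_f_f)
  qed
  have f0: "f 0 = 0" using linear_0[OF bounded_linear.linear[OF bf]] .
  show ?thesis
    using first_variation[OF t \<xi> dK[unfolded c_def y_def]]
    by (simp add: partial_eta_eq[OF c DK] partial_eta_eq[OF c D]
        covector_pull_partial_h_eq[OF c DK] covector_pull_partial_h_eq[OF c D] f0)
       (simp add: f_def)
qed

end

section \<open>The action and its first variation\<close>

locale lagrangian_curve = admissible_curve G M E t0 t1 h \<eta>
  for G :: "('a, 'g) monoid_scheme" (structure)
    and M :: "('a, 'e::real_inner) manifold" and E :: "'e set"
    and t0 t1 :: real and h :: "real \<Rightarrow> 'a" and \<eta> :: "real \<Rightarrow> 'e" +
  fixes L :: "'a \<times> 'e \<Rightarrow> real"
  assumes L: "smooth_fun (tangent_bundle M) L"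
begin

definition force where "force t = covector_pull G M (h t) (partial_h G M L (h t) (\<eta> t))"

definition momentum where "momentum t = partial_eta G M L (h t) (\<eta> t)"

definition action_derivative where
  "action_derivative \<xi> = action_differential M I (\<lambda>t. L) (admissible_variation G M I h \<xi>)"

text \<open>
  Both covectors are values of one derivative in a chart that may stay fixed while \<open>t\<close> varies.
\<close>

lemma trivialised_along:
  assumes c: "c \<in> atlas M" and t: "t \<in> chart_times c"
  defines "D \<equiv> frechet_derivative (trivialised L c) (at (snd c (h t), \<eta> t))"
  shows "force t v = D (triv c (snd c (h t)) v, 0)" "momentum t v = D (0, v)" "linear D"
proof -
  have hc: "h t \<in> fst c" using t by (simp add: chart_times_def)
  let ?S = "(snd c ` fst c) \<times> (UNIV :: 'e set)"
  have S: "open ?S" "(snd c (h t), \<eta> t) \<in> ?S"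
    using hc chart_open[OF c] by (auto intro: open_Times)
  have D: "(trivialised L c has_derivative D) (at (snd c (h t), \<eta> t))"
    unfolding D_def by (rule smooth_on_has_derivative[OF trivialised_smooth(2)[OF L c] S])
  show "force t v = D (triv c (snd c (h t)) v, 0)" "momentum t v = D (0, v)" "linear D"
    unfolding force_def momentum_def
    using covector_pull_partial_h_eq[OF c hc D] partial_eta_eq[OF c hc D] has_derivative_linear[OF D]
    by auto
qed

lemma momentum_linear: "t \<in> I \<Longrightarrow> linear (momentum t)"
proof -
  assume "t \<in> I"
  note t = trivialised_along[OF chart_times_at[OF this]]
  show ?thesis
    by (rule linearI) (simp_all add: t del: real_scaleR_def flip: linear_add[OF t(3)] linear_scale[OF t(3)])
qed

lemma force_linear: "t \<in> I \<Longrightarrow> linear (force t)"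
proof -
  assume tI: "t \<in> I"
  let ?c = "chart_at M (h t)"
  note t = trivialised_along[OF chart_times_at[OF tI]]
  have l: "linear (triv ?c (snd ?c (h t)))"
    using chart_times_at[OF tI] by (intro triv_linear) (auto simp: chart_times_def)
  show ?thesis
    by (rule linearI)
      (simp_all add: t linear_add[OF l] linear_scale[OF l] del: real_scaleR_def
        flip: linear_add[OF t(3)] linear_scale[OF t(3)])
qed

lemma force_momentum_smooth:
  assumes c: "c \<in> atlas M"
  shows "smooth_on (chart_times c) (\<lambda>t. force t v)" "smooth_on (chart_times c) (\<lambda>t. momentum t v)"
proof -
  let ?S = "(snd c ` fst c) \<times> (UNIV :: 'e set)"
  have S: "open ?S" using chart_open[OF c] by (auto intro: open_Times)
  have y: "smooth_on (chart_times c) (\<lambda>t. snd c (h t))"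
    using curve_coord_smooth[OF c] by (simp add: comp_def)
  have "smooth_on (chart_times c) \<eta>"
    by (rule smooth_on_subset[OF eta_smooth]) (auto simp: chart_times_def)
  then have p: "smooth_on (chart_times c) (\<lambda>t. (snd c (h t), \<eta> t))"
    using y by (intro smooth_on_Pair)
  have sub: "(\<lambda>t. (snd c (h t), \<eta> t)) ` chart_times c \<subseteq> ?S" by (auto simp: chart_times_def)
  note dir = smooth_on_directional_derivative[OF frame_prod[OF E E] trivialised_smooth(2)[OF L c] S p sub]
  have "(\<lambda>t. snd c (h t)) ` chart_times c \<subseteq> snd c ` fst c" by (auto simp: chart_times_def)
  from smooth_on_compose[OF E triv_smooth_fixed[OF c] y this]
  have "smooth_on (chart_times c) (\<lambda>t. triv c (snd c (h t)) v)" .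
  then have "smooth_on (chart_times c) (\<lambda>t. (triv c (snd c (h t)) v, 0 :: 'e))"
    by (intro smooth_on_Pair smooth_on_const)
  from dir[OF this] show "smooth_on (chart_times c) (\<lambda>t. force t v)"
    by (rule smooth_on_cong) (simp add: trivialised_along[OF c])
  have "smooth_on (chart_times c) (\<lambda>t. (0 :: 'e, v))" by (rule smooth_on_const)
  from dir[OF this] show "smooth_on (chart_times c) (\<lambda>t. momentum t v)"
    by (rule smooth_on_cong) (simp add: trivialised_along[OF c])
qed

text \<open>
  Continuity is local, so it suffices to check it on the times spent in each chart.
\<close>

lemma continuous_on_chart_times:
  assumes "\<And>c. c \<in> atlas M \<Longrightarrow> continuous_on (chart_times c) f"
  shows "continuous_on I f"
  unfolding continuous_on_eq_continuous_within
proof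
  fix t assume t: "t \<in> I"
  note c = chart_times_at[OF t]
  have "continuous (at t within chart_times (chart_at M (h t))) f"
    using assms[OF c(1)] c(2) by (simp add: continuous_on_eq_continuous_within)
  then show "continuous (at t within I) f"
    by (simp add: at_within_openin[OF chart_times_openin[OF c(1)] c(2)])
qed

lemma continuous_on_vector_derivative:
  assumes U: "openin (top_of_set I) U" and f: "smooth_on U f"
  shows "continuous_on U (\<lambda>t. vector_derivative f (at t within I))"
proof -
  have "Ck_on (Suc 0) U f" using f by (simp add: smooth_on_def)
  then obtain f' where f': "\<And>t. t \<in> U \<Longrightarrow> (f has_derivative f' t) (at t within U)"
    "\<And>v. Ck_on 0 U (\<lambda>t. f' t v)" unfolding Ck_on.simps(2) by blast
  have "continuous_on U (\<lambda>t. f' t 1)" using f'(2)[of 1] by simp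
  then show ?thesis
  proof (rule continuous_on_eq)
    fix t assume t: "t \<in> U"
    have tI: "t \<in> I" using openin_subset[OF U] t by auto
    have "f' t r = r *\<^sub>R f' t 1" for r
      using linear_scale[OF has_derivative_linear[OF f'(1)[OF t]], of r 1] by simp
    then have "f' t = (\<lambda>r. r *\<^sub>R f' t 1)" by (rule ext)
    then have "(f has_vector_derivative f' t 1) (at t within I)"
      unfolding has_vector_derivative_def at_within_openin[OF U t, symmetric]
      using f'(1)[OF t] by metis
    from vector_derivative_I[OF tI this]
    show "f' t 1 = vector_derivative f (at t within I)" by (rule sym)
  qed
qed

abbreviation momentum' where "momentum' \<equiv> covector_derivative I momentum"

lemma momentum_has_vector_derivative:
  assumes t: "t \<in> I"
  shows "((\<lambda>s. momentum s v) has_vector_derivative momentum' t v) (at t within I)"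
proof -
  note c = chart_times_at[OF t]
  from smooth_on_has_vector_derivative[OF force_momentum_smooth(2)[OF c(1)] c(2)]
  show ?thesis
    unfolding covector_derivative_def at_within_openin[OF chart_times_openin[OF c(1)] c(2)] .
qed

lemma momentum'_linear:
  assumes t: "t \<in> I"
  shows "linear (momentum' t)"
proof (rule linearI)
  fix a b and r :: real
  have "((\<lambda>s. momentum s a + momentum s b) has_vector_derivative momentum' t a + momentum' t b)
      (at t within I)"
    by (intro has_vector_derivative_add momentum_has_vector_derivative t)
  then have "((\<lambda>s. momentum s (a + b)) has_vector_derivative momentum' t a + momentum' t b)
      (at t within I)"
    by (rule has_vector_derivative_transform[OF t, rotated]) (simp add: linear_add[OF momentum_linear])
  from vector_derivative_I[OF t this] show "momentum' t (a + b) = momentum' t a + momentum' t b"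
    by (simp add: covector_derivative_def)
  have "((\<lambda>s. r *\<^sub>R momentum s a) has_vector_derivative r *\<^sub>R momentum' t a) (at t within I)"
    by (intro bounded_linear.has_vector_derivative[OF bounded_linear_scaleR_right]
        momentum_has_vector_derivative t)
  then have "((\<lambda>s. momentum s (r *\<^sub>R a)) has_vector_derivative r *\<^sub>R momentum' t a) (at t within I)"
    by (rule has_vector_derivative_transform[OF t, rotated]) (simp add: linear_scale[OF momentum_linear])
  from vector_derivative_I[OF t this] show "momentum' t (r *\<^sub>R a) = r *\<^sub>R momentum' t a"
    by (simp add: covector_derivative_def)
qed

lemma covectors_continuous:
  assumes "continuous_on I w"
  shows "continuous_on I (\<lambda>t. force t (w t))" "continuous_on I (\<lambda>t. momentum t (w t))"
    "continuous_on I (\<lambda>t. momentum' t (w t))"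
proof -
  have F: "continuous_on I (\<lambda>t. force t v)" for v
    by (rule continuous_on_chart_times[OF smooth_on_continuous[OF force_momentum_smooth(1)]])
  show "continuous_on I (\<lambda>t. force t (w t))"
    by (rule continuous_on_linear_family[OF E force_linear F assms])
  have F: "continuous_on I (\<lambda>t. momentum t v)" for v
    by (rule continuous_on_chart_times[OF smooth_on_continuous[OF force_momentum_smooth(2)]])
  show "continuous_on I (\<lambda>t. momentum t (w t))"
    by (rule continuous_on_linear_family[OF E momentum_linear F assms])
  have F: "continuous_on I (\<lambda>t. momentum' t v)" for v
    unfolding covector_derivative_def
    by (rule continuous_on_chart_times[OF continuous_on_vector_derivative[OF
            chart_times_openin force_momentum_smooth(2)]])
  show "continuous_on I (\<lambda>t. momentum' t (w t))"
    by (rule continuous_on_linear_family[OF E momentum'_linear F assms])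
qed

abbreviation deriv where "deriv \<xi> t \<equiv> vector_derivative \<xi> (at t within I)"

lemma generator_derivative:
  assumes "\<xi> \<in> generators t0 t1" "t \<in> I"
  shows "(\<xi> has_vector_derivative deriv \<xi> t) (at t within I)"
  using assms by (intro smooth_on_has_vector_derivative) (auto simp: generators_def)

lemma generator_continuous:
  assumes "\<xi> \<in> generators t0 t1"
  shows "continuous_on I \<xi>" "continuous_on I (deriv \<xi>)" "continuous_on I (\<lambda>t. bracket (\<eta> t) (\<xi> t))"
proof -
  have \<xi>: "smooth_on I \<xi>" using assms by (simp add: generators_def)
  then show "continuous_on I \<xi>" by (rule smooth_on_continuous)
  then show "continuous_on I (\<lambda>t. bracket (\<eta> t) (\<xi> t))"
    by (intro bracket_continuous smooth_on_continuous[OF eta_smooth])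
  show "continuous_on I (deriv \<xi>)" by (rule continuous_on_vector_derivative[OF _ \<xi>]) simp
qed

lemma action_derivative_eq:
  assumes \<xi>: "\<xi> \<in> generators t0 t1"
  shows "action_derivative \<xi>
    = integral I (\<lambda>t. force t (\<xi> t) + momentum t (deriv \<xi> t + bracket (\<eta> t) (\<xi> t)))"
  unfolding action_derivative_def action_differential_def
proof (rule integral_cong)
  fix t assume t: "t \<in> I"
  show "differential (tangent_bundle M) L (admissible_variation G M I h \<xi> t)
      = force t (\<xi> t) + momentum t (deriv \<xi> t + bracket (\<eta> t) (\<xi> t))"
    unfolding force_def momentum_def
    by (rule first_variation[OF t generator_derivative[OF \<xi> t] lagrangian_differentiable[OF L t]])
qed

text \<open>
  The covector whose values on \<open>d'\<close> decide in part (a).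
\<close>

definition euler where
  "euler t v = force t v - momentum' t v + momentum t (bracket (\<eta> t) v)"

lemma euler_linear: "t \<in> I \<Longrightarrow> linear (euler t)"
  unfolding euler_def
  by (intro linear_compose_add linear_compose_sub force_linear momentum'_linear
      linear_compose[OF bracket_linear_right momentum_linear, unfolded comp_def])

lemma euler_continuous:
  "continuous_on I (\<lambda>t. euler t v)"
  unfolding euler_def
  by (intro continuous_intros covectors_continuous bracket_continuous
      smooth_on_continuous[OF eta_smooth])

text \<open>
  Integration by parts: \<open>\<langle>momentum, \<xi>\<rangle>\<close> vanishes at both end-points, so the integral of its derivative is
  zero and may be added.
\<close>

lemma action_derivative_euler:
  assumes \<xi>: "\<xi> \<in> generators t0 t1"
  shows "action_derivative \<xi> = integral I (\<lambda>t. euler t (\<xi> t))"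
proof -
  note c = generator_continuous[OF \<xi>]
  have "((\<lambda>s. momentum s (\<xi> s)) has_vector_derivative momentum' t (\<xi> t) + momentum t (deriv \<xi> t))
      (at t within I)" if t: "t \<in> I" for t
  proof -
    have "((\<lambda>s. momentum s (\<xi> s)) has_derivative
        (\<lambda>r. r *\<^sub>R momentum' t (\<xi> t) + momentum t (r *\<^sub>R deriv \<xi> t))) (at t within I)"
      by (rule has_derivative_linear_family[where F' = "\<lambda>v r. r *\<^sub>R momentum' t v", OF E momentum_linear t])
        (use momentum_has_vector_derivative[OF t] generator_derivative[OF \<xi> t] in
          \<open>auto simp: has_vector_derivative_def\<close>)
    then show ?thesis
      by (simp add: has_vector_derivative_def linear_scale[OF momentum_linear[OF t]] scaleR_right_distrib
          del: real_scaleR_def)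
  qed
  from fundamental_theorem_of_calculus[OF less_imp_le[OF t01] this]
  have "((\<lambda>t. momentum' t (\<xi> t) + momentum t (deriv \<xi> t)) has_integral
      momentum t1 (\<xi> t1) - momentum t0 (\<xi> t0)) I" by simp
  moreover have "momentum t1 (\<xi> t1) - momentum t0 (\<xi> t0) = 0"
    using \<xi> t01 linear_0[OF momentum_linear] by (simp add: generators_def)
  ultimately have 0: "((\<lambda>t. momentum' t (\<xi> t) + momentum t (deriv \<xi> t)) has_integral 0) I" by simp
  have "continuous_on I (\<lambda>t. euler t (\<xi> t))"
    by (rule continuous_on_linear_family[OF E euler_linear euler_continuous c(1)])
  then have "((\<lambda>t. euler t (\<xi> t)) has_integral integral I (\<lambda>t. euler t (\<xi> t))) I"
    by (intro integrable_integral integrable_continuous_interval)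
  from has_integral_add[OF this 0]
  have "((\<lambda>t. euler t (\<xi> t) + (momentum' t (\<xi> t) + momentum t (deriv \<xi> t))) has_integral
      integral I (\<lambda>t. euler t (\<xi> t))) I" by simp
  then have "((\<lambda>t. force t (\<xi> t) + momentum t (deriv \<xi> t + bracket (\<eta> t) (\<xi> t))) has_integral
      integral I (\<lambda>t. euler t (\<xi> t))) I"
    by (rule has_integral_eq[rotated]) (simp add: euler_def linear_add[OF momentum_linear])
  then show ?thesis using action_derivative_eq[OF \<xi>] by (simp add: integral_unique)
qed

lemma polynomial_generator:
  assumes "real_polynomial_function p"
  shows "(\<lambda>t. ((t - t0) * (t1 - t) * p t) *\<^sub>R v) \<in> generators t0 t1"
proof -
  have "real_polynomial_function (\<lambda>t::real. t)"
    by (rule real_polynomial_function.intros(1)) (rule bounded_linear_ident)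
  then have "real_polynomial_function (\<lambda>t. (t - t0) * (t1 - t) * p t)"
    by (intro real_polynomial_function.intros(4) real_polynomial_function_diff assms
        real_polynomial_function.intros(2))
  from smooth_on_scaleR[OF smooth_on_real_polynomial_function[OF this] smooth_on_const]
  show ?thesis by (simp add: generators_def)
qed

section \<open>Comparison of the three kinds of extremals\<close>

text \<open>
  Generators along a fixed direction \<open>v\<close> suffice to detect a continuous family of covectors on \<open>v\<close>.
\<close>

lemma vanishing_against_generators:
  fixes F :: "real \<Rightarrow> 'e \<Rightarrow> real"
  assumes lin: "\<And>t. t \<in> I \<Longrightarrow> linear (F t)" and cont: "continuous_on I (\<lambda>t. F t v)"
    and zero: "\<And>\<xi>. \<xi> \<in> generators t0 t1 \<Longrightarrow> (\<And>t. \<exists>r. \<xi> t = r *\<^sub>R v) \<Longrightarrow>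
      integral I (\<lambda>t. F t (\<xi> t)) = 0"
    and t: "t \<in> I"
  shows "F t v = 0"
proof (rule fundamental_lemma_calculus_of_variations[OF t01 cont _ t])
  fix p :: "real \<Rightarrow> real" assume p: "real_polynomial_function p"
  have "integral I (\<lambda>t. (t - t0) * (t1 - t) * p t * F t v)
      = integral I (\<lambda>t. F t (((t - t0) * (t1 - t) * p t) *\<^sub>R v))"
    by (rule integral_cong) (simp add: linear_scale[OF lin])
  also have "\<dots> = 0" by (rule zero[OF polynomial_generator[OF p]]) blast
  finally show "integral I (\<lambda>t. (t - t0) * (t1 - t) * p t * F t v) = 0" .
qed

lemma generator_add: "a \<in> generators t0 t1 \<Longrightarrow> b \<in> generators t0 t1 \<Longrightarrow> (\<lambda>t. a t + b t) \<in> generators t0 t1"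
  by (auto simp: generators_def intro: smooth_on_add)

lemma generator_linear_image:
  assumes Q: "bounded_linear Q" and \<xi>: "\<xi> \<in> generators t0 t1"
  shows "(\<lambda>t. Q (\<xi> t)) \<in> generators t0 t1"
    and "t \<in> I \<Longrightarrow> deriv (\<lambda>t. Q (\<xi> t)) t = Q (deriv \<xi> t)"
proof -
  show "(\<lambda>t. Q (\<xi> t)) \<in> generators t0 t1"
    using \<xi> linear_0[OF bounded_linear.linear[OF Q]]
    by (auto simp: generators_def intro: smooth_on_bounded_linear[OF Q])
  show "deriv (\<lambda>t. Q (\<xi> t)) t = Q (deriv \<xi> t)" if "t \<in> I"
    by (rule vector_derivative_I[OF that bounded_linear.has_vector_derivative[OF Q
            generator_derivative[OF \<xi> that]]])
qed

text \<open>
  With \<open>Q\<close> a projection of a splitting: the derivative of a curve in a subspace stays in the subspace.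
\<close>

lemma derivative_in_kernel:
  assumes Q: "bounded_linear Q" and \<xi>: "\<xi> \<in> generators t0 t1" and t: "t \<in> I"
    and zero: "\<And>s. s \<in> I \<Longrightarrow> Q (\<xi> s) = 0"
  shows "Q (deriv \<xi> t) = 0"
proof -
  have "((\<lambda>s. Q (\<xi> s)) has_vector_derivative 0) (at t within I)"
    by (rule has_vector_derivative_transform[OF t _ has_vector_derivative_const]) (simp add: zero)
  from vector_derivative_I[OF t this] show ?thesis
    using generator_linear_image(2)[OF Q \<xi> t] by simp
qed

lemma extremal_wrt_iff:
  assumes "\<forall>t\<in>I. \<eta> t \<in> d"
  shows "extremal_wrt G M t0 t1 d V (\<lambda>t. L) h \<eta> \<longleftrightarrow> (\<forall>\<xi>\<in>V. action_derivative \<xi> = 0)"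
  using assms adm by (simp add: extremal_wrt_def action_derivative_def)

context
  fixes d d' :: "'e set" and P P' :: "'e \<Rightarrow> 'e"
  assumes splitting: "splitting d d' P P'" and eta_d: "\<forall>t\<in>I. \<eta> t \<in> d"
begin

lemma projections_bounded: "bounded_linear P" "bounded_linear P'"
  by (rule frame_bounded_linear[OF E splitting_linear(1)[OF splitting]]
      frame_bounded_linear[OF E splitting_linear(2)[OF splitting]])+

lemma projections_sum: "P x + P' x = x" and projections_mem: "P x \<in> d" "P' x \<in> d'"
  using splitting by (auto simp: splitting_def)

lemmas mem_d_iff = splitting_mem_iff(1)[OF splitting]
  and mem_d'_iff = splitting_mem_iff(2)[OF splitting]

lemma projection_fixed: "x \<in> d' \<Longrightarrow> P' x = x"
  using projections_sum[of x] by (simp add: mem_d'_iff)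

lemma nonholonomic_extremal_iff:
  "nonholonomic_extremal G M t0 t1 d (\<lambda>t. L) h \<eta> \<longleftrightarrow>
    (\<forall>\<xi>\<in>generators t0 t1. (\<forall>t\<in>I. \<xi> t \<in> d) \<longrightarrow> action_derivative \<xi> = 0)"
  unfolding nonholonomic_extremal_def extremal_wrt_iff[OF eta_d] by auto

text \<open>
  Along a nonholonomic extremal, replacing a generator \<open>\<xi>\<close> by \<open>P\<xi>\<close> gives a first variation of zero,
  so only the values of the Euler covector on \<open>d'\<close> matter.
\<close>

lemma unconstrained_iff_euler_annihilates_complement:
  assumes nonhol: "nonholonomic_extremal G M t0 t1 d (\<lambda>t. L) h \<eta>"
  shows "unconstrained_extremal G M t0 t1 d (\<lambda>t. L) h \<eta> \<longleftrightarrow> (\<forall>t\<in>I. \<forall>b\<in>d'. euler t b = 0)"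
  unfolding unconstrained_extremal_def extremal_wrt_iff[OF eta_d]
proof (intro iffI ballI)
  fix t b assume all: "\<forall>\<xi>\<in>generators t0 t1. action_derivative \<xi> = 0" and t: "t \<in> I"
  show "euler t b = 0"
    by (rule vanishing_against_generators[OF euler_linear euler_continuous _ t])
      (use all action_derivative_euler in auto)
next
  fix \<xi> :: "real \<Rightarrow> 'e"
  assume b: "\<forall>t\<in>I. \<forall>b\<in>d'. euler t b = 0" and \<xi>: "\<xi> \<in> generators t0 t1"
  note P\<xi> = generator_linear_image(1)[OF projections_bounded(1) \<xi>]
  have "action_derivative \<xi> = integral I (\<lambda>t. euler t (P (\<xi> t)))"
    unfolding action_derivative_euler[OF \<xi>]
  proof (rule integral_cong)
    fix t assume t: "t \<in> I"
    have "euler t (\<xi> t) = euler t (P (\<xi> t) + P' (\<xi> t))" by (simp only: projections_sum)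
    also have "\<dots> = euler t (P (\<xi> t)) + euler t (P' (\<xi> t))"
      by (rule linear_add[OF euler_linear[OF t]])
    also have "euler t (P' (\<xi> t)) = 0" using b t projections_mem by blast
    finally show "euler t (\<xi> t) = euler t (P (\<xi> t))" by simp
  qed
  also have "\<dots> = action_derivative (\<lambda>t. P (\<xi> t))" using action_derivative_euler[OF P\<xi>] by simp
  also have "\<dots> = 0"
    using nonhol[unfolded nonholonomic_extremal_iff, rule_format, OF P\<xi>] projections_mem(1) by simp
  finally show "action_derivative \<xi> = 0" .
qed

lemma vakonomic_generator_iff:
  assumes \<xi>: "\<xi> \<in> generators t0 t1" and t: "t \<in> I"
  shows "tangent_to (tangent_bundle M) (constraint_distribution G M d)
      (admissible_variation G M I h \<xi> t) \<longleftrightarrow> P' (deriv \<xi> t + bracket (\<eta> t) (\<xi> t)) = 0"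
proof -
  have d_eq: "d = {x. P' x = 0}" using mem_d_iff by blast
  have "\<eta> t \<in> d" using eta_d t by blast
  from admissible_variation_tangent_iff[OF t generator_derivative[OF \<xi> t] this
      projections_bounded(2) d_eq]
  show ?thesis unfolding mem_d_iff .
qed

text \<open>
  The \<open>d'\<close>-part of \<open>\<xi>' + [\<eta>, \<xi>]\<close> for \<open>\<xi> = a + b\<close> is the left side of the differential equation of
  part (b).
\<close>

lemma linearised_constraint_of_sum:
  assumes a: "a \<in> generators t0 t1" "\<forall>t\<in>I. a t \<in> d" and b: "b \<in> generators t0 t1" "\<forall>t\<in>I. b t \<in> d'"
    and t: "t \<in> I"
  shows "P' (deriv (\<lambda>t. a t + b t) t + bracket (\<eta> t) (a t + b t))
    = deriv b t + P' (bracket (\<eta> t) (a t)) + P' (bracket (\<eta> t) (b t))"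
proof -
  have "deriv (\<lambda>t. a t + b t) t = deriv a t + deriv b t"
    by (rule vector_derivative_I[OF t has_vector_derivative_add[OF
            generator_derivative[OF a(1) t] generator_derivative[OF b(1) t]]])
  moreover have "P' (deriv a t) = 0"
    by (rule derivative_in_kernel[OF projections_bounded(2) a(1) t]) (use a(2) mem_d_iff in blast)
  moreover have "P (deriv b t) = 0"
    by (rule derivative_in_kernel[OF projections_bounded(1) b(1) t]) (use b(2) mem_d'_iff in blast)
  ultimately show ?thesis
    using projection_fixed[of "deriv b t"] mem_d'_iff
    by (simp add: linear_add[OF bracket_linear_right] linear_add[OF splitting_linear(2)[OF splitting]])
qed

text \<open>
  Under the differential equation, \<open>b' + [\<eta>, b] = P[\<eta>, b] - P'[\<eta>, a]\<close>; hence the first variation along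
  \<open>a + b\<close> exceeds the one along \<open>a\<close> by the difference of the two integrals compared in part (b).
\<close>

lemma action_derivative_split:
  assumes a: "a \<in> generators t0 t1" "\<forall>t\<in>I. a t \<in> d" and b: "b \<in> generators t0 t1" "\<forall>t\<in>I. b t \<in> d'"
    and eq: "\<forall>t\<in>I. deriv b t + P' (bracket (\<eta> t) (a t)) + P' (bracket (\<eta> t) (b t)) = 0"
  shows "action_derivative (\<lambda>t. a t + b t) = action_derivative a
    + (integral I (\<lambda>t. force t (b t) + momentum t (P (bracket (\<eta> t) (b t))))
       - integral I (\<lambda>t. momentum t (P' (bracket (\<eta> t) (a t)))))"
proof -
  let ?A = "\<lambda>t. force t (a t) + momentum t (deriv a t + bracket (\<eta> t) (a t))"
  let ?B = "\<lambda>t. force t (b t) + momentum t (P (bracket (\<eta> t) (b t)))"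
  let ?C = "\<lambda>t. momentum t (P' (bracket (\<eta> t) (a t)))"
  note ca = generator_continuous[OF a(1)] and cb = generator_continuous[OF b(1)]
  have A: "?A integrable_on I" and B: "?B integrable_on I" and C: "?C integrable_on I"
    by (intro integrable_continuous_interval continuous_on_add covectors_continuous ca cb
        bounded_linear.continuous_on[OF projections_bounded(1)]
        bounded_linear.continuous_on[OF projections_bounded(2)])+
  have "action_derivative (\<lambda>t. a t + b t) = integral I (\<lambda>t. ?A t + (?B t - ?C t))"
    unfolding action_derivative_eq[OF generator_add[OF a(1) b(1)]]
  proof (rule integral_cong)
    fix t assume t: "t \<in> I"
    have "deriv (\<lambda>t. a t + b t) t = deriv a t + deriv b t"
      by (rule vector_derivative_I[OF t has_vector_derivative_add[OF
              generator_derivative[OF a(1) t] generator_derivative[OF b(1) t]]])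
    moreover have "deriv b t + bracket (\<eta> t) (b t)
        = P (bracket (\<eta> t) (b t)) - P' (bracket (\<eta> t) (a t))"
    proof -
      have "deriv b t + bracket (\<eta> t) (b t)
          = deriv b t + (P (bracket (\<eta> t) (b t)) + P' (bracket (\<eta> t) (b t)))"
        by (simp only: projections_sum)
      also have "\<dots> = (deriv b t + P' (bracket (\<eta> t) (a t)) + P' (bracket (\<eta> t) (b t)))
          + (P (bracket (\<eta> t) (b t)) - P' (bracket (\<eta> t) (a t)))"
        by (simp add: algebra_simps)
      also have "deriv b t + P' (bracket (\<eta> t) (a t)) + P' (bracket (\<eta> t) (b t)) = 0"
        using eq t by blast
      finally show ?thesis by (simp only: add_0_left)
    qed
    ultimately have "deriv (\<lambda>t. a t + b t) t + bracket (\<eta> t) (a t + b t)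
        = (deriv a t + bracket (\<eta> t) (a t))
          + (P (bracket (\<eta> t) (b t)) - P' (bracket (\<eta> t) (a t)))"
      by (simp add: linear_add[OF bracket_linear_right] algebra_simps)
    then show "force t (a t + b t) + momentum t (deriv (\<lambda>t. a t + b t) t + bracket (\<eta> t) (a t + b t))
        = ?A t + (?B t - ?C t)"
      by (simp add: linear_add[OF force_linear[OF t]] linear_add[OF momentum_linear[OF t]]
          linear_diff[OF momentum_linear[OF t]])
  qed
  also have "\<dots> = integral I ?A + (integral I ?B - integral I ?C)"
    using A B C by (simp add: integral_add integral_diff integrable_diff)
  finally show ?thesis using action_derivative_eq[OF a(1)] by simp
qed

text \<open>
  A generator tangent to the constraint is the same as a pair \<open>a = P\<xi>\<close>, \<open>b = P'\<xi>\<close> solving the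
  differential equation, and the first variation along \<open>a\<close> is zero.
\<close>

lemma vakonomic_iff_integral_identity:
  assumes nonhol: "nonholonomic_extremal G M t0 t1 d (\<lambda>t. L) h \<eta>"
  shows "vakonomic_extremal G M t0 t1 d (\<lambda>t. L) h \<eta> \<longleftrightarrow>
    (\<forall>a b. a \<in> generators t0 t1 \<longrightarrow> b \<in> generators t0 t1 \<longrightarrow> (\<forall>t\<in>I. a t \<in> d \<and> b t \<in> d') \<longrightarrow>
      (\<forall>t\<in>I. deriv b t + P' (bracket (\<eta> t) (a t)) + P' (bracket (\<eta> t) (b t)) = 0) \<longrightarrow>
      integral I (\<lambda>t. force t (b t) + momentum t (P (bracket (\<eta> t) (b t))))
      = integral I (\<lambda>t. momentum t (P' (bracket (\<eta> t) (a t)))))"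
    (is "_ \<longleftrightarrow> ?R")
proof -
  have zero: "action_derivative a = 0" if "a \<in> generators t0 t1" "\<forall>t\<in>I. a t \<in> d" for a
    using nonhol that unfolding nonholonomic_extremal_iff by blast
  have V: "vakonomic_extremal G M t0 t1 d (\<lambda>t. L) h \<eta> \<longleftrightarrow>
    (\<forall>\<xi>\<in>generators t0 t1. (\<forall>t\<in>I. P' (deriv \<xi> t + bracket (\<eta> t) (\<xi> t)) = 0) \<longrightarrow>
       action_derivative \<xi> = 0)"
    unfolding vakonomic_extremal_def extremal_wrt_iff[OF eta_d]
    using vakonomic_generator_iff by auto
  show ?thesis
    unfolding V
  proof
    assume vak: "\<forall>\<xi>\<in>generators t0 t1. (\<forall>t\<in>I. P' (deriv \<xi> t + bracket (\<eta> t) (\<xi> t)) = 0) \<longrightarrow>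
       action_derivative \<xi> = 0"
    show ?R
    proof (intro allI impI)
      fix a b :: "real \<Rightarrow> 'e"
      assume a: "a \<in> generators t0 t1" and b: "b \<in> generators t0 t1"
        and ab: "\<forall>t\<in>I. a t \<in> d \<and> b t \<in> d'"
        and eq: "\<forall>t\<in>I. deriv b t + P' (bracket (\<eta> t) (a t)) + P' (bracket (\<eta> t) (b t)) = 0"
      have ad: "\<forall>t\<in>I. a t \<in> d" and bd: "\<forall>t\<in>I. b t \<in> d'" using ab by auto
      have "action_derivative (\<lambda>t. a t + b t) = 0"
        using vak generator_add[OF a b] linearised_constraint_of_sum[OF a ad b bd] eq by simp
      then show "integral I (\<lambda>t. force t (b t) + momentum t (P (bracket (\<eta> t) (b t))))
          = integral I (\<lambda>t. momentum t (P' (bracket (\<eta> t) (a t))))"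
        using action_derivative_split[OF a ad b bd eq] zero[OF a ad] by simp
    qed
  next
    assume R: ?R
    show "\<forall>\<xi>\<in>generators t0 t1. (\<forall>t\<in>I. P' (deriv \<xi> t + bracket (\<eta> t) (\<xi> t)) = 0) \<longrightarrow>
       action_derivative \<xi> = 0"
    proof (intro ballI impI)
      fix \<xi> :: "real \<Rightarrow> 'e" assume \<xi>: "\<xi> \<in> generators t0 t1"
        and c: "\<forall>t\<in>I. P' (deriv \<xi> t + bracket (\<eta> t) (\<xi> t)) = 0"
      let ?a = "\<lambda>t. P (\<xi> t)" and ?b = "\<lambda>t. P' (\<xi> t)"
      have a: "?a \<in> generators t0 t1" and b: "?b \<in> generators t0 t1"
        using generator_linear_image(1)[OF _ \<xi>] projections_bounded by auto
      have ad: "\<forall>t\<in>I. ?a t \<in> d" and bd: "\<forall>t\<in>I. ?b t \<in> d'" using projections_mem by auto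
      have eq: "\<forall>t\<in>I. deriv ?b t + P' (bracket (\<eta> t) (?a t)) + P' (bracket (\<eta> t) (?b t)) = 0"
        using c by (simp add: projections_sum flip: linearised_constraint_of_sum[OF a ad b bd])
      have "integral I (\<lambda>t. force t (?b t) + momentum t (P (bracket (\<eta> t) (?b t))))
          = integral I (\<lambda>t. momentum t (P' (bracket (\<eta> t) (?a t))))"
        using R a b ad bd eq by blast
      with action_derivative_split[OF a ad b bd eq] zero[OF a ad]
      show "action_derivative \<xi> = 0" by (simp add: projections_sum)
    qed
  qed
qed

text \<open>
  For \<open>\<xi>\<close> in \<open>d\<close> the first variations of the two Lagrangians differ by the integral of
  \<open>\<langle>\<lambda>, P'[\<eta>, \<xi>]\<rangle>\<close>, and the one of the modified Lagrangian is zero.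
\<close>

lemma nonholonomic_iff_multiplier_condition:
  assumes lam: "multiplier t0 t1 d P' lam"
    and unc: "unconstrained_extremal G M t0 t1 d (modified_lagrangian G M P' L lam) h \<eta>"
  shows "nonholonomic_extremal G M t0 t1 d (\<lambda>t. L) h \<eta> \<longleftrightarrow>
    (\<forall>t\<in>I. \<forall>a\<in>d. lam t (P' (bracket (\<eta> t) a)) = 0)"
proof -
  have lam_linear: "linear (lam t)" if "t \<in> I" for t
    using lam that by (simp add: multiplier_def annihilator_def)
  have lam_cont: "continuous_on I (\<lambda>t. lam t v)" for v
    using lam by (intro smooth_on_continuous) (simp add: multiplier_def)
  let ?F = "\<lambda>t v. lam t (P' (bracket (\<eta> t) v))"
  have F_linear: "linear (?F t)" if "t \<in> I" for t
    using linear_compose[OF bracket_linear_right linear_compose[OF splitting_linear(2)[OF splitting]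
          lam_linear[OF that]], of "\<eta> t"] by (simp add: comp_def)
  have F_cont: "continuous_on I (\<lambda>t. ?F t (w t))" if "continuous_on I w" for w
    by (rule continuous_on_linear_family[OF E lam_linear lam_cont])
      (auto intro!: bounded_linear.continuous_on[OF projections_bounded(2)] bracket_continuous that
        smooth_on_continuous[OF eta_smooth])
  have key: "action_derivative \<xi> = integral I (\<lambda>t. ?F t (\<xi> t))"
    if \<xi>: "\<xi> \<in> generators t0 t1" and \<xi>d: "\<forall>t\<in>I. \<xi> t \<in> d" for \<xi>
  proof -
    note c = generator_continuous[OF \<xi>]
    let ?A = "\<lambda>t. force t (\<xi> t) + momentum t (deriv \<xi> t + bracket (\<eta> t) (\<xi> t))"
    have "0 = action_differential M I (modified_lagrangian G M P' L lam) (admissible_variation G M I h \<xi>)"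
      using unc \<xi> by (simp add: unconstrained_extremal_def extremal_wrt_def)
    also have "\<dots> = integral I (\<lambda>t. ?A t - ?F t (\<xi> t))"
      unfolding action_differential_def
    proof (rule integral_cong)
      fix t assume t: "t \<in> I"
      have "P' (deriv \<xi> t) = 0"
        by (rule derivative_in_kernel[OF projections_bounded(2) \<xi> t]) (use \<xi>d mem_d_iff in blast)
      then have "P' (deriv \<xi> t + bracket (\<eta> t) (\<xi> t)) = P' (bracket (\<eta> t) (\<xi> t))"
        by (simp add: linear_add[OF splitting_linear(2)[OF splitting]])
      moreover have "linear (\<lambda>x. lam t (P' x))"
        using linear_compose[OF splitting_linear(2)[OF splitting] lam_linear[OF t]]
        by (simp add: comp_def)
      ultimately show "differential (tangent_bundle M) (modified_lagrangian G M P' L lam t)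
          (admissible_variation G M I h \<xi> t) = ?A t - ?F t (\<xi> t)"
        using first_variation_modified[OF L t generator_derivative[OF \<xi> t], of lam P']
        by (simp add: force_def momentum_def)
    qed
    also have "\<dots> = integral I ?A - integral I (\<lambda>t. ?F t (\<xi> t))"
      by (intro integral_diff integrable_continuous_interval continuous_on_add covectors_continuous
          F_cont c)
    finally show ?thesis using action_derivative_eq[OF \<xi>] by simp
  qed
  show ?thesis
    unfolding nonholonomic_extremal_iff
  proof (intro iffI ballI impI)
    fix t a assume nonhol: "\<forall>\<xi>\<in>generators t0 t1. (\<forall>t\<in>I. \<xi> t \<in> d) \<longrightarrow> action_derivative \<xi> = 0"
      and t: "t \<in> I" and a: "a \<in> d"
    show "?F t a = 0"
    proof (rule vanishing_against_generators[OF F_linear F_cont[OF continuous_on_const] _ t])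
      fix \<xi> :: "real \<Rightarrow> 'e" assume \<xi>: "\<xi> \<in> generators t0 t1" and "\<And>t. \<exists>r. \<xi> t = r *\<^sub>R a"
      then have "\<forall>t\<in>I. \<xi> t \<in> d"
        using a splitting by (metis splitting_def subspace_scale)
      then show "integral I (\<lambda>t. ?F t (\<xi> t)) = 0" using key \<xi> nonhol by simp
    qed
  next
    fix \<xi> :: "real \<Rightarrow> 'e" assume z: "\<forall>t\<in>I. \<forall>a\<in>d. ?F t a = 0" and \<xi>: "\<xi> \<in> generators t0 t1" "\<forall>t\<in>I. \<xi> t \<in> d"
    have "integral I (\<lambda>t. ?F t (\<xi> t)) = integral I (\<lambda>t. 0)"
      by (rule integral_cong) (use z \<xi> in blast)
    then show "action_derivative \<xi> = 0" using key[OF \<xi>] by simp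
  qed
qed

end

end

theorem theorem5p3:
  fixes G :: "('a, 'g) monoid_scheme"
    and M :: "('a, 'e::real_inner) manifold"
    and L :: "'a \<times> 'e \<Rightarrow> real"
    and d d' :: "'e set"
    and P P' :: "'e \<Rightarrow> 'e"
    and t0 t1 :: real
  assumes "t0 < t1"
    and "lie_group G M"
    and "smooth_fun (tangent_bundle M) L"
    and "splitting d d' P P'"
  shows
    "(\<forall>h \<eta>. nonholonomic_extremal G M t0 t1 d (\<lambda>t. L) h \<eta> \<longrightarrow>
        (unconstrained_extremal G M t0 t1 d (\<lambda>t. L) h \<eta> \<longleftrightarrow>
         (\<forall>t\<in>{t0..t1}. \<forall>b\<in>d'.
            covector_pull G M (h t) (partial_h G M L (h t) (\<eta> t)) b
            - covector_derivative {t0..t1} (\<lambda>s. partial_eta G M L (h s) (\<eta> s)) t b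
            + ad_star G M (\<eta> t) (partial_eta G M L (h t) (\<eta> t)) b = 0)))
     \<and>
     (\<forall>h \<eta>. nonholonomic_extremal G M t0 t1 d (\<lambda>t. L) h \<eta> \<longrightarrow>
        (vakonomic_extremal G M t0 t1 d (\<lambda>t. L) h \<eta> \<longleftrightarrow>
         (\<forall>a b. a \<in> generators t0 t1 \<longrightarrow> b \<in> generators t0 t1 \<longrightarrow>
            (\<forall>t\<in>{t0..t1}. a t \<in> d \<and> b t \<in> d') \<longrightarrow>
            (\<forall>t\<in>{t0..t1}. vector_derivative b (at t within {t0..t1})
               + P' (lie_algebra_bracket G M (\<eta> t) (a t))
               + P' (lie_algebra_bracket G M (\<eta> t) (b t)) = 0) \<longrightarrow>
            integral {t0..t1} (\<lambda>t.
               covector_pull G M (h t) (partial_h G M L (h t) (\<eta> t)) (b t)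
               + ad_star G M (\<eta> t) (dual_map P (partial_eta G M L (h t) (\<eta> t))) (b t))
            = integral {t0..t1} (\<lambda>t.
               ad_star G M (\<eta> t) (dual_map P' (partial_eta G M L (h t) (\<eta> t))) (a t)))))
     \<and>
     (\<forall>lam h \<eta>. vakonomic_extremal_with_multiplier G M t0 t1 d P' L lam h \<eta> \<longrightarrow>
        (nonholonomic_extremal G M t0 t1 d (\<lambda>t. L) h \<eta> \<longleftrightarrow>
         (\<forall>t\<in>{t0..t1}. \<forall>a\<in>d. lam t (P' (lie_algebra_bracket G M (\<eta> t) a)) = 0)))"
proof -
  have "smooth_manifold M" using assms(2) by (simp add: lie_group_def)
  then obtain B :: "'e set" where "finite B" "span B = UNIV"
    unfolding smooth_manifold_def by blast
  then obtain E :: "'e set" where E: "frame E" by (rule frame_exists)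
  have curve: "lagrangian_curve G M E t0 t1 h \<eta> L" if "admissible G M {t0..t1} h \<eta>" for h \<eta>
    using assms(1-3) E that by unfold_locales
  have nonhol: "lagrangian_curve G M E t0 t1 h \<eta> L" "\<forall>t\<in>{t0..t1}. \<eta> t \<in> d"
    if "nonholonomic_extremal G M t0 t1 d (\<lambda>t. L) h \<eta>" for h \<eta>
    using that curve by (auto simp: nonholonomic_extremal_def extremal_wrt_def)
  show ?thesis
  proof (intro conjI allI impI)
    fix h \<eta> assume nh: "nonholonomic_extremal G M t0 t1 d (\<lambda>t. L) h \<eta>"
    interpret lagrangian_curve G M E t0 t1 h \<eta> L by (rule nonhol(1)[OF nh])
    show "unconstrained_extremal G M t0 t1 d (\<lambda>t. L) h \<eta> \<longleftrightarrow>
         (\<forall>t\<in>{t0..t1}. \<forall>b\<in>d'.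
            covector_pull G M (h t) (partial_h G M L (h t) (\<eta> t)) b
            - covector_derivative {t0..t1} (\<lambda>s. partial_eta G M L (h s) (\<eta> s)) t b
            + ad_star G M (\<eta> t) (partial_eta G M L (h t) (\<eta> t)) b = 0)"
      using unconstrained_iff_euler_annihilates_complement[OF assms(4) nonhol(2)[OF nh] nh]
      unfolding euler_def force_def momentum_def ad_star_def covector_derivative_def .
    show "vakonomic_extremal G M t0 t1 d (\<lambda>t. L) h \<eta> \<longleftrightarrow>
         (\<forall>a b. a \<in> generators t0 t1 \<longrightarrow> b \<in> generators t0 t1 \<longrightarrow>
            (\<forall>t\<in>{t0..t1}. a t \<in> d \<and> b t \<in> d') \<longrightarrow>
            (\<forall>t\<in>{t0..t1}. vector_derivative b (at t within {t0..t1})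
               + P' (lie_algebra_bracket G M (\<eta> t) (a t))
               + P' (lie_algebra_bracket G M (\<eta> t) (b t)) = 0) \<longrightarrow>
            integral {t0..t1} (\<lambda>t.
               covector_pull G M (h t) (partial_h G M L (h t) (\<eta> t)) (b t)
               + ad_star G M (\<eta> t) (dual_map P (partial_eta G M L (h t) (\<eta> t))) (b t))
            = integral {t0..t1} (\<lambda>t.
               ad_star G M (\<eta> t) (dual_map P' (partial_eta G M L (h t) (\<eta> t))) (a t)))"
      using vakonomic_iff_integral_identity[OF assms(4) nonhol(2)[OF nh] nh]
      unfolding force_def momentum_def ad_star_def dual_map_def comp_def .
  next
    fix lam h \<eta> assume "vakonomic_extremal_with_multiplier G M t0 t1 d P' L lam h \<eta>"
    then have lam: "multiplier t0 t1 d P' lam"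
      and unc: "unconstrained_extremal G M t0 t1 d (modified_lagrangian G M P' L lam) h \<eta>"
      by (auto simp: vakonomic_extremal_with_multiplier_def)
    then have adm: "admissible G M {t0..t1} h \<eta>" and \<eta>d: "\<forall>t\<in>{t0..t1}. \<eta> t \<in> d"
      by (auto simp: unconstrained_extremal_def extremal_wrt_def)
    interpret lagrangian_curve G M E t0 t1 h \<eta> L by (rule curve[OF adm])
    show "nonholonomic_extremal G M t0 t1 d (\<lambda>t. L) h \<eta> \<longleftrightarrow>
         (\<forall>t\<in>{t0..t1}. \<forall>a\<in>d. lam t (P' (lie_algebra_bracket G M (\<eta> t) a)) = 0)"
      by (rule nonholonomic_iff_multiplier_condition[OF assms(4) \<eta>d lam unc])
  qed
qed

end
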